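(* Let $2<a<3$. The operator $\mathscr{L}h=-\frac14\partial_x(xh)+2\mathcal{Q}_0(h,H)$, with domain $\mathscr{D}(\mathscr{L})$, generates a strongly continuous semigroup $(S_0(t))_{t\ge0}$ on $\mathbb{Y}_a^0$, and for any $\nu\in(0,1-\frac a4-2^{1-a})$ there exists $C(\nu)>0$ such that $$\|S_0(t)h\|_{L^1(w_a)}\le C(\nu)\exp(-\nu t)\,\|h\|_{L^1(w_a)}\qquad\text{for any }h\in\mathbb{Y}_a^0\text{ and }t\ge0.$$ Moreover, $$\|\mathscr{L}h\|_{L^1(w_a)}\ge\frac{\nu}{C(\nu)}\,\|h\|_{L^1(w_a)}\qquad\text{for any }h\in\mathscr{D}(\mathscr{L})\cap\mathbb{Y}_a^0.$$
   Context: $H(x)=\frac{2}{\pi(1+x^2)^2}$. Collision operator: $\mathcal{Q}_0(f,g)(x)=\int_{\mathbb{R}}f(x+\frac y2)g(x-\frac y2)\,dy-\frac12f(x)\int_{\mathbb{R}}g(y)\,dy-\frac12g(x)\int_{\mathbb{R}}f(y)\,dy$. $w_a(x)=(1+|x|)^a$, $\|f\|_{L^1(w_a)}=\int_{\mathbb{R}}|f(x)|w_a(x)\,dx$, and $\mathbb{Y}_a^0=\{f\in L^1(w_a):\int f\,dx=\int xf\,dx=\int x^2f\,dx=0\}$, equipped with $\|\cdot\|_{L^1(w_a)}$. The domain of $\mathscr{L}$ in $\mathbb{Y}_a^0$ is $\mathscr{D}(\mathscr{L})\cap\mathbb{Y}_a^0=\{h\in\mathbb{Y}_a^0:\partial_x(xh)\in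 L^1(w_a)\}$ (derivative in the sense of distributions). *)

theory Defs
  imports "HOL-Analysis.Analysis"
begin

definition H :: "real \<Rightarrow> real" where
  "H x = 2 / (pi * (1 + x\<^sup>2)\<^sup>2)"

definition Q0 :: "(real \<Rightarrow> real) \<Rightarrow> (real \<Rightarrow> real) \<Rightarrow> real \<Rightarrow> real" where
  "Q0 f g x = (\<integral>y. f (x + y / 2) * g (x - y / 2) \<partial>lborel)
     - 1 / 2 * f x * (\<integral>y. g y \<partial>lborel) - 1 / 2 * g x * (\<integral>y. f y \<partial>lborel)"

text \<open>Elements of the weighted Lebesgue spaces are represented by functions; equality of elements
  is equality almost everywhere.\<close>

definition weight :: "real \<Rightarrow> real \<Rightarrow> real" where
  "weight a x = (1 + \<bar>x\<bar>) powr a"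

definition L1w :: "real \<Rightarrow> (real \<Rightarrow> real) set" where
  "L1w a = {f. f \<in> borel_measurable lborel \<and> integrable lborel (\<lambda>x. f x * weight a x)}"

definition L1w_norm :: "real \<Rightarrow> (real \<Rightarrow> real) \<Rightarrow> real" where
  "L1w_norm a f = (\<integral>x. \<bar>f x\<bar> * weight a x \<partial>lborel)"

definition Y0 :: "real \<Rightarrow> (real \<Rightarrow> real) set" where
  "Y0 a = {f \<in> L1w a. (\<integral>x. f x \<partial>lborel) = 0 \<and> (\<integral>x. x * f x \<partial>lborel) = 0
     \<and> (\<integral>x. x\<^sup>2 * f x \<partial>lborel) = 0}"

definition test_function :: "(real \<Rightarrow> real) \<Rightarrow> bool" where
  "test_function \<phi> \<longleftrightarrow>
     (\<forall>n. (deriv ^^ n) \<phi> differentiable_on UNIV) \<and> compact (closure {x. \<phi> x \<noteq> 0})"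

definition locally_integrable :: "(real \<Rightarrow> real) \<Rightarrow> bool" where
  "locally_integrable f \<longleftrightarrow> (\<forall>K. compact K \<longrightarrow> set_integrable lborel K f)"

text \<open>The distributional derivative of \<open>f\<close> is the regular distribution given by \<open>g\<close>.\<close>

definition has_distr_deriv :: "(real \<Rightarrow> real) \<Rightarrow> (real \<Rightarrow> real) \<Rightarrow> bool" where
  "has_distr_deriv f g \<longleftrightarrow> locally_integrable f \<and> locally_integrable g \<and>
     (\<forall>\<phi>. test_function \<phi> \<longrightarrow>
        (\<integral>x. f x * deriv \<phi> x \<partial>lborel) = - (\<integral>x. g x * \<phi> x \<partial>lborel))"

text \<open>If it exists as a function, the distributional derivative is unique up to null sets, so the
  choice only selects a representative.\<close>

definition distr_deriv :: "(real \<Rightarrow> real) \<Rightarrow> real \<Rightarrow> real" where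
  "distr_deriv f = (SOME g. has_distr_deriv f g)"

definition Lop :: "(real \<Rightarrow> real) \<Rightarrow> real \<Rightarrow> real" where
  "Lop h x = - (1 / 4) * distr_deriv (\<lambda>y. y * h y) x + 2 * Q0 h H x"

definition dom_L :: "real \<Rightarrow> (real \<Rightarrow> real) set" where
  "dom_L a = {h \<in> Y0 a. \<exists>g \<in> L1w a. has_distr_deriv (\<lambda>x. x * h x) g}"

text \<open>Strongly continuous semigroups of bounded linear operators on a space \<open>X\<close> of functions
  modulo almost everywhere equality, normed by \<open>N\<close>. Linearity and boundedness make each
  \<open>S t\<close> compatible with almost everywhere equality.\<close>

definition strongly_continuous_semigroup ::
  "(real \<Rightarrow> real) set \<Rightarrow> ((real \<Rightarrow> real) \<Rightarrow> real) \<Rightarrow> (real \<Rightarrow> (real \<Rightarrow> real) \<Rightarrow> real \<Rightarrow> real) \<Rightarrow> bool"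
where
  "strongly_continuous_semigroup X N S \<longleftrightarrow>
     (\<forall>t\<ge>0. \<forall>h\<in>X. S t h \<in> X) \<and>
     (\<forall>t\<ge>0. \<forall>h\<in>X. \<forall>k\<in>X. \<forall>c d. AE x in lborel.
        S t (\<lambda>y. c * h y + d * k y) x = c * S t h x + d * S t k x) \<and>
     (\<forall>t\<ge>0. \<exists>M. \<forall>h\<in>X. N (S t h) \<le> M * N h) \<and>
     (\<forall>h\<in>X. AE x in lborel. S 0 h x = h x) \<and>
     (\<forall>s\<ge>0. \<forall>t\<ge>0. \<forall>h\<in>X. AE x in lborel. S (s + t) h x = S s (S t h) x) \<and>
     (\<forall>h\<in>X. \<forall>t\<ge>0. ((\<lambda>s. N (\<lambda>x. S s h x - S t h x)) \<longlongrightarrow> 0) (at t within {0..}))"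

definition has_generator_value ::
  "((real \<Rightarrow> real) \<Rightarrow> real) \<Rightarrow> (real \<Rightarrow> (real \<Rightarrow> real) \<Rightarrow> real \<Rightarrow> real) \<Rightarrow>
     (real \<Rightarrow> real) \<Rightarrow> (real \<Rightarrow> real) \<Rightarrow> bool"
where
  "has_generator_value N S h g \<longleftrightarrow>
     ((\<lambda>t. N (\<lambda>x. (S t h x - h x) / t - g x)) \<longlongrightarrow> 0) (at_right 0)"

text \<open>The infinitesimal generator of \<open>S\<close> is the operator \<open>A\<close> with domain exactly \<open>D\<close>.\<close>

definition generates ::
  "(real \<Rightarrow> real) set \<Rightarrow> ((real \<Rightarrow> real) \<Rightarrow> real) \<Rightarrow> (real \<Rightarrow> real) set \<Rightarrow>
     ((real \<Rightarrow> real) \<Rightarrow> real \<Rightarrow> real) \<Rightarrow> (real \<Rightarrow> (real \<Rightarrow> real) \<Rightarrow> real \<Rightarrow> real) \<Rightarrow> bool"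
where
  "generates X N D A S \<longleftrightarrow> strongly_continuous_semigroup X N S \<and>
     D = {h \<in> X. \<exists>g\<in>X. has_generator_value N S h g} \<and>
     (\<forall>h\<in>D. A h \<in> X \<and> has_generator_value N S h (A h))"

end

theory Submission
  imports Defs "HOL-Probability.Characteristic_Functions" "HOL-Real_Asymp.Real_Asymp"
begin

text \<open>On functions of mass zero \<open>2 Q0 h H = K h - h\<close>, where \<open>K h\<close> is the convolution of \<open>h\<close> with \<open>H\<close>,
  rescaled by \<open>1 / 2\<close> and multiplied by 2. Hence the operator is the generator of the group
  of dilations \<open>T t\<close>, damped by \<open>exp (- t)\<close>, plus the bounded operator \<open>K\<close>, and the semigroup is given by
  the Dyson series. The exact rate is visible in the weak norm \<open>sup |h^(\<xi>)| / |\<xi>|^a\<close>, which is finite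
  because three moments vanish: \<open>T t\<close> has norm \<open>exp (- (1 - a / 4) t)\<close> and \<open>K\<close> has norm \<open>2^(1 - a)\<close>. In
  the weighted \<open>L^1\<close> norm \<open>K\<close> reaches a size arbitrarily close to \<open>2^(1 - a)\<close> up to a term supported in a
  bounded interval, and since the Fourier transform of \<open>H\<close> is integrable against \<open>|\<xi>|^a\<close>, the operator \<open>K\<close>
  maps the weak norm into bounded functions, which controls that term.\<close>

section \<open>Strongly continuous groups with a bounded perturbation\<close>

text \<open>Both parts of the rate are scaling exponents. \<open>T t\<close> stretches lengths by
  exp (t / 4), so the weight can grow by exp (a t / 4) against the damping exp (- t).
  \<open>K\<close> doubles the mass and halves frequencies, which turns the bound |\<xi>|^a into 2 *
  2^(- a) * |\<xi>|^a. The obstacle is that in the weighted norm the second factor is visible only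
  far out: near the origin the weight is about 1, halving lengths gains nothing, and
  \<open>K\<close> multiplies mass by 2. Estimating \<open>K\<close> in that norm alone therefore
  loses the rate, whereas the weak norm sees the cancellation of the moments and gets the right
  factor at every frequency. The range of a has two sources: H decays like |x|^(- 4), so its
  integral against the weight needs a < 3; and |\<xi>|^a must interpolate between the quadratic and
  the cubic Taylor bound for the exponential. Since dilations are invertible, T (- t) is available,
  and the semigroup U is obtained from G t = T (- t) (U t), which solves an integral equation with
  bounded operators only. All of this takes place in a quotient type of integrable functions, where
  norms and vector-valued integrals are at hand.\<close>

lemma has_integral_monomial:
  fixes c t :: real
  assumes "0 \<le> t"
  shows "((\<lambda>s. c * s ^ n) has_integral c * t ^ Suc n / Suc n) {0..t}"
proof -
  have "((\<lambda>s. c * s ^ n) has_integral c * t ^ Suc n / Suc n - c * 0 ^ Suc n / Suc n) {0..t}"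
  proof (rule fundamental_theorem_of_calculus[OF assms])
    fix x :: real
    have "((\<lambda>x. c * x ^ Suc n / Suc n) has_real_derivative c * (real (Suc n) * x ^ n) / Suc n) (at x within {0..t})"
      by (rule derivative_eq_intros refl | simp)+
    then show "((\<lambda>x. c * x ^ Suc n / Suc n) has_vector_derivative c * x ^ n) (at x within {0..t})"
      by (simp add: has_real_derivative_iff_has_vector_derivative)
  qed
  then show ?thesis by simp
qed

lemma pow_over_fact_null: "(\<lambda>n. B * (x ^ n / fact n)) \<longlonglongrightarrow> (0::real)"
  using tendsto_mult_right_zero[OF summable_LIMSEQ_zero[OF summable_exp[of x]], of B]
  by (simp add: field_simps)

text \<open>The right derivative at 0 of an indefinite integral. It computes the derivative of
  \<open>G\<close> at 0 and, later, the generator of the dilations from their integrated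
  form.\<close>

lemma integral_average_tendsto:
  fixes f :: "real \<Rightarrow> 'a::banach"
  assumes "continuous_on {0..1} f"
  shows "((\<lambda>t. integral {0..t} f /\<^sub>R t) \<longlongrightarrow> f 0) (at_right 0)"
proof -
  have "((\<lambda>t. integral {0..t} f) has_vector_derivative f 0) (at 0 within {0..1})"
    by (rule integral_has_vector_derivative) (use assms in auto)
  moreover have "at 0 within {0..1} = (at_right 0 :: real filter)"
    using at_within_Icc_at_right[of "0::real" 1] by simp
  ultimately have "((\<lambda>t. (1 / norm t) *\<^sub>R (integral {0..t} f - t *\<^sub>R f 0)) \<longlongrightarrow> 0) (at_right 0)"
    by (simp add: has_vector_derivative_def has_derivative_within)
  then have "((\<lambda>t. (1 / norm t) *\<^sub>R (integral {0..t} f - t *\<^sub>R f 0) + f 0) \<longlongrightarrow> 0 + f 0) (at_right 0)"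
    by (intro tendsto_intros)
  moreover have "\<forall>\<^sub>F t in at_right 0.
      (1 / norm t) *\<^sub>R (integral {0..t} f - t *\<^sub>R f 0) + f 0 = integral {0..t} f /\<^sub>R t"
    unfolding eventually_at_right_field
    by (intro exI[of _ 1]) (auto simp: algebra_simps divide_inverse)
  ultimately show ?thesis by (auto intro: Lim_transform_eventually)
qed

text \<open>A group rather than a semigroup, because the construction conjugates \<open>K\<close> by
  \<open>T (- s)\<close> and \<open>T s\<close>. The growth bound is two-sided and crude; it serves
  only convergence. The decay for positive times enters later as a hypothesis of its own.\<close>

locale perturbed_group =
  fixes T :: "real \<Rightarrow> 'a::banach \<Rightarrow> 'a" and K :: "'a \<Rightarrow> 'a" and \<omega> :: real
  assumes T_linear: "\<And>t. bounded_linear (T t)"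
    and T_0: "\<And>x. T 0 x = x"
    and T_add: "\<And>s t x. T (s + t) x = T s (T t x)"
    and T_bound: "\<And>t x. norm (T t x) \<le> exp (\<omega> * \<bar>t\<bar>) * norm x"
    and T_cont_0: "\<And>x. ((\<lambda>t. T t x) \<longlongrightarrow> x) (at 0)"
    and K_linear: "bounded_linear K"
    and omega_nonneg: "0 \<le> \<omega>"
begin

lemma T_tendsto_0:
  assumes "(\<tau> \<longlongrightarrow> 0) F"
  shows "((\<lambda>i. T (\<tau> i) x) \<longlongrightarrow> x) F"
proof -
  have "isCont (\<lambda>t. T t x) 0"
    unfolding isCont_def T_0 by (rule T_cont_0)
  then have "((\<lambda>i. T (\<tau> i) x) \<longlongrightarrow> T 0 x) F"
    using assms by (rule isCont_tendsto_compose)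
  then show ?thesis by (simp add: T_0)
qed

text \<open>The group law pulls the fixed operator \<open>T t\<close> out of
  \<open>T (\<tau> i)\<close>, which reduces joint continuity to times near 0; there the growth
  bound controls the moving vector.\<close>

lemma T_tendsto:
  assumes \<tau>: "(\<tau> \<longlongrightarrow> t) F" and u: "(u \<longlongrightarrow> x) F"
  shows "((\<lambda>i. T (\<tau> i) (u i)) \<longlongrightarrow> T t x) F"
proof -
  have 0: "((\<lambda>i. \<tau> i - t) \<longlongrightarrow> 0) F"
    using \<tau> by (simp add: LIM_zero)
  have "((\<lambda>i. exp (\<omega> * \<bar>\<tau> i - t\<bar>) * norm (u i - x)) \<longlongrightarrow> exp (\<omega> * \<bar>0\<bar>) * norm (x - x)) F"
    by (intro tendsto_intros 0 u)
  then have A: "((\<lambda>i. T (\<tau> i - t) (u i - x)) \<longlongrightarrow> 0) F"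
    by (intro Lim_null_comparison[OF always_eventually[OF allI[OF T_bound]]]) simp
  have "((\<lambda>i. T (\<tau> i - t) (u i - x) + T (\<tau> i - t) x) \<longlongrightarrow> 0 + x) F"
    by (intro tendsto_add A T_tendsto_0 0)
  moreover have "T (\<tau> i - t) (u i - x) + T (\<tau> i - t) x = T (\<tau> i - t) (u i)" for i
    by (simp add: bounded_linear.linear[OF T_linear] linear_diff)
  ultimately have "((\<lambda>i. T t (T (\<tau> i - t) (u i))) \<longlongrightarrow> T t x) F"
    by (intro bounded_linear.tendsto[OF T_linear]) simp
  then show ?thesis by (simp flip: T_add)
qed

lemma T_continuous_on [continuous_intros]:
  "continuous_on S \<tau> \<Longrightarrow> continuous_on S u \<Longrightarrow> continuous_on S (\<lambda>s. T (\<tau> s) (u s))"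
  unfolding continuous_on_def by (auto intro!: T_tendsto)

lemma T_diff: "T t (x - y) = T t x - T t y"
  and T_plus: "T t (x + y) = T t x + T t y"
  and T_scaleR: "T t (c *\<^sub>R x) = c *\<^sub>R T t x"
  by (simp_all add: bounded_linear.linear[OF T_linear] linear_diff linear_add linear_scale)

lemma T_minus_cancel: "T t (T (- t) x) = x" "T (- t) (T t x) = x"
  by (simp_all flip: T_add add: T_0)

section \<open>The interaction picture: the conjugated perturbation and uniqueness for its integral
  equation\<close>

definition A :: "real \<Rightarrow> 'a \<Rightarrow> 'a" where
  "A s x = T (- s) (K (T s x))"

lemma A_linear: "bounded_linear (A s)"
  unfolding A_def using bounded_linear_compose[OF T_linear bounded_linear_compose[OF K_linear T_linear]] .

lemma A_diff: "A s (x - y) = A s x - A s y"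
  and A_plus: "A s (x + y) = A s x + A s y"
  and A_scaleR: "A s (c *\<^sub>R x) = c *\<^sub>R A s x"
  by (simp_all add: bounded_linear.linear[OF A_linear] linear_diff linear_add linear_scale)

lemma A_continuous_on [continuous_intros]:
  "continuous_on S \<tau> \<Longrightarrow> continuous_on S u \<Longrightarrow> continuous_on S (\<lambda>s. A (\<tau> s) (u s))"
  unfolding A_def by (intro continuous_intros bounded_linear.continuous_on[OF K_linear])

lemma A_shift: "A (r + s) x = T (- s) (A r (T s x))"
  unfolding A_def by (simp flip: T_add add: add.commute)

definition k :: real where
  "k = (SOME k. 0 < k \<and> (\<forall>x. norm (K x) \<le> k * norm x))"

lemma k_pos: "0 < k" and K_bound: "norm (K x) \<le> k * norm x"
proof -
  have "\<exists>k>0. \<forall>x. norm (K x) \<le> k * norm x"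
    using bounded_linear.pos_bounded[OF K_linear] by (metis mult.commute)
  then have "0 < k \<and> (\<forall>x. norm (K x) \<le> k * norm x)"
    unfolding k_def by (rule someI_ex)
  then show "0 < k" "norm (K x) \<le> k * norm x" by auto
qed

text \<open>The bound for \<open>A\<close> on {0..R}: \<open>T (- s)\<close> and \<open>T s\<close>
  contribute one factor exp (\<omega> s) each.\<close>

definition m :: "real \<Rightarrow> real" where
  "m R = exp (2 * \<omega> * R) * k"

lemma m_pos: "0 < m R"
  by (simp add: m_def k_pos)

lemma A_bound:
  assumes "0 \<le> s" "s \<le> R"
  shows "norm (A s x) \<le> m R * norm x"
proof -
  have "norm (A s x) \<le> exp (\<omega> * \<bar>- s\<bar>) * norm (K (T s x))"
    unfolding A_def by (rule T_bound)
  also have "\<dots> \<le> exp (\<omega> * \<bar>- s\<bar>) * (k * norm (T s x))"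
    by (intro mult_left_mono K_bound) simp
  also have "\<dots> \<le> exp (\<omega> * \<bar>- s\<bar>) * (k * (exp (\<omega> * \<bar>s\<bar>) * norm x))"
    using k_pos by (intro mult_left_mono T_bound) auto
  also have "\<dots> = exp (\<omega> * s) * (k * (exp (\<omega> * s) * norm x))"
    using assms by simp
  also have "\<dots> = exp (2 * \<omega> * s) * k * norm x"
    using exp_add[of "\<omega> * s" "\<omega> * s"] by (simp add: mult.assoc)
  also have "\<dots> \<le> m R * norm x"
    unfolding m_def using assms k_pos omega_nonneg by (intro mult_right_mono) (auto intro: mult_left_mono)
  finally show ?thesis .
qed

text \<open>One Picard step turns the n-th term of an exponential series into the next one.
  Uniqueness and the convergence of the Dyson series both iterate it.\<close>

lemma picard_bound:
  assumes "\<And>s. s \<in> {0..R} \<Longrightarrow> norm (u s) \<le> B * (m R * s) ^ n / fact n"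
    and "continuous_on {0..R} u" "t \<in> {0..R}"
  shows "norm (integral {0..t} (\<lambda>s. A s (u s))) \<le> B * (m R * t) ^ Suc n / fact (Suc n)"
proof -
  have c: "continuous_on {0..t} (\<lambda>s. A s (u s))"
    using assms(3) by (intro continuous_intros continuous_on_subset[OF assms(2)]) auto
  define c where "c = B * m R ^ Suc n / fact n"
  have I: "((\<lambda>s. c * s ^ n) has_integral c * t ^ Suc n / Suc n) {0..t}"
    using assms(3) by (intro has_integral_monomial) simp
  have "norm (integral {0..t} (\<lambda>s. A s (u s))) \<le> integral {0..t} (\<lambda>s. c * s ^ n)"
  proof (rule Henstock_Kurzweil_Integration.integral_norm_bound_integral)
    show "(\<lambda>s. A s (u s)) integrable_on {0..t}" by (rule integrable_continuous_real[OF c])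
    show "(\<lambda>s. c * s ^ n) integrable_on {0..t}" using I by blast
    fix s assume s: "s \<in> {0..t}"
    then have "norm (A s (u s)) \<le> m R * norm (u s)"
      using assms by (intro A_bound) auto
    also have "\<dots> \<le> m R * (B * (m R * s) ^ n / fact n)"
      using assms s m_pos by (intro mult_left_mono) (auto simp: less_imp_le)
    also have "\<dots> = c * s ^ n" by (simp add: c_def power_mult_distrib)
    finally show "norm (A s (u s)) \<le> c * s ^ n" .
  qed
  also have "\<dots> = c * t ^ Suc n / Suc n" using I by blast
  also have "\<dots> = B * (m R * t) ^ Suc n / fact (Suc n)"
    by (simp add: c_def power_mult_distrib field_simps)
  finally show ?thesis .
qed

text \<open>A solution of the homogeneous equation reproduces itself under the Picard step, so it
  obeys the factorial bound for every n and must vanish.\<close>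

lemma uniqueness:
  assumes c: "continuous_on {0..} u"
    and u: "\<And>t. 0 \<le> t \<Longrightarrow> u t = integral {0..t} (\<lambda>s. A s (u s))" and "0 \<le> R"
  shows "u R = 0"
proof -
  have cR: "continuous_on {0..R} u" using c by (rule continuous_on_subset) auto
  have "compact (u ` {0..R})" by (rule compact_continuous_image[OF cR]) simp
  then obtain B where B: "\<And>s. s \<in> {0..R} \<Longrightarrow> norm (u s) \<le> B"
    by (meson compact_imp_bounded bounded_iff imageI)
  have "s \<in> {0..R} \<Longrightarrow> norm (u s) \<le> B * (m R * s) ^ n / fact n" for n s
  proof (induction n arbitrary: s)
    case 0 then show ?case using B by simp
  next
    case (Suc n)
    then show ?case using picard_bound[OF Suc.IH cR Suc.prems] u[of s] by auto
  qed
  then have "norm (u R) \<le> B * ((m R * R) ^ n / fact n)" for n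
    using \<open>0 \<le> R\<close> by simp
  moreover note pow_over_fact_null[of B "m R * R"]
  ultimately have "norm (u R) \<le> 0"
    by (intro LIMSEQ_le_const) auto
  then show ?thesis by simp
qed


section \<open>The Dyson series and the perturbed semigroup\<close>

primrec dyson :: "nat \<Rightarrow> 'a \<Rightarrow> real \<Rightarrow> 'a" where
  "dyson 0 x = (\<lambda>t. x)"
| "dyson (Suc n) x = (\<lambda>t. integral {0..t} (\<lambda>s. A s (dyson n x s)))"

lemma continuous_on_atLeastI:
  fixes f :: "real \<Rightarrow> 'b::topological_space"
  assumes "\<And>R. 0 \<le> R \<Longrightarrow> continuous_on {0..R} f"
  shows "continuous_on {0..} f"
  unfolding continuous_on_def
proof
  fix t :: real assume t: "t \<in> {0..}"
  \<comment> \<open>The endpoint \<open>t + 1\<close> puts t in the relative interior of the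
    interval, so that the restricted and the full one-sided neighbourhoods agree.\<close>
  have "(f \<longlongrightarrow> f t) (at t within {0..t + 1})"
    using assms[of "t + 1"] t by (auto simp: continuous_on_def)
  moreover have "at t within {0..t + 1} = at t within {0..}"
    by (rule at_within_nhd[of t "{..<t + 1}"]) auto
  ultimately show "(f \<longlongrightarrow> f t) (at t within {0..})" by simp
qed

lemma integral_A_continuous:
  assumes "continuous_on {0..} u"
  shows "continuous_on {0..} (\<lambda>t. integral {0..t} (\<lambda>s. A s (u s)))"
proof (rule continuous_on_atLeastI)
  fix R :: real
  have "continuous_on {0..R} (\<lambda>s. A s (u s))"
    by (intro continuous_intros continuous_on_subset[OF assms]) auto
  then show "continuous_on {0..R} (\<lambda>t. integral {0..t} (\<lambda>s. A s (u s)))"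
    by (intro indefinite_integral_continuous_1 integrable_continuous_real)
qed

lemma dyson_continuous: "continuous_on {0..} (dyson n x)"
  by (induction n) (auto intro: integral_A_continuous)

lemma dyson_continuous_Icc: "0 \<le> b \<Longrightarrow> continuous_on {b..t} (dyson n x)"
  by (rule continuous_on_subset[OF dyson_continuous]) auto

lemma dyson_bound:
  "t \<in> {0..R} \<Longrightarrow> norm (dyson n x t) \<le> norm x * (m R * t) ^ n / fact n"
proof (induction n arbitrary: t)
  case (Suc n)
  show ?case
    using picard_bound[OF Suc.IH dyson_continuous_Icc Suc.prems] by simp
qed simp

definition G :: "'a \<Rightarrow> real \<Rightarrow> 'a" where
  "G x t = (\<Sum>n. dyson n x t)"

lemma dyson_uniform_limit:
  assumes "0 \<le> R"
  shows "uniform_limit {0..R} (\<lambda>N t. \<Sum>n<N. dyson n x t) (G x) sequentially"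
  unfolding G_def
proof (rule Weierstrass_m_test)
  fix n t assume t: "t \<in> {0..R}"
  have "norm (dyson n x t) \<le> norm x * (m R * t) ^ n / fact n"
    by (rule dyson_bound[OF t])
  also have "\<dots> \<le> norm x * ((m R * R) ^ n / fact n)"
    using t m_pos[of R]
    by (auto intro!: mult_left_mono divide_right_mono power_mono simp: less_imp_le)
  finally show "norm (dyson n x t) \<le> norm x * ((m R * R) ^ n / fact n)" .
next
  show "summable (\<lambda>n. norm x * ((m R * R) ^ n / fact n))"
    using summable_exp[of "m R * R"] by (intro summable_mult) (simp add: field_simps)
qed

lemma dyson_sums: "0 \<le> t \<Longrightarrow> (\<lambda>n. dyson n x t) sums G x t"
  using tendsto_uniform_limitI[OF dyson_uniform_limit[of t x], of t] by (simp add: sums_def)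

lemma G_continuous: "continuous_on {0..} (G x)"
proof (rule continuous_on_atLeastI)
  fix R :: real assume "0 \<le> R"
  from dyson_uniform_limit[OF this] show "continuous_on {0..R} (G x)"
    by (rule uniform_limit_theorem[rotated])
      (auto intro!: always_eventually continuous_on_sum dyson_continuous_Icc)
qed

lemma G_continuous_Icc: "0 \<le> b \<Longrightarrow> continuous_on {b..t} (G x)"
  by (rule continuous_on_subset[OF G_continuous]) auto

text \<open>The partial sums satisfy the equation with an index shift, and uniform convergence on
  {0..t} allows passing to the limit under the integral.\<close>

lemma G_eq:
  assumes t: "0 \<le> t"
  shows "G x t = x + integral {0..t} (\<lambda>s. A s (G x s))"
proof -
  define P where "P = (\<lambda>N s. \<Sum>n<N. dyson n x s)"
  have cP: "continuous_on {0..t} (P N)" for N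
    unfolding P_def by (intro continuous_on_sum dyson_continuous_Icc) simp
  have P_Suc: "P (Suc N) t = x + integral {0..t} (\<lambda>s. A s (P N s))" for N
  proof -
    have "integral {0..t} (\<lambda>s. A s (P N s)) = integral {0..t} (\<lambda>s. \<Sum>n<N. A s (dyson n x s))"
      by (simp add: P_def linear_sum[OF bounded_linear.linear[OF A_linear]])
    also have "\<dots> = (\<Sum>n<N. integral {0..t} (\<lambda>s. A s (dyson n x s)))"
      by (intro integral_sum finite_lessThan integrable_continuous_real continuous_intros
          dyson_continuous_Icc) simp
    finally show ?thesis
      unfolding P_def sum.lessThan_Suc_shift by simp
  qed
  have "uniform_limit {0..t} (\<lambda>N s. A s (P N s)) (\<lambda>s. A s (G x s)) sequentially"
  proof (rule uniform_limitI)
    fix e :: real assume "0 < e"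
    then have "\<forall>\<^sub>F N in sequentially. \<forall>s\<in>{0..t}. dist (P N s) (G x s) < e / m t"
      using dyson_uniform_limit[OF t, of x] m_pos[of t] unfolding P_def
      by (intro uniform_limitD) auto
    then show "\<forall>\<^sub>F N in sequentially. \<forall>s\<in>{0..t}. dist (A s (P N s)) (A s (G x s)) < e"
    proof eventually_elim
      case (elim N)
      show ?case
      proof
        fix s assume s: "s \<in> {0..t}"
        have "dist (A s (P N s)) (A s (G x s)) \<le> m t * dist (P N s) (G x s)"
          using A_bound[of s t "P N s - G x s"] s by (simp add: dist_norm A_diff)
        also have "\<dots> < m t * (e / m t)"
          using elim s m_pos[of t] by (intro mult_strict_left_mono) auto
        finally show "dist (A s (P N s)) (A s (G x s)) < e" using m_pos[of t] by simp
      qed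
    qed
  qed
  then obtain I J where I: "\<And>N. ((\<lambda>s. A s (P N s)) has_integral I N) {0..t}"
    and J: "((\<lambda>s. A s (G x s)) has_integral J) {0..t}" and IJ: "I \<longlonglongrightarrow> J"
    by (rule uniform_limit_integral) (auto intro!: continuous_intros cP)
  have "(\<lambda>N. x + I N) \<longlonglongrightarrow> x + J" by (intro tendsto_intros IJ)
  moreover have "x + I N = P (Suc N) t" for N
    using I[of N] by (simp add: P_Suc integral_unique)
  moreover have "(\<lambda>N. P (Suc N) t) \<longlonglongrightarrow> G x t"
    using dyson_sums[OF t, of x] unfolding sums_def P_def by (rule LIMSEQ_Suc)
  ultimately have "G x t = x + J"
    by (simp add: LIMSEQ_unique)
  then show ?thesis using J by (simp add: integral_unique)
qed

lemma G_unique: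
  assumes u: "continuous_on {0..} u"
    and eq: "\<And>t. 0 \<le> t \<Longrightarrow> u t = x + integral {0..t} (\<lambda>s. A s (u s))" and "0 \<le> t"
  shows "u t = G x t"
proof -
  have "u t - G x t = 0"
  proof (rule uniqueness[OF _ _ \<open>0 \<le> t\<close>])
    show "continuous_on {0..} (\<lambda>t. u t - G x t)"
      by (intro continuous_intros u G_continuous)
    fix t :: real assume t: "0 \<le> t"
    have "integral {0..t} (\<lambda>s. A s (u s - G x s))
      = integral {0..t} (\<lambda>s. A s (u s)) - integral {0..t} (\<lambda>s. A s (G x s))"
      unfolding A_diff
      by (intro integral_diff integrable_continuous_real continuous_intros G_continuous_Icc
          continuous_on_subset[OF u]) auto
    then show "u t - G x t = integral {0..t} (\<lambda>s. A s (u s - G x s))"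
      using eq[OF t] G_eq[OF t, of x] by simp
  qed
  then show ?thesis by simp
qed

text \<open>By uniqueness: the right-hand side solves the integral equation with the combined
  initial value.\<close>

lemma G_lincomb:
  assumes "0 \<le> t"
  shows "G (c *\<^sub>R x + d *\<^sub>R y) t = c *\<^sub>R G x t + d *\<^sub>R G y t"
proof (rule G_unique[symmetric, OF _ _ assms])
  show "continuous_on {0..} (\<lambda>t. c *\<^sub>R G x t + d *\<^sub>R G y t)"
    by (intro continuous_intros G_continuous)
  fix t :: real assume t: "0 \<le> t"
  have i: "(\<lambda>s. A s (G z s)) integrable_on {0..t}" for z
    by (intro integrable_continuous_real continuous_intros G_continuous_Icc) simp
  have "integral {0..t} (\<lambda>s. A s (c *\<^sub>R G x s + d *\<^sub>R G y s))
    = c *\<^sub>R integral {0..t} (\<lambda>s. A s (G x s)) + d *\<^sub>R integral {0..t} (\<lambda>s. A s (G y s))"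
    unfolding A_plus A_scaleR by (simp add: integral_add integrable_cmul i)
  then show "c *\<^sub>R G x t + d *\<^sub>R G y t
    = c *\<^sub>R x + d *\<^sub>R y + integral {0..t} (\<lambda>s. A s (c *\<^sub>R G x s + d *\<^sub>R G y s))"
    using G_eq[OF t, of x] G_eq[OF t, of y] by (simp add: algebra_simps)
qed

definition U :: "real \<Rightarrow> 'a \<Rightarrow> 'a" where
  "U t x = T t (G x t)"

lemma U_lincomb: "0 \<le> t \<Longrightarrow> U t (c *\<^sub>R x + d *\<^sub>R y) = c *\<^sub>R U t x + d *\<^sub>R U t y"
  by (simp add: U_def G_lincomb T_plus T_scaleR)

lemma U_diff: "0 \<le> t \<Longrightarrow> U t (x - y) = U t x - U t y"
  using U_lincomb[of t 1 x "- 1" y] by simp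

lemma U_0: "U 0 x = x"
  using G_eq[of 0 x] by (simp add: U_def T_0)

text \<open>The path after time t, transported by \<open>T t\<close>, solves the integral equation
  with initial value \<open>U t x\<close>, because \<open>A_shift\<close> turns
  \<open>A (q + t)\<close> into a conjugate of \<open>A q\<close>. Uniqueness identifies it with
  \<open>G (U t x)\<close>.\<close>

lemma U_add:
  assumes "0 \<le> s" "0 \<le> t"
  shows "U (s + t) x = U s (U t x)"
proof -
  define w where "w = (\<lambda>r. T t (G x (r + t)))"
  have cA: "continuous_on {b..r} (\<lambda>q. A q (G x q))" if "0 \<le> b" for b r
    by (intro continuous_intros G_continuous_Icc that)
  have "w s = G (U t x) s"
  proof (rule G_unique[OF _ _ \<open>0 \<le> s\<close>])
    show "continuous_on {0..} w"
      unfolding w_def using \<open>0 \<le> t\<close>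
      by (intro continuous_intros continuous_on_compose2[OF G_continuous]) auto
    fix r :: real assume r: "0 \<le> r"
    have "G x (r + t) = x + integral {0..r + t} (\<lambda>q. A q (G x q))"
      using r \<open>0 \<le> t\<close> by (intro G_eq) simp
    \<comment> \<open>The part over {0..t} restores \<open>G x t\<close>; the rest is shifted to
      start at 0.\<close>
    also have "integral {0..r + t} (\<lambda>q. A q (G x q))
      = integral {0..t} (\<lambda>q. A q (G x q)) + integral {t..r + t} (\<lambda>q. A q (G x q))"
      using r \<open>0 \<le> t\<close>
      by (intro Henstock_Kurzweil_Integration.integral_combine[symmetric] integrable_continuous_real cA) auto
    also have "x + (\<dots>) = G x t + integral {t..r + t} (\<lambda>q. A q (G x q))"
      using G_eq[OF \<open>0 \<le> t\<close>, of x] by simp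
    also have "integral {t..r + t} (\<lambda>q. A q (G x q)) = integral {0..r} (\<lambda>q. A (q + t) (G x (q + t)))"
      using integral_shift_real_ivl[of t t "r + t" "\<lambda>q. A q (G x q)"] by simp
    finally have "w r = T t (G x t) + T t (integral {0..r} (\<lambda>q. A (q + t) (G x (q + t))))"
      by (simp add: w_def T_plus)
    also have "T t (integral {0..r} (\<lambda>q. A (q + t) (G x (q + t))))
      = integral {0..r} (\<lambda>q. T t (A (q + t) (G x (q + t))))"
      using \<open>0 \<le> t\<close>
      by (intro integral_linear[OF _ T_linear, unfolded o_def, symmetric] integrable_continuous_real
          continuous_intros continuous_on_compose2[OF G_continuous]) auto
    also have "(\<lambda>q. T t (A (q + t) (G x (q + t)))) = (\<lambda>q. A q (w q))"
      by (simp add: A_shift w_def T_minus_cancel)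
    finally show "w r = U t x + integral {0..r} (\<lambda>q. A q (w q))" by (simp add: U_def)
  qed
  then show ?thesis by (simp add: U_def w_def T_add)
qed

lemma U_continuous: "continuous_on {0..} (\<lambda>t. U t x)"
  unfolding U_def by (intro continuous_intros G_continuous)

text \<open>\<open>M\<close> annihilates every Dyson term, hence the sum. With \<open>M\<close> the
  triple of moments this makes the space of functions with vanishing moments invariant.\<close>

lemma U_in_kernel:
  fixes M :: "'a \<Rightarrow> 'b::banach"
  assumes M: "bounded_linear M" and MT: "\<And>t x. M x = 0 \<Longrightarrow> M (T t x) = 0"
    and MK: "\<And>x. M x = 0 \<Longrightarrow> M (K x) = 0" and "M x = 0" "0 \<le> t"
  shows "M (U t x) = 0"
proof -
  have "M (dyson n x t) = 0" if "0 \<le> t" for n t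
    using that
  proof (induction n arbitrary: t)
    case (Suc n)
    have "M (dyson (Suc n) x t) = integral {0..t} (\<lambda>s. M (A s (dyson n x s)))"
      by (auto intro!: integral_linear[OF _ M, unfolded o_def, symmetric] integrable_continuous_real
          continuous_intros dyson_continuous_Icc)
    also have "\<dots> = integral {0..t} (\<lambda>s. 0)"
      by (rule Henstock_Kurzweil_Integration.integral_cong) (auto simp: A_def MT MK Suc.IH)
    finally show ?case by simp
  qed (simp add: \<open>M x = 0\<close>)
  then have "M (G x t) = 0"
    using bounded_linear.sums[OF M dyson_sums[OF \<open>0 \<le> t\<close>, of x]] \<open>0 \<le> t\<close>
    by (simp add: sums_iff)
  then show ?thesis by (simp add: U_def MT)
qed

text \<open>Bounds on the single Dyson terms with a factorial in the denominator sum to an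
  exponential; this replaces any differential inequality.\<close>

lemma U_norm_le:
  fixes P :: "'a \<Rightarrow> 'b::banach"
  assumes P: "bounded_linear P" and "0 \<le> t"
    and le: "\<And>n. norm (P (T t (dyson n x t))) \<le> B * c ^ n / fact n"
  shows "norm (P (U t x)) \<le> B * exp c"
proof -
  have "(\<lambda>n. P (T t (dyson n x t))) sums P (U t x)"
    unfolding U_def by (intro bounded_linear.sums[OF P] bounded_linear.sums[OF T_linear] dyson_sums assms)
  moreover have B: "(\<lambda>n. B * (c ^ n / fact n)) sums (B * exp c)"
    using exp_converges[of c] by (intro sums_mult) (simp add: field_simps)
  moreover have "norm (\<Sum>n. P (T t (dyson n x t))) \<le> (\<Sum>n. B * (c ^ n / fact n))"
    using le by (intro norm_suminf_le sums_summable[OF B]) simp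
  ultimately show ?thesis by (simp add: sums_iff)
qed

lemma U_bound: "0 \<le> t \<Longrightarrow> norm (U t x) \<le> exp (\<omega> * t) * exp (m t * t) * norm x"
proof -
  assume t: "0 \<le> t"
  have "norm (T t (dyson n x t)) \<le> exp (\<omega> * t) * norm x * (m t * t) ^ n / fact n" for n
    using order_trans[OF T_bound mult_left_mono[OF dyson_bound[of t t n x]], of t] t by simp
  from U_norm_le[OF bounded_linear_ident t this] show ?thesis by (simp add: ac_simps)
qed

lemma G_deriv_0: "((\<lambda>t. (G x t - x) /\<^sub>R t) \<longlongrightarrow> K x) (at_right 0)"
proof -
  have "((\<lambda>t. integral {0..t} (\<lambda>s. A s (G x s)) /\<^sub>R t) \<longlongrightarrow> A 0 (G x 0)) (at_right 0)"
    by (intro integral_average_tendsto continuous_intros G_continuous_Icc) simp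
  moreover have "A 0 (G x 0) = K x"
    using G_eq[of 0 x] by (simp add: A_def T_0)
  moreover have "\<forall>\<^sub>F t in at_right 0. integral {0..t} (\<lambda>s. A s (G x s)) /\<^sub>R t = (G x t - x) /\<^sub>R t"
    unfolding eventually_at_right_field using G_eq[of _ x] by (intro exI[of _ 1]) auto
  ultimately show ?thesis by (auto intro: Lim_transform_eventually)
qed

text \<open>A bounded perturbation does not change the domain: the two difference quotients differ
  by \<open>T t\<close> applied to the quotient of \<open>G\<close>, and this tends to
  \<open>K x\<close>. Existence of one limit is therefore equivalent to existence of the
  other.\<close>

lemma U_generator:
  "((\<lambda>t. (U t x - x) /\<^sub>R t) \<longlongrightarrow> z) (at_right 0)
    \<longleftrightarrow> ((\<lambda>t. (T t x - x) /\<^sub>R t) \<longlongrightarrow> z - K x) (at_right 0)"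
proof -
  have "((\<lambda>t. T t ((G x t - x) /\<^sub>R t)) \<longlongrightarrow> T 0 (K x)) (at_right 0)"
    by (intro T_tendsto G_deriv_0) (rule tendsto_ident_at)
  then have *: "((\<lambda>t. T t ((G x t - x) /\<^sub>R t)) \<longlongrightarrow> K x) (at_right 0)"
    by (simp add: T_0)
  have eq: "(U t x - x) /\<^sub>R t - T t ((G x t - x) /\<^sub>R t) = (T t x - x) /\<^sub>R t" for t
    by (simp add: U_def T_scaleR T_diff algebra_simps)
  then have eq': "(T t x - x) /\<^sub>R t + T t ((G x t - x) /\<^sub>R t) = (U t x - x) /\<^sub>R t" for t
    by (simp add: algebra_simps)
  show ?thesis
    using tendsto_diff[OF _ *, of "\<lambda>t. (U t x - x) /\<^sub>R t" z]
      tendsto_add[OF _ *, of "\<lambda>t. (T t x - x) /\<^sub>R t" "z - K x"]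
    unfolding eq eq' by auto
qed


text \<open>Undoing the conjugation gives Duhamel's formula: the next term is the integral of T (t -
  s) K T s applied to the current one. \<open>P\<close> is arbitrary because the same recursion is
  run for the weak functionals, for the truncation and for the identity.\<close>

lemma dyson_step_bound:
  fixes P :: "'a \<Rightarrow> 'b::banach"
  assumes P: "bounded_linear P" and t: "0 \<le> t"
    and le: "\<And>s. 0 \<le> s \<Longrightarrow> s \<le> t \<Longrightarrow> norm (P (T (t - s) (K (T s (dyson n x s))))) \<le> c * s ^ n"
  shows "norm (P (T t (dyson (Suc n) x t))) \<le> c * t ^ Suc n / Suc n"
proof -
  have ci: "(\<lambda>s. A s (dyson n x s)) integrable_on {0..t}"
    by (intro integrable_continuous_real continuous_intros dyson_continuous_Icc) simp
  have PT: "bounded_linear (\<lambda>y. P (T t y))"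
    by (rule bounded_linear_compose[OF P T_linear])
  have "P (T t (dyson (Suc n) x t)) = integral {0..t} (\<lambda>s. P (T t (A s (dyson n x s))))"
    using integral_linear[OF ci PT] by (simp add: o_def)
  also have "\<dots> = integral {0..t} (\<lambda>s. P (T (t - s) (K (T s (dyson n x s)))))"
    by (simp add: A_def flip: T_add)
  finally have eq: "P (T t (dyson (Suc n) x t)) = integral {0..t} (\<lambda>s. P (T (t - s) (K (T s (dyson n x s)))))" .
  note I = has_integral_monomial[OF t, of c n]
  have "norm (integral {0..t} (\<lambda>s. P (T (t - s) (K (T s (dyson n x s)))))) \<le> integral {0..t} (\<lambda>s. c * s ^ n)"
  proof (rule Henstock_Kurzweil_Integration.integral_norm_bound_integral)
    show "(\<lambda>s. P (T (t - s) (K (T s (dyson n x s))))) integrable_on {0..t}"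
      by (intro integrable_continuous_real bounded_linear.continuous_on[OF P] continuous_intros
          bounded_linear.continuous_on[OF K_linear] dyson_continuous_Icc) simp
    show "(\<lambda>s. c * s ^ n) integrable_on {0..t}" using I by blast
  qed (use le in auto)
  then show ?thesis by (simp only: eq integral_unique[OF I])
qed

text \<open>The functionals \<open>F\<close> form a weak norm in which \<open>K\<close> has the optimal size \<open>\<beta>\<close>. In the given norm
  this size is only reached up to the truncation \<open>P\<close>, and \<open>K\<close> regularises enough to control \<open>P\<close> by
  the weak norm. The factor \<open>n!\<close> in the Dyson series makes a Gronwall argument unnecessary.\<close>

lemma U_decay:
  fixes F :: "'i \<Rightarrow> 'a \<Rightarrow> 'b::banach" and P :: "'a \<Rightarrow> 'c::banach"
  assumes T_decay: "\<And>t x. 0 \<le> t \<Longrightarrow> norm (T t x) \<le> exp (- \<gamma> * t) * norm x"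
    and F: "\<And>i. bounded_linear (F i)" and P: "bounded_linear P"
    and F_T: "\<And>t x B i. 0 \<le> t \<Longrightarrow> (\<And>j. norm (F j x) \<le> B * q j) \<Longrightarrow> norm (F i (T t x)) \<le> exp (- \<gamma> * t) * B * q i"
    and F_K: "\<And>x B i. (\<And>j. norm (F j x) \<le> B * q j) \<Longrightarrow> norm (F i (K x)) \<le> \<beta> * B * q i"
    and P_le: "\<And>x. norm (P x) \<le> norm x"
    and P_K: "\<And>t x B. 0 \<le> t \<Longrightarrow> (\<And>j. norm (F j x) \<le> B * q j) \<Longrightarrow> norm (P (T t (K x))) \<le> L * exp (- \<gamma> * t) * B"
    and K_le: "\<And>x. norm (K x) \<le> \<kappa> * norm x + C * norm (P x)"
    and pos: "0 < \<beta>" "\<beta> \<le> \<kappa>'" "0 \<le> \<kappa>" "\<kappa> < \<kappa>'" "0 \<le> L" "0 \<le> C"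
  shows "\<exists>D>0. \<forall>x t. 0 \<le> t \<longrightarrow> (\<forall>i. norm (F i x) \<le> norm x * q i)
    \<longrightarrow> norm (U t x) \<le> D * exp (- (\<gamma> - \<kappa>') * t) * norm x"
proof -
  \<comment> \<open>The 1 covers the term n = 0, where \<open>K\<close> has not yet acted; L /
    \<beta> turns the bound L \<beta>^n of the later terms into a multiple of \<beta>^(n +
    1).\<close>
  define C1 where "C1 = max 1 (L / \<beta>)"
  \<comment> \<open>Chosen so that \<kappa> D + C C1 \<le> \<kappa>' D, which closes the induction
    in the full norm; D \<ge> 1 covers its start.\<close>
  define D where "D = 1 + C * C1 / (\<kappa>' - \<kappa>)"
  have C1: "1 \<le> C1" "L \<le> C1 * \<beta>"
    using pos by (auto simp: C1_def field_simps max_def)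
  have "(\<kappa>' - \<kappa>) * D = (\<kappa>' - \<kappa>) + C * C1"
    using pos by (simp add: D_def distrib_left)
  then have D: "1 \<le> D" "\<kappa> * D + C * C1 \<le> \<kappa>' * D"
    using pos C1 by (auto simp: D_def[symmetric] left_diff_distrib) (simp add: D_def)
  have "norm (U t x) \<le> D * exp (- (\<gamma> - \<kappa>') * t) * norm x"
    if t: "0 \<le> t" and x: "\<And>i. norm (F i x) \<le> norm x * q i" for x t
  proof -
    define e where "e = (\<lambda>t. exp (- \<gamma> * t) * norm x)"
    have e_add: "exp (- \<gamma> * (t - s)) * e s = e t" for s t
    proof -
      have "exp (- \<gamma> * (t - s)) * exp (- \<gamma> * s) = exp (- \<gamma> * t)"
        by (simp add: mult_exp_exp algebra_simps)
      then show ?thesis by (simp add: e_def flip: mult.assoc)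
    qed
    have e_nonneg: "0 \<le> e t" for t by (simp add: e_def)
    \<comment> \<open>The weak norm comes first, since it needs no other bound. It feeds the
      truncated part, and both feed the full norm.\<close>
    have F_bound: "norm (F i (T t (dyson n x t))) \<le> (e t * (\<beta> * t) ^ n / fact n) * q i" if "0 \<le> t" for n t i
      using that
    proof (induction n arbitrary: t i)
      case 0
      then show ?case using F_T[OF 0 x, of i] by (simp add: e_def)
    next
      case (Suc n)
      have "norm (F i (T t (dyson (Suc n) x t))) \<le> (e t * \<beta> ^ Suc n / fact n * q i) * t ^ Suc n / Suc n"
      proof (rule dyson_step_bound[OF F Suc.prems])
        fix s assume s: "0 \<le> s" "s \<le> t"
        have "norm (F i (T (t - s) (K (T s (dyson n x s)))))
          \<le> exp (- \<gamma> * (t - s)) * (\<beta> * (e s * (\<beta> * s) ^ n / fact n)) * q i"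
          using s by (intro F_T F_K Suc.IH) auto
        also have "\<dots> = (exp (- \<gamma> * (t - s)) * e s) * \<beta> ^ Suc n / fact n * q i * s ^ n"
          by (simp add: power_mult_distrib)
        finally show "norm (F i (T (t - s) (K (T s (dyson n x s))))) \<le> e t * \<beta> ^ Suc n / fact n * q i * s ^ n"
          by (simp only: e_add)
      qed
      then show ?case by (simp add: power_mult_distrib field_simps)
    qed
    have P_bound: "norm (P (T t (dyson n x t))) \<le> C1 * (e t * (\<beta> * t) ^ n / fact n)" if "0 \<le> t" for n t
    proof (cases n)
      case 0
      have "norm (P (T t x)) \<le> e t"
        using order_trans[OF P_le T_decay[OF that]] by (simp add: e_def)
      also have "\<dots> \<le> C1 * e t" using C1 mult_right_mono[OF C1(1) e_nonneg[of t]] by simp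
      finally show ?thesis by (simp add: 0)
    next
      case (Suc n)
      have "norm (P (T t (dyson (Suc n) x t))) \<le> (L * e t * \<beta> ^ n / fact n) * t ^ Suc n / Suc n"
      proof (rule dyson_step_bound[OF P that])
        fix s assume s: "0 \<le> s" "s \<le> t"
        have "norm (P (T (t - s) (K (T s (dyson n x s)))))
          \<le> L * exp (- \<gamma> * (t - s)) * (e s * (\<beta> * s) ^ n / fact n)"
          using s by (intro P_K F_bound) auto
        also have "\<dots> = L * (exp (- \<gamma> * (t - s)) * e s) * \<beta> ^ n / fact n * s ^ n"
          by (simp add: power_mult_distrib)
        finally show "norm (P (T (t - s) (K (T s (dyson n x s))))) \<le> L * e t * \<beta> ^ n / fact n * s ^ n"
          by (simp only: e_add)
      qed
      also have "\<dots> = L * (e t * \<beta> ^ n * t ^ Suc n / fact (Suc n))"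
        by (simp add: field_simps)
      also have "\<dots> \<le> C1 * \<beta> * (e t * \<beta> ^ n * t ^ Suc n / fact (Suc n))"
        using C1 e_nonneg[of t] that pos by (intro mult_right_mono) auto
      also have "\<dots> = C1 * (e t * (\<beta> * t) ^ Suc n / fact (Suc n))"
        by (simp add: power_mult_distrib field_simps)
      finally show ?thesis by (simp only: Suc)
    qed
    have N_bound: "norm (T t (dyson n x t)) \<le> D * (e t * (\<kappa>' * t) ^ n / fact n)" if "0 \<le> t" for n t
      using that
    proof (induction n arbitrary: t)
      case 0
      have "norm (T t x) \<le> e t" using T_decay[OF 0] by (simp add: e_def)
      also have "\<dots> \<le> D * e t" using mult_right_mono[OF D(1) e_nonneg[of t]] by simp
      finally show ?case by simp
    next
      case (Suc n)
      have "norm (T t (dyson (Suc n) x t)) \<le> (e t * \<kappa>' ^ n / fact n * (\<kappa>' * D)) * t ^ Suc n / Suc n"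
      proof (rule dyson_step_bound[OF bounded_linear_ident Suc.prems])
        fix s assume s: "0 \<le> s" "s \<le> t"
        have "norm (T (t - s) (K (T s (dyson n x s)))) \<le> exp (- \<gamma> * (t - s)) * norm (K (T s (dyson n x s)))"
          using s by (intro T_decay) simp
        also have "\<dots> \<le> exp (- \<gamma> * (t - s)) * ((\<kappa>' * D) * (e s * (\<kappa>' * s) ^ n / fact n))"
        proof (rule mult_left_mono)
          have "norm (K (T s (dyson n x s))) \<le> \<kappa> * norm (T s (dyson n x s)) + C * norm (P (T s (dyson n x s)))"
            by (rule K_le)
          also have "\<dots> \<le> \<kappa> * (D * (e s * (\<kappa>' * s) ^ n / fact n)) + C * (C1 * (e s * (\<beta> * s) ^ n / fact n))"
            using s pos by (intro add_mono mult_left_mono Suc.IH P_bound) auto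
          \<comment> \<open>The truncated part grows only at rate \<beta> \<le> \<kappa>', so it is
            absorbed into the slack between \<kappa> and \<kappa>'.\<close>
          also have "\<dots> \<le> \<kappa> * (D * (e s * (\<kappa>' * s) ^ n / fact n)) + C * (C1 * (e s * (\<kappa>' * s) ^ n / fact n))"
            using s pos C1 e_nonneg[of s]
            by (intro add_mono order_refl mult_left_mono divide_right_mono power_mono mult_right_mono) auto
          also have "\<dots> = (\<kappa> * D + C * C1) * (e s * (\<kappa>' * s) ^ n / fact n)"
            by (simp add: distrib_right mult.assoc add_divide_distrib)
          also have "\<dots> \<le> (\<kappa>' * D) * (e s * (\<kappa>' * s) ^ n / fact n)"
            using D(2) s pos e_nonneg[of s] by (intro mult_right_mono) auto
          finally show "norm (K (T s (dyson n x s))) \<le> (\<kappa>' * D) * (e s * (\<kappa>' * s) ^ n / fact n)" .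
        qed simp
        also have "exp (- \<gamma> * (t - s)) * (\<kappa>' * D * (e s * (\<kappa>' * s) ^ n / fact n))
          = (exp (- \<gamma> * (t - s)) * e s) * \<kappa>' ^ n / fact n * (\<kappa>' * D) * s ^ n"
          by (simp add: power_mult_distrib)
        finally show "norm (T (t - s) (K (T s (dyson n x s)))) \<le> e t * \<kappa>' ^ n / fact n * (\<kappa>' * D) * s ^ n"
          by (simp only: e_add)
      qed
      then show ?case by (simp add: power_mult_distrib field_simps)
    qed
    have "norm (U t x) \<le> D * e t * exp (\<kappa>' * t)"
      using N_bound[OF t] by (intro U_norm_le[OF bounded_linear_ident t]) (simp add: mult.assoc)
    also have "\<dots> = D * exp (- (\<gamma> - \<kappa>') * t) * norm x"
      by (simp add: e_def algebra_simps exp_add[symmetric] flip: mult.assoc)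
    finally show ?thesis .
  qed
  then show ?thesis using D(1) by (intro exI[of _ D]) auto
qed

text \<open>Telescoping over the times \<open>j \<tau>\<close> bounds \<open>x - U (n \<tau>) x\<close> by a geometric series; let \<open>n\<close> tend to
  infinity and then \<open>\<tau>\<close> to 0.\<close>

lemma generator_lower_bound:
  assumes decay: "\<And>t y. y \<in> V \<Longrightarrow> 0 \<le> t \<Longrightarrow> norm (U t y) \<le> C * exp (- \<nu> * t) * norm y"
    and V_U: "\<And>t y. y \<in> V \<Longrightarrow> 0 \<le> t \<Longrightarrow> U t y \<in> V"
    and V_diff: "\<And>y z. y \<in> V \<Longrightarrow> z \<in> V \<Longrightarrow> y - z \<in> V"
    and "0 < C" "0 < \<nu>" "x \<in> V"
    and z: "((\<lambda>t. (U t x - x) /\<^sub>R t) \<longlongrightarrow> z) (at_right 0)"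
  shows "\<nu> / C * norm x \<le> norm z"
proof -
  have step: "norm x * (1 - exp (- \<nu> * \<tau>)) / \<tau> \<le> C * norm ((U \<tau> x - x) /\<^sub>R \<tau>)" if \<tau>: "0 < \<tau>" for \<tau>
  proof -
    define r where "r = exp (- \<nu> * \<tau>)"
    have r: "0 < r" "r < 1" using \<tau> \<open>0 < \<nu>\<close> by (auto simp: r_def)
    have r_pow: "exp (- \<nu> * (real n * \<tau>)) = r ^ n" for n
      by (simp add: r_def exp_of_nat_mult[symmetric] algebra_simps)
    define d where "d = C * norm (U \<tau> x - x)"
    have "norm (x - U (real n * \<tau>) x) \<le> d * (\<Sum>j<n. r ^ j)" for n
    proof (induction n)
      case (Suc n)
      have "U (real (Suc n) * \<tau>) x = U (real n * \<tau>) (U \<tau> x)"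
        using U_add[of "real n * \<tau>" \<tau> x] \<tau> by (simp add: algebra_simps)
      then have "x - U (real (Suc n) * \<tau>) x = (x - U (real n * \<tau>) x) - U (real n * \<tau>) (U \<tau> x - x)"
        using \<tau> by (simp add: U_diff)
      then have "norm (x - U (real (Suc n) * \<tau>) x)
        \<le> norm (x - U (real n * \<tau>) x) + norm (U (real n * \<tau>) (U \<tau> x - x))"
        by (simp only: norm_triangle_ineq4)
      \<comment> \<open>The increment \<open>U \<tau> x - x\<close> lies in \<open>V\<close> again,
        so it decays with the constant C.\<close>
      also have "norm (U (real n * \<tau>) (U \<tau> x - x)) \<le> C * exp (- \<nu> * (real n * \<tau>)) * norm (U \<tau> x - x)"
        using \<tau> \<open>x \<in> V\<close> by (intro decay V_diff V_U) auto
      also have "\<dots> = d * r ^ n" unfolding r_pow d_def by simp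
      finally show ?case using Suc.IH by (simp add: algebra_simps)
    qed (simp add: U_0)
    moreover have "(\<Sum>j<n. r ^ j) \<le> 1 / (1 - r)" for n
      using r sum_le_suminf[OF summable_geometric[of r], of "{..<n}"] by (simp add: suminf_geometric)
    moreover have "0 \<le> d" using \<open>0 < C\<close> by (simp add: d_def)
    ultimately have A: "norm (x - U (real n * \<tau>) x) \<le> d * (1 / (1 - r))" for n
      by (meson mult_left_mono order_trans)
    have "norm x \<le> d * (1 / (1 - r)) + C * r ^ n * norm x" for n
    proof -
      have "norm (U (real n * \<tau>) x) \<le> C * exp (- \<nu> * (real n * \<tau>)) * norm x"
        using \<tau> \<open>x \<in> V\<close> by (intro decay) auto
      then show ?thesis
        using A[of n] norm_triangle_ineq[of "x - U (real n * \<tau>) x" "U (real n * \<tau>) x"]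
        unfolding r_pow by simp
    qed
    moreover have "(\<lambda>n. d * (1 / (1 - r)) + C * r ^ n * norm x) \<longlonglongrightarrow> d * (1 / (1 - r)) + C * 0 * norm x"
      using r by (intro tendsto_intros LIMSEQ_power_zero) auto
    ultimately have "norm x \<le> d * (1 / (1 - r))"
      using LIMSEQ_le_const[of "\<lambda>n. d * (1 / (1 - r)) + C * r ^ n * norm x" "d * (1 / (1 - r))" "norm x"]
      by auto
    then have "norm x * (1 - r) \<le> d" using r by (simp add: field_simps)
    then have "norm x * (1 - r) / \<tau> \<le> d / \<tau>" using \<tau> by (intro divide_right_mono) auto
    also have "d / \<tau> = C * norm ((U \<tau> x - x) /\<^sub>R \<tau>)"
      using \<tau> by (simp add: d_def divide_inverse mult.commute mult.left_commute)
    finally show ?thesis by (simp add: r_def)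
  qed
  \<comment> \<open>The quotient (1 - exp (- \<nu> \<tau>)) / \<tau> left by the geometric sum tends
    to \<nu>.\<close>
  have "((\<lambda>\<tau>. exp (- \<nu> * \<tau>)) has_real_derivative exp (- \<nu> * 0) * (- \<nu>)) (at 0)"
    by (rule derivative_eq_intros refl | simp)+
  then have "((\<lambda>\<tau>. (exp (- \<nu> * \<tau>) - 1) / \<tau>) \<longlongrightarrow> - \<nu>) (at_right 0)"
    by (auto simp: has_field_derivative_iff intro: tendsto_mono[OF at_le])
  then have "((\<lambda>\<tau>. norm x * - ((exp (- \<nu> * \<tau>) - 1) / \<tau>)) \<longlongrightarrow> norm x * - (- \<nu>)) (at_right 0)"
    by (intro tendsto_intros)
  moreover have "(\<lambda>\<tau>. norm x * - ((exp (- \<nu> * \<tau>) - 1) / \<tau>)) = (\<lambda>\<tau>. norm x * (1 - exp (- \<nu> * \<tau>)) / \<tau>)"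
    by (auto simp: fun_eq_iff diff_divide_distrib right_diff_distrib)
  ultimately have "((\<lambda>\<tau>. norm x * (1 - exp (- \<nu> * \<tau>)) / \<tau>) \<longlongrightarrow> norm x * \<nu>) (at_right 0)"
    by simp
  moreover have "((\<lambda>\<tau>. C * norm ((U \<tau> x - x) /\<^sub>R \<tau>)) \<longlongrightarrow> C * norm z) (at_right 0)"
    by (intro tendsto_intros z)
  moreover have "\<forall>\<^sub>F \<tau> in at_right 0. norm x * (1 - exp (- \<nu> * \<tau>)) / \<tau> \<le> C * norm ((U \<tau> x - x) /\<^sub>R \<tau>)"
    using step unfolding eventually_at_right_field by (intro exI[of _ 1]) auto
  ultimately have "norm x * \<nu> \<le> C * norm z"
    using tendsto_le[OF trivial_limit_at_right_real] by blast
  then show ?thesis using \<open>0 < C\<close> by (simp add: field_simps)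
qed

end

section \<open>The Banach space of integrable functions\<close>

text \<open>A partial equivalence: reflexivity fails outside the integrable functions, so the
  quotient selects the integrable functions and identifies them almost everywhere in one
  step.\<close>

definition l1_rel :: "(real \<Rightarrow> real) \<Rightarrow> (real \<Rightarrow> real) \<Rightarrow> bool" where
  "l1_rel f g \<longleftrightarrow> integrable lborel f \<and> integrable lborel g \<and> (AE x in lborel. f x = g x)"

lemma l1_relI: "integrable lborel f \<Longrightarrow> integrable lborel g \<Longrightarrow> AE x in lborel. f x = g x \<Longrightarrow> l1_rel f g"
  by (simp add: l1_rel_def)

quotient_type l1 = "real \<Rightarrow> real" / partial: l1_rel
proof (rule part_equivpI)
  show "\<exists>f. l1_rel f f" by (intro exI[of _ "\<lambda>_. 0"] l1_relI) auto
  show "symp l1_rel" by (auto simp: symp_def l1_rel_def elim: eventually_mono)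
  show "transp l1_rel"
    unfolding transp_def l1_rel_def by (auto elim: eventually_elim2)
qed

instantiation l1 :: real_normed_vector
begin

lift_definition zero_l1 :: l1 is "\<lambda>_. 0"
  by (simp add: l1_rel_def)

lift_definition plus_l1 :: "l1 \<Rightarrow> l1 \<Rightarrow> l1" is "\<lambda>f g x. f x + g x"
  unfolding l1_rel_def by (auto elim: eventually_elim2)

lift_definition minus_l1 :: "l1 \<Rightarrow> l1 \<Rightarrow> l1" is "\<lambda>f g x. f x - g x"
  unfolding l1_rel_def by (auto elim: eventually_elim2)

lift_definition uminus_l1 :: "l1 \<Rightarrow> l1" is "\<lambda>f x. - f x"
  unfolding l1_rel_def by (auto elim: eventually_mono)

lift_definition scaleR_l1 :: "real \<Rightarrow> l1 \<Rightarrow> l1" is "\<lambda>c f x. c * f x"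
  unfolding l1_rel_def by (auto elim: eventually_mono)

lift_definition norm_l1 :: "l1 \<Rightarrow> real" is "\<lambda>f. \<integral>x. \<bar>f x\<bar> \<partial>lborel"
  unfolding l1_rel_def by (auto intro!: integral_cong_AE elim: eventually_mono)

definition "sgn (u :: l1) = inverse (norm u) *\<^sub>R u"
definition "dist (u :: l1) v = norm (u - v)"
definition "(uniformity :: (l1 \<times> l1) filter) = (INF e\<in>{0<..}. principal {(u, v). dist u v < e})"
definition "open (U :: l1 set) \<longleftrightarrow> (\<forall>u\<in>U. eventually (\<lambda>(u', v). u' = u \<longrightarrow> v \<in> U) uniformity)"

instance
proof
  fix u v w :: l1 and c d :: real
  show "u + v + w = u + (v + w)" by transfer (auto simp: l1_rel_def algebra_simps)
  show "u + v = v + u" by transfer (auto simp: l1_rel_def algebra_simps)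
  show "0 + u = u" by transfer (auto simp: l1_rel_def)
  show "- u + u = 0" by transfer (auto simp: l1_rel_def)
  show "u - v = u + - v" by transfer (auto simp: l1_rel_def)
  show "c *\<^sub>R (u + v) = c *\<^sub>R u + c *\<^sub>R v" by transfer (auto simp: l1_rel_def algebra_simps)
  show "(c + d) *\<^sub>R u = c *\<^sub>R u + d *\<^sub>R u" by transfer (auto simp: l1_rel_def algebra_simps)
  show "c *\<^sub>R d *\<^sub>R u = (c * d) *\<^sub>R u" by transfer (auto simp: l1_rel_def algebra_simps)
  show "1 *\<^sub>R u = u" by transfer (auto simp: l1_rel_def)
  show "sgn u = inverse (norm u) *\<^sub>R u" by (rule sgn_l1_def)
  show "dist u v = norm (u - v)" by (rule dist_l1_def)
  show "(uniformity :: (l1 \<times> l1) filter) = (INF e\<in>{0<..}. principal {(u, v). dist u v < e})"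
    by (rule uniformity_l1_def)
  show "open U \<longleftrightarrow> (\<forall>u\<in>U. eventually (\<lambda>(u', v). u' = u \<longrightarrow> v \<in> U) uniformity)" for U :: "l1 set"
    by (rule open_l1_def)
  show "norm u = 0 \<longleftrightarrow> u = 0"
    by transfer (auto simp: l1_rel_def integral_nonneg_eq_0_iff_AE)
  show "norm (u + v) \<le> norm u + norm v"
  proof transfer
    fix f g :: "real \<Rightarrow> real" assume "l1_rel f f" "l1_rel g g"
    then have "(\<integral>x. \<bar>f x + g x\<bar> \<partial>lborel) \<le> (\<integral>x. \<bar>f x\<bar> + \<bar>g x\<bar> \<partial>lborel)"
      by (intro integral_mono) (auto simp: l1_rel_def)
    also have "\<dots> = (\<integral>x. \<bar>f x\<bar> \<partial>lborel) + (\<integral>x. \<bar>g x\<bar> \<partial>lborel)"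
      using \<open>l1_rel f f\<close> \<open>l1_rel g g\<close> by (intro Bochner_Integration.integral_add) (auto simp: l1_rel_def)
    finally show "(\<integral>x. \<bar>f x + g x\<bar> \<partial>lborel) \<le> (\<integral>x. \<bar>f x\<bar> \<partial>lborel) + (\<integral>x. \<bar>g x\<bar> \<partial>lborel)" .
  qed
  show "norm (c *\<^sub>R u) = \<bar>c\<bar> * norm u"
    by transfer (simp add: abs_mult)
qed

end

lemma l1_rel_rep: "l1_rel (rep_l1 u) (rep_l1 u)"
  by (rule Quotient_rep_reflp[OF Quotient_l1])

lemma integrable_rep_l1 [simp]: "integrable lborel (rep_l1 u)"
  using l1_rel_rep[of u] by (simp add: l1_rel_def)

lemma rep_abs_l1: "integrable lborel f \<Longrightarrow> AE x in lborel. rep_l1 (abs_l1 f) x = f x"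
  using rep_abs_rsp_left[OF Quotient3_l1, of f f] by (simp add: l1_rel_def)

lemma abs_rep_l1: "abs_l1 (rep_l1 u) = u"
  by (rule Quotient_abs_rep[OF Quotient_l1])

lemma norm_abs_l1: "integrable lborel f \<Longrightarrow> norm (abs_l1 f) = (\<integral>x. \<bar>f x\<bar> \<partial>lborel)"
  by (rule norm_l1.abs_eq) (simp add: l1_rel_def)

lemma norm_rep_l1: "norm u = (\<integral>x. \<bar>rep_l1 u x\<bar> \<partial>lborel)"
  by (simp add: norm_l1.rep_eq)

lemma abs_l1_eqI: "integrable lborel f \<Longrightarrow> integrable lborel g \<Longrightarrow> AE x in lborel. f x = g x \<Longrightarrow> abs_l1 f = abs_l1 g"
  by (intro Quotient_rel_abs[OF Quotient_l1] l1_relI)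

lemma abs_l1_add: "integrable lborel f \<Longrightarrow> integrable lborel g \<Longrightarrow> abs_l1 f + abs_l1 g = abs_l1 (\<lambda>x. f x + g x)"
  by (rule plus_l1.abs_eq) (auto simp: l1_rel_def)

lemma abs_l1_diff: "integrable lborel f \<Longrightarrow> integrable lborel g \<Longrightarrow> abs_l1 f - abs_l1 g = abs_l1 (\<lambda>x. f x - g x)"
  by (rule minus_l1.abs_eq) (auto simp: l1_rel_def)

lemma abs_l1_scaleR: "integrable lborel f \<Longrightarrow> c *\<^sub>R abs_l1 f = abs_l1 (\<lambda>x. c * f x)"
  by (rule scaleR_l1.abs_eq) (auto simp: l1_rel_def)

lemma abs_l1_zero: "abs_l1 (\<lambda>_. 0) = 0"
  by (simp add: zero_l1_def)

lemma abs_l1_sum: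
  assumes "\<And>i. i \<in> I \<Longrightarrow> integrable lborel (f i)"
  shows "(\<Sum>i\<in>I. abs_l1 (f i)) = abs_l1 (\<lambda>x. \<Sum>i\<in>I. f i x)"
  using assms by (induction I rule: infinite_finite_induct) (auto simp: abs_l1_zero abs_l1_add)

text \<open>Dominated convergence as convergence in the norm of \<open>l1\<close>: the differences
  are dominated by g + |f|.\<close>

lemma abs_l1_dominated_convergence:
  fixes s :: "nat \<Rightarrow> real \<Rightarrow> real"
  assumes s: "\<And>i. s i \<in> borel_measurable lborel" and f: "f \<in> borel_measurable lborel"
    and g: "integrable lborel g"
    and lim: "AE x in lborel. (\<lambda>i. s i x) \<longlonglongrightarrow> f x" and bound: "\<And>i. AE x in lborel. \<bar>s i x\<bar> \<le> g x"
  shows "(\<lambda>i. abs_l1 (s i)) \<longlonglongrightarrow> abs_l1 f"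
proof -
  have bound': "AE x in lborel. norm (s i x) \<le> g x" for i using bound by simp
  have si: "integrable lborel (s i)" for i
    by (rule Bochner_Integration.integrable_bound[OF g s]) (use bound[of i] in \<open>auto elim!: eventually_mono\<close>)
  have fi: "integrable lborel f"
    by (rule Bochner_Integration.integrable_dominated_convergence[OF f s g lim bound'])
  have "(\<lambda>i. \<integral>x. \<bar>s i x - f x\<bar> \<partial>lborel) \<longlonglongrightarrow> (\<integral>x. 0 \<partial>(lborel :: real measure))"
  proof (rule Bochner_Integration.integral_dominated_convergence)
    show "integrable lborel (\<lambda>x. g x + \<bar>f x\<bar>)" using g fi by auto
    show "AE x in lborel. (\<lambda>i. \<bar>s i x - f x\<bar>) \<longlonglongrightarrow> 0"
      using lim by eventually_elim (auto intro: tendsto_rabs_zero LIM_zero)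
    show "AE x in lborel. norm \<bar>s i x - f x\<bar> \<le> g x + \<bar>f x\<bar>" for i
      using bound[of i] by eventually_elim auto
  qed (use s f in auto)
  then have "(\<lambda>i. norm (abs_l1 (s i) - abs_l1 f)) \<longlonglongrightarrow> 0"
    using si fi by (simp add: abs_l1_diff norm_abs_l1)
  then show ?thesis by (simp add: tendsto_norm_zero_iff LIM_zero_iff)
qed

text \<open>A subsequence with increments below 2^(- n) is an absolutely summable telescoping
  series, and a Cauchy sequence with a convergent subsequence converges.\<close>

lemma Cauchy_convergent_if_abs_summable:
  fixes X :: "nat \<Rightarrow> 'a::real_normed_vector"
  assumes series: "\<And>f :: nat \<Rightarrow> 'a. summable (\<lambda>n. norm (f n)) \<Longrightarrow> summable f" and X: "Cauchy X"
  shows "convergent X"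
proof -
  have "\<exists>N. \<forall>p\<ge>N. \<forall>q\<ge>N. norm (X p - X q) < (1 / 2) ^ n" for n
    using CauchyD[OF X, of "(1 / 2) ^ n"] by simp
  then obtain N where N: "\<And>n p q. p \<ge> N n \<Longrightarrow> q \<ge> N n \<Longrightarrow> norm (X p - X q) < (1 / 2) ^ n"
    by metis
  \<comment> \<open>The thresholds N need not increase; their partial sums, with \<open>Suc\<close>,
    are strictly increasing and still dominate them.\<close>
  define r where "r n = (\<Sum>i\<le>n. Suc (N i))" for n
  have r: "strict_mono r" by (auto simp: strict_mono_Suc_iff r_def)
  have rN: "N n \<le> r n" for n
    unfolding r_def by (rule order_trans[OF _ member_le_sum[of n]]) auto
  have rN': "N n \<le> r (Suc n)" for n
    using rN[of n] strict_monoD[OF r, of n "Suc n"] by simp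
  have "summable (\<lambda>n. norm (X (r (Suc n)) - X (r n)))"
    by (rule summable_comparison_test'[OF summable_geometric[of "1 / 2 :: real"], of 0])
      (auto intro!: less_imp_le N rN rN')
  then have "summable (\<lambda>n. X (r (Suc n)) - X (r n))" by (rule series)
  then have "convergent (\<lambda>n. X (r n) - X (r 0))"
    unfolding summable_iff_convergent sum_lessThan_telescope[of "\<lambda>n. X (r n)"] .
  then have "convergent (\<lambda>n. X (r n))" by (simp add: convergent_diff_const_right_iff)
  then obtain l where "(X \<circ> r) \<longlonglongrightarrow> l" by (auto simp: convergent_def o_def)
  with X r have "X \<longlonglongrightarrow> l"
    using Cauchy_converges_subseq by blast
  then show ?thesis by (rule convergentI)
qed

instance l1 :: banach
proof
  fix X :: "nat \<Rightarrow> l1" assume "Cauchy X"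
  show "convergent X"
  proof (rule Cauchy_convergent_if_abs_summable[OF _ \<open>Cauchy X\<close>])
    fix u :: "nat \<Rightarrow> l1" assume sum: "summable (\<lambda>n. norm (u n))"
    have [measurable]: "rep_l1 (u n) \<in> borel_measurable borel" for n
      using borel_measurable_integrable[OF integrable_rep_l1[of "u n"]] by simp
    \<comment> \<open>Riesz-Fischer: by monotone convergence the sum of the absolute values has
      finite integral, so the series converges almost everywhere and that sum dominates all partial
      sums.\<close>
    have "(\<integral>\<^sup>+x. (\<Sum>n. ennreal \<bar>rep_l1 (u n) x\<bar>) \<partial>lborel) = (\<Sum>n. \<integral>\<^sup>+x. ennreal \<bar>rep_l1 (u n) x\<bar> \<partial>lborel)"
      by (intro nn_integral_suminf) simp
    also have "\<dots> = (\<Sum>n. ennreal (norm (u n)))"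
      by (simp add: norm_rep_l1 nn_integral_eq_integral)
    also have "\<dots> \<noteq> \<infinity>" using sum by (simp add: ennreal_suminf_neq_top)
    finally have "AE x in lborel. (\<Sum>n. ennreal \<bar>rep_l1 (u n) x\<bar>) \<noteq> \<infinity>"
      by (intro nn_integral_PInf_AE) auto
    then have sumAE: "AE x in lborel. summable (\<lambda>n. \<bar>rep_l1 (u n) x\<bar>)"
      by eventually_elim (auto intro: summable_suminf_not_top)
    define G where "G x = (\<Sum>n. \<bar>rep_l1 (u n) x\<bar>)" for x
    have G: "integrable lborel G"
      unfolding G_def using sumAE sum by (intro integrable_suminf) (auto simp: norm_rep_l1)
    have "(\<lambda>N. abs_l1 (\<lambda>x. \<Sum>n<N. rep_l1 (u n) x)) \<longlonglongrightarrow> abs_l1 (\<lambda>x. \<Sum>n. rep_l1 (u n) x)"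
    proof (rule abs_l1_dominated_convergence[OF _ _ G])
      show "AE x in lborel. (\<lambda>N. \<Sum>n<N. rep_l1 (u n) x) \<longlonglongrightarrow> (\<Sum>n. rep_l1 (u n) x)"
        using sumAE by eventually_elim (auto intro: summable_LIMSEQ summable_rabs_cancel)
      show "AE x in lborel. \<bar>\<Sum>n<N. rep_l1 (u n) x\<bar> \<le> G x" for N
        using sumAE
      proof eventually_elim
        case (elim x)
        have "\<bar>\<Sum>n<N. rep_l1 (u n) x\<bar> \<le> (\<Sum>n<N. \<bar>rep_l1 (u n) x\<bar>)" by (rule sum_abs)
        also have "\<dots> \<le> G x" unfolding G_def using elim by (intro sum_le_suminf) auto
        finally show ?case .
      qed
    qed auto
    then show "summable u"
      by (simp add: summable_iff_convergent convergent_def abs_l1_sum[symmetric] abs_rep_l1) blast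
  qed
qed

text \<open>Density of step functions, phrased as an induction principle: a closed linear property
  has to be checked on compact intervals only. It is used for the strong continuity of the
  dilations.\<close>

lemma l1_closed_subspace_UNIV:
  assumes V: "subspace V" "closed V"
    and ivl: "\<And>a b. a \<le> b \<Longrightarrow> abs_l1 (indicator {a..b}) \<in> V"
  shows "u \<in> V"
proof -
  have dom_lim: "abs_l1 f \<in> V"
    if "\<And>i. s i \<in> borel_measurable lborel" "f \<in> borel_measurable lborel" "integrable lborel g"
      "AE x in lborel. (\<lambda>i. s i x) \<longlonglongrightarrow> f x" "\<And>i. AE x in lborel. \<bar>s i x\<bar> \<le> g x"
      "\<And>i. abs_l1 (s i) \<in> V" for s f g
    using closed_sequentially[OF V(2) that(6) abs_l1_dominated_convergence[OF that(1-5)]] .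
  have fin: "emeasure lborel (A \<inter> {- R..R}) < \<infinity>" for A and R :: real
    by (rule emeasure_bounded_finite) (rule bounded_subset[OF bounded_closed_interval], auto)
  \<comment> \<open>The sets are truncated to a bounded interval because complements occur in the
    induction and would otherwise have infinite measure.\<close>
  have bounded_set: "abs_l1 (indicator (A \<inter> {- R..R})) \<in> V" if "A \<in> sets borel" "0 \<le> R" for A R
    using that(1)
  proof (induction A rule: borel_set_induct)
    case empty
    show ?case using subspace_0[OF V(1)] by (simp add: abs_l1_zero)
  next
    case (interval a b)
    have eq: "{a..b} \<inter> {- R..R} = {max a (- R)..min b R}" by auto
    show ?case
    proof (cases "max a (- R) \<le> min b R")
      case True then show ?thesis unfolding eq by (rule ivl)
    next
      case False
      then have "{a..b} \<inter> {- R..R} = {}" unfolding eq by simp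
      then show ?thesis using subspace_0[OF V(1)] by (simp add: abs_l1_zero)
    qed
  next
    case (compl A)
    have "abs_l1 (indicator {- R..R}) - abs_l1 (indicator (A \<inter> {- R..R})) \<in> V"
      using compl that(2) by (intro subspace_diff[OF V(1)] ivl) auto
    moreover have "abs_l1 (indicator {- R..R}) - abs_l1 (indicator (A \<inter> {- R..R}))
        = abs_l1 (\<lambda>x. indicator {- R..R} x - indicator (A \<inter> {- R..R}) x)"
      using compl(1) fin[of A] fin[of UNIV] by (intro abs_l1_diff integrable_real_indicator) auto
    moreover have "(\<lambda>x. indicator {- R..R} x - indicator (A \<inter> {- R..R}) x :: real) = indicator (- A \<inter> {- R..R})"
      by (auto simp: fun_eq_iff indicator_def)
    ultimately show ?case by simp
  next
    case (union B)
    have meas: "B i \<inter> {- R..R} \<in> sets lborel" for i using union(2) by auto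
    have eq: "(\<lambda>x. \<Sum>i<n. indicator (B i \<inter> {- R..R}) x :: real) = indicator ((\<Union>i<n. B i) \<inter> {- R..R})" for n
    proof -
      have "disjoint_family_on (\<lambda>i. B i \<inter> {- R..R}) {..<n}"
        using union(1) by (auto simp: disjoint_family_on_def)
      then have "indicator (\<Union>i<n. B i \<inter> {- R..R}) x = (\<Sum>i<n. indicator (B i \<inter> {- R..R}) x :: real)" for x
        by (rule indicator_UN_disjoint[OF finite_lessThan])
      moreover have "(\<Union>i<n. B i \<inter> {- R..R}) = (\<Union>i<n. B i) \<inter> {- R..R}" by auto
      ultimately show ?thesis by (simp add: fun_eq_iff)
    qed
    show ?case
    proof (rule dom_lim)
      show "integrable lborel (indicator {- R..R} :: real \<Rightarrow> real)"
        using fin[of UNIV] by (intro integrable_real_indicator) auto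
      show "abs_l1 (indicator ((\<Union>i<n. B i) \<inter> {- R..R})) \<in> V" for n
        unfolding eq[symmetric] using union(3) meas
        by (subst abs_l1_sum[symmetric]) (auto intro!: subspace_sum[OF V(1)] integrable_real_indicator fin)
      show "AE x in lborel. (\<lambda>n. indicator ((\<Union>i<n. B i) \<inter> {- R..R}) x :: real)
          \<longlonglongrightarrow> indicator ((\<Union>i. B i) \<inter> {- R..R}) x"
      proof (rule AE_I2)
        fix x
        have "(\<lambda>n. indicator (\<Union>i<n. B i) x * indicator {- R..R} x :: real)
          \<longlonglongrightarrow> indicator (\<Union>i. B i) x * indicator {- R..R} x"
          by (intro tendsto_intros LIMSEQ_indicator_UN)
        then show "(\<lambda>n. indicator ((\<Union>i<n. B i) \<inter> {- R..R}) x :: real)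
          \<longlonglongrightarrow> indicator ((\<Union>i. B i) \<inter> {- R..R}) x"
          by (simp add: indicator_inter_arith)
      qed
    qed (use union(2) in \<open>auto simp: indicator_def\<close>)
  qed
  have "abs_l1 f \<in> V" if "integrable lborel f" for f
    using that
  proof (induction f rule: integrable_induct)
    case (base A c)
    have "abs_l1 (indicator A) \<in> V"
    proof (rule dom_lim)
      show "integrable lborel (indicator A :: real \<Rightarrow> real)"
        using base by (intro integrable_real_indicator)
      show "abs_l1 (indicator (A \<inter> {- real n..real n})) \<in> V" for n
        using base by (intro bounded_set) auto
      show "AE x in lborel. (\<lambda>n. indicator (A \<inter> {- real n..real n}) x :: real) \<longlonglongrightarrow> indicator A x"
      proof (rule AE_I2)
        fix x :: real
        obtain N where "\<bar>x\<bar> \<le> real N" using real_arch_simple by blast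
        then have "\<forall>\<^sub>F n in sequentially. indicator (A \<inter> {- real n..real n}) x = (indicator A x :: real)"
          unfolding eventually_sequentially by (intro exI[of _ N]) (auto simp: indicator_def)
        then show "(\<lambda>n. indicator (A \<inter> {- real n..real n}) x :: real) \<longlonglongrightarrow> indicator A x"
          by (rule tendsto_eventually)
      qed
    qed (use base in \<open>auto simp: indicator_def\<close>)
    then have "c *\<^sub>R abs_l1 (indicator A) \<in> V" by (rule subspace_scale[OF V(1)])
    then show ?case using base by (simp add: abs_l1_scaleR integrable_real_indicator mult.commute)
  next
    case (add f g)
    then show ?case using subspace_add[OF V(1)] by (simp flip: abs_l1_add)
  next
    case (lim f s)
    show ?case
      \<comment> \<open>The approximating functions of this induction come with the bound 2
        |f|.\<close>
      by (rule dom_lim[of s f "\<lambda>x. 2 * \<bar>f x\<bar>"]) (use lim in auto)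
  qed
  from this[of "rep_l1 u"] show ?thesis by (simp add: abs_rep_l1)
qed

section \<open>Test functions and distributional derivatives\<close>

text \<open>For k = 0 the classical flat function. The powers in the denominator are included
  because differentiation produces them.\<close>

definition expinv :: "nat \<Rightarrow> real \<Rightarrow> real" where
  "expinv k y = (if 0 < y then exp (- (1 / y)) / y ^ k else 0)"

lemma expinv_null_right: "(expinv k \<longlongrightarrow> 0) (at_right 0)"
proof -
  have "((\<lambda>u::real. u ^ k / exp u) \<longlongrightarrow> 0) at_top"
    by (rule tendsto_power_div_exp_0)
  then have "((\<lambda>y::real. inverse y ^ k / exp (inverse y)) \<longlongrightarrow> 0) (at_right 0)"
    by (rule filterlim_compose[OF _ filterlim_inverse_at_top_right])
  moreover have "\<forall>\<^sub>F y in at_right 0. inverse y ^ k / exp (inverse y) = expinv k y"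
    unfolding eventually_at_right_field
    by (intro exI[of _ 1]) (auto simp: expinv_def exp_minus field_simps)
  ultimately show ?thesis by (rule Lim_transform_eventually)
qed

lemma expinv_deriv:
  "(expinv k has_real_derivative expinv (k + 2) y - real k * expinv (k + 1) y) (at y)"
proof -
  consider "0 < y" | "y < 0" | "y = 0" by linarith
  then show ?thesis
  proof cases
    case 1
    have "((\<lambda>y. exp (- (1 / y)) * inverse (y ^ k)) has_real_derivative
       (exp (- (1 / y)) * (1 / y\<^sup>2)) * inverse (y ^ k) + exp (- (1 / y)) * (- (real k * y ^ (k - 1)) / (y ^ k)\<^sup>2)) (at y)"
      using 1 by (auto intro!: derivative_eq_intros simp: divide_simps power2_eq_square)
    moreover have "real k * y ^ (k - 1) / (y ^ k)\<^sup>2 = real k / y ^ (k + 1)"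
      using 1 by (cases k) (auto simp: field_simps power2_eq_square)
    then have "exp (- (1 / y)) * (- (real k * y ^ (k - 1)) / (y ^ k)\<^sup>2) = - (real k * expinv (k + 1) y)"
      using 1 by (simp only: minus_divide_left[symmetric]) (simp add: expinv_def)
    moreover have "(exp (- (1 / y)) * (1 / y\<^sup>2)) * inverse (y ^ k) = expinv (k + 2) y"
      using 1 by (simp add: expinv_def power_add field_simps power2_eq_square)
    ultimately have "((\<lambda>y. exp (- (1 / y)) * inverse (y ^ k)) has_real_derivative
        expinv (k + 2) y - real k * expinv (k + 1) y) (at y)" by simp
    then show ?thesis
      by (rule DERIV_cong_ev[THEN iffD1, rotated -1, OF _ refl _ refl])
        (use 1 in \<open>auto simp: expinv_def divide_inverse intro!: eventually_mono[OF eventually_nhds_in_open[of "{0<..}"]]\<close>)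
  next
    case 2
    have "((\<lambda>y. 0) has_real_derivative expinv (k + 2) y - real k * expinv (k + 1) y) (at y)"
      using 2 by (simp add: expinv_def)
    then show ?thesis
      by (rule DERIV_cong_ev[THEN iffD1, rotated -1, OF _ refl _ refl])
        (use 2 in \<open>auto simp: expinv_def intro!: eventually_mono[OF eventually_nhds_in_open[of "{..<0}"]]\<close>)
  next
    case 3
    \<comment> \<open>From the right the difference quotient at 0 is \<open>expinv (Suc k)\<close>,
      which again tends to 0.\<close>
    have "((\<lambda>h. expinv k h / h) \<longlongrightarrow> 0) (at_right 0)"
    proof (rule Lim_transform_eventually[OF expinv_null_right[of "Suc k"]])
      show "\<forall>\<^sub>F h in at_right 0. expinv (Suc k) h = expinv k h / h"
        unfolding eventually_at_right_field by (intro exI[of _ 1]) (auto simp: expinv_def)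
    qed
    moreover have "((\<lambda>h. expinv k h / h) \<longlongrightarrow> 0) (at_left 0)"
    proof (rule Lim_transform_eventually[OF tendsto_const])
      show "\<forall>\<^sub>F h in at_left 0. 0 = expinv k h / h"
        unfolding eventually_at_left_field by (intro exI[of _ "-1"]) (auto simp: expinv_def)
    qed
    ultimately have "((\<lambda>h. expinv k h / h) \<longlongrightarrow> 0) (at 0)"
      by (simp add: filterlim_split_at_real)
    then show ?thesis using 3 by (simp add: has_field_derivative_iff expinv_def)
  qed
qed

text \<open>An algebra that contains the bumps and is closed under differentiation, so that
  derivatives of all orders exist without a formula for them.\<close>

inductive_set smooth_class :: "(real \<Rightarrow> real) set" where
  expinv: "(\<lambda>x. expinv k (c * x + d)) \<in> smooth_class"
| const: "(\<lambda>x. c) \<in> smooth_class"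
| add: "f \<in> smooth_class \<Longrightarrow> g \<in> smooth_class \<Longrightarrow> (\<lambda>x. f x + g x) \<in> smooth_class"
| mult: "f \<in> smooth_class \<Longrightarrow> g \<in> smooth_class \<Longrightarrow> (\<lambda>x. f x * g x) \<in> smooth_class"

lemma smooth_class_deriv:
  "f \<in> smooth_class \<Longrightarrow> \<exists>g\<in>smooth_class. \<forall>x. (f has_real_derivative g x) (at x)"
proof (induction rule: smooth_class.induct)
  case (expinv k c d)
  have "((\<lambda>x. expinv k (c * x + d)) has_real_derivative
     (c * expinv (k + 2) (c * x + d) + (c * - real k) * expinv (k + 1) (c * x + d))) (at x)" for x
    by (rule DERIV_cong[OF DERIV_chain2[OF expinv_deriv]]) (auto intro!: derivative_eq_intros simp: algebra_simps)
  moreover have "(\<lambda>x. c * expinv (k + 2) (c * x + d) + (c * - real k) * expinv (k + 1) (c * x + d)) \<in> smooth_class"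
    by (intro smooth_class.intros)
  ultimately show ?case by (intro bexI allI)
next
  case (const c)
  show ?case by (intro bexI[OF _ smooth_class.const[of 0]]) auto
next
  case (add f g)
  then obtain f' g' where "f' \<in> smooth_class" "g' \<in> smooth_class"
    "\<And>x. (f has_real_derivative f' x) (at x)" "\<And>x. (g has_real_derivative g' x) (at x)" by blast
  then show ?case
    by (intro bexI[of _ "\<lambda>x. f' x + g' x"] smooth_class.intros) (auto intro!: derivative_eq_intros)
next
  case (mult f g)
  then obtain f' g' where "f' \<in> smooth_class" "g' \<in> smooth_class"
    "\<And>x. (f has_real_derivative f' x) (at x)" "\<And>x. (g has_real_derivative g' x) (at x)" by blast
  with mult.hyps show ?case
    by (intro bexI[of _ "\<lambda>x. f' x * g x + g' x * f x"] smooth_class.intros) (auto intro!: derivative_eq_intros)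
qed

lemma smooth_class_differentiable:
  assumes "f \<in> smooth_class"
  shows "(deriv ^^ n) f differentiable_on UNIV"
proof -
  have d: "deriv f \<in> smooth_class" if f: "f \<in> smooth_class" for f
  proof -
    obtain g where g: "g \<in> smooth_class" "\<And>x. (f has_real_derivative g x) (at x)"
      using smooth_class_deriv[OF f] by blast
    then have "deriv f = g" by (auto intro: DERIV_imp_deriv)
    with g show ?thesis by simp
  qed
  have "(deriv ^^ n) f \<in> smooth_class"
    by (induction n) (auto intro: assms d)
  from smooth_class_deriv[OF this] show ?thesis
    by (auto simp: differentiable_on_def real_differentiable_def intro: differentiable_at_withinI)
qed

text \<open>The two factors vanish left of a and right of b. The parameter c stays free because a
  large c brings the bump close to the indicator of the open interval; the arguments are spelled in
  the shape of the rule \<open>smooth_class.expinv\<close>.\<close>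

lemma test_function_bump:
  "test_function (\<lambda>x. expinv 0 (c * x + - c * a) * expinv 0 (- c * x + c * b))" if "0 < c"
proof -
  have "{x. expinv 0 (c * x + - c * a) * expinv 0 (- c * x + c * b) \<noteq> 0} \<subseteq> {a..b}"
  proof
    fix x assume "x \<in> {x. expinv 0 (c * x + - c * a) * expinv 0 (- c * x + c * b) \<noteq> 0}"
    then have "0 < c * x + - c * a" "0 < - c * x + c * b" by (auto simp: expinv_def split: if_splits)
    then have "0 < c * (x - a)" "0 < c * (b - x)" by (simp_all add: algebra_simps)
    with that show "x \<in> {a..b}" by (simp add: zero_less_mult_iff)
  qed
  then have "compact (closure {x. expinv 0 (c * x + - c * a) * expinv 0 (- c * x + c * b) \<noteq> 0})"
    by (meson bounded_closed_interval bounded_subset compact_closure)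
  then show ?thesis
    unfolding test_function_def by (intro conjI allI smooth_class_differentiable smooth_class.intros)
qed

lemma test_function_DERIV:
  assumes "test_function \<phi>"
  shows "(\<phi> has_real_derivative deriv \<phi> x) (at x)"
proof -
  have "\<phi> differentiable_on UNIV"
    using assms unfolding test_function_def by (metis funpow_0)
  then have "\<phi> field_differentiable at x"
    by (simp add: differentiable_on_def field_differentiable_def real_differentiable_def)
  then show ?thesis by (simp add: DERIV_deriv_iff_field_differentiable)
qed

lemma test_function_continuous_deriv:
  assumes "test_function \<phi>"
  shows "continuous_on UNIV (deriv \<phi>)"
proof -
  have "(deriv ^^ 1) \<phi> differentiable_on UNIV"
    using assms unfolding test_function_def by blast
  then show ?thesis by (simp add: differentiable_imp_continuous_on)
qed

lemma test_function_continuous: "test_function \<phi> \<Longrightarrow> continuous_on UNIV \<phi>"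
  by (intro continuous_at_imp_continuous_on ballI DERIV_isCont[OF test_function_DERIV])

lemma test_function_support:
  assumes "test_function \<phi>"
  obtains R where "0 < R" "\<And>x. R < \<bar>x\<bar> \<Longrightarrow> \<phi> x = 0" "\<And>x. R < \<bar>x\<bar> \<Longrightarrow> deriv \<phi> x = 0"
proof -
  have "bounded {x. \<phi> x \<noteq> 0}"
    using assms unfolding test_function_def by (meson bounded_closure_image bounded_subset closure_subset compact_imp_bounded)
  then obtain R where R: "0 < R" "\<And>x. \<phi> x \<noteq> 0 \<Longrightarrow> \<bar>x\<bar> \<le> R"
    by (auto simp: bounded_pos)
  have "deriv \<phi> x = 0" if x: "R < \<bar>x\<bar>" for x
  proof -
    have "\<forall>\<^sub>F y in nhds x. \<phi> y = 0"
    proof (rule eventually_mono[OF eventually_nhds_in_open[of "{y. R < \<bar>y\<bar>}"]])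
      show "open {y::real. R < \<bar>y\<bar>}" by (intro open_Collect_less continuous_intros)
    qed (use x R(2) in force)+
    then have "(\<phi> has_real_derivative 0) (at x)"
      using DERIV_cong_ev[OF refl _ refl, of \<phi> "\<lambda>_. 0" x 0] by simp
    then show ?thesis by (rule DERIV_imp_deriv)
  qed
  with R that show thesis by (metis not_le)
qed

lemma continuous_compact_support_bounded:
  fixes f :: "real \<Rightarrow> real"
  assumes "continuous_on UNIV f" "\<And>x. R < \<bar>x\<bar> \<Longrightarrow> f x = 0"
  obtains B where "0 \<le> B" "\<And>x. \<bar>f x\<bar> \<le> B"
proof -
  have "compact (f ` {- R..R})"
    by (intro compact_continuous_image continuous_on_subset[OF assms(1)]) auto
  then obtain B where B: "\<And>x. x \<in> {- R..R} \<Longrightarrow> \<bar>f x\<bar> \<le> B"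
    by (metis compact_imp_bounded bounded_iff imageI real_norm_def)
  have "\<bar>f x\<bar> \<le> max B 0" for x
  proof (cases "R < \<bar>x\<bar>")
    case False
    then have "x \<in> {- R..R}" by auto
    then show ?thesis using B[of x] by simp
  qed (simp add: assms(2))
  then show thesis using that[of "max B 0"] by auto
qed

lemma test_function_bounded:
  assumes "test_function \<phi>"
  obtains B where "0 \<le> B" "\<And>x. \<bar>\<phi> x\<bar> \<le> B" "\<And>x. \<bar>deriv \<phi> x\<bar> \<le> B"
proof -
  obtain R where R: "\<And>x. R < \<bar>x\<bar> \<Longrightarrow> \<phi> x = 0" "\<And>x. R < \<bar>x\<bar> \<Longrightarrow> deriv \<phi> x = 0"
    using test_function_support[OF assms] by metis
  obtain B1 where "0 \<le> B1" "\<And>x. \<bar>\<phi> x\<bar> \<le> B1"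
    using continuous_compact_support_bounded[OF test_function_continuous[OF assms] R(1)] by blast
  moreover obtain B2 where "0 \<le> B2" "\<And>x. \<bar>deriv \<phi> x\<bar> \<le> B2"
    using continuous_compact_support_bounded[OF test_function_continuous_deriv[OF assms] R(2)] by blast
  ultimately show thesis
    using that[of "max B1 B2"] by (metis max.coboundedI1 max.coboundedI2 max.cobounded1 order_trans)
qed

lemma deriv_scale:
  assumes "\<phi> differentiable_on UNIV"
  shows "deriv (\<lambda>x. \<phi> (c * x)) = (\<lambda>x. c * deriv \<phi> (c * x :: real))"
proof
  fix x :: real
  have "(\<phi> has_real_derivative deriv \<phi> (c * x)) (at (c * x))"
    using assms by (simp add: differentiable_on_def DERIV_deriv_iff_real_differentiable)
  then have "((\<lambda>x. \<phi> (c * x)) has_real_derivative deriv \<phi> (c * x) * c) (at x)"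
    by (rule DERIV_chain2) (auto intro!: derivative_eq_intros)
  then show "deriv (\<lambda>x. \<phi> (c * x)) x = c * deriv \<phi> (c * x)"
    by (simp add: DERIV_imp_deriv mult.commute)
qed

text \<open>A dilation acting on a function is moved onto the test function, so the latter class has
  to be stable under scaling.\<close>

lemma test_function_scale:
  assumes \<phi>: "test_function \<phi>" and c: "0 < c"
  shows "test_function (\<lambda>x. \<phi> (c * x))"
proof -
  have D: "(deriv ^^ n) \<phi> differentiable_on UNIV" for n
    using \<phi> by (simp add: test_function_def)
  have "(deriv ^^ n) (\<lambda>x. \<phi> (c * x)) = (\<lambda>x. c ^ n * (deriv ^^ n) \<phi> (c * x))" for n
  proof (induction n)
    case (Suc n)
    have "(\<lambda>x. (deriv ^^ n) \<phi> (c * x)) differentiable_on UNIV"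
      using differentiable_on_compose[of "\<lambda>x. c * x" UNIV "(deriv ^^ n) \<phi>"]
      by (auto intro!: derivative_intros differentiable_on_subset[OF D])
    then have "deriv (\<lambda>x. c ^ n * (deriv ^^ n) \<phi> (c * x)) x = c ^ n * deriv (\<lambda>x. (deriv ^^ n) \<phi> (c * x)) x" for x
      by (intro deriv_cmult) (simp add: differentiable_on_def field_differentiable_def real_differentiable_def)
    then show ?case by (simp add: Suc.IH deriv_scale[OF D] fun_eq_iff)
  qed simp
  moreover have "(\<lambda>x. c ^ n * (deriv ^^ n) \<phi> (c * x)) differentiable_on UNIV" for n
    using differentiable_on_compose[of "\<lambda>x. c * x" UNIV "(deriv ^^ n) \<phi>"]
    by (auto intro!: derivative_intros differentiable_on_subset[OF D])
  moreover obtain R where R: "0 < R" "\<And>x. R < \<bar>x\<bar> \<Longrightarrow> \<phi> x = 0"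
    using test_function_support[OF \<phi>] by metis
  have "{x. \<phi> (c * x) \<noteq> 0} \<subseteq> {- (R / c)..R / c}"
  proof
    fix x assume "x \<in> {x. \<phi> (c * x) \<noteq> 0}"
    then have "\<bar>c * x\<bar> \<le> R" using R(2) by force
    then have "- R \<le> c * x" "c * x \<le> R" by (auto simp: abs_le_iff)
    then show "x \<in> {- (R / c)..R / c}" using c by (auto simp: field_simps)
  qed
  then have "compact (closure {x. \<phi> (c * x) \<noteq> 0})"
    by (meson bounded_closed_interval bounded_subset compact_closure)
  ultimately show ?thesis by (simp add: test_function_def)
qed

lemma test_function_measurable:
  assumes "test_function \<phi>"
  shows "\<phi> \<in> borel_measurable borel" "deriv \<phi> \<in> borel_measurable borel"
  using test_function_continuous[OF assms] test_function_continuous_deriv[OF assms]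
  by (auto intro: borel_measurable_continuous_onI)

text \<open>The indicator of an interval is a bounded pointwise limit of test functions: the values of
  \<open>expinv 0\<close> tend to 1 at infinity.\<close>

lemma locally_integrable_zero_AE:
  assumes u: "locally_integrable u" "u \<in> borel_measurable borel"
    and zero: "\<And>\<phi>. test_function \<phi> \<Longrightarrow> (\<integral>x. u x * \<phi> x \<partial>lborel) = 0"
  shows "AE x in lborel. u x = 0"
proof -
  note [measurable] = u(2)
  have int: "integrable lborel (\<lambda>x. indicator A x * u x)" if "bounded A" "A \<in> sets borel" for A
  proof -
    obtain R where R: "A \<subseteq> {- R..R}"
      using \<open>bounded A\<close> by (auto simp: bounded_iff abs_le_iff subset_iff) (metis minus_le_iff)
    have "integrable lborel (\<lambda>x. indicator {- R..R} x * u x)"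
      using u(1) compact_Icc[of "- R" R] by (simp add: locally_integrable_def set_integrable_def)
    then have "integrable lborel (\<lambda>x. indicator A x *\<^sub>R (indicator {- R..R} x * u x))"
      using that(2) by (intro integrable_mult_indicator) auto
    moreover have "(\<lambda>x. indicator A x *\<^sub>R (indicator {- R..R} x * u x)) = (\<lambda>x. indicator A x * u x)"
      using R by (auto simp: fun_eq_iff indicator_def)
    ultimately show ?thesis by simp
  qed
  have open_ivl: "(\<integral>x. indicator {a<..<b} x * u x \<partial>lborel) = 0" for a b
  proof -
    define \<phi> where "\<phi> n x = expinv 0 (real (Suc n) * x + - real (Suc n) * a) * expinv 0 (- real (Suc n) * x + real (Suc n) * b)" for n x
    have [measurable]: "\<phi> n \<in> borel_measurable borel" for n
      using test_function_measurable(1)[OF test_function_bump[of "real (Suc n)" a b]]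
      by (simp add: \<phi>_def[abs_def])
    have in_iff: "x \<in> {a<..<b} \<longleftrightarrow> 0 < real (Suc n) * x + - real (Suc n) * a \<and> 0 < - real (Suc n) * x + real (Suc n) * b" for x n
    proof -
      have "0 < real (Suc n) * (x - a) \<longleftrightarrow> a < x" "0 < real (Suc n) * (b - x) \<longleftrightarrow> x < b"
        by (simp_all only: zero_less_mult_iff) auto
      then show ?thesis by (simp add: algebra_simps)
    qed
    have e1: "0 \<le> expinv 0 y" "expinv 0 y \<le> 1" for y by (auto simp: expinv_def)
    have lim: "(\<lambda>n. \<phi> n x) \<longlonglongrightarrow> indicator {a<..<b} x" for x
    proof (cases "x \<in> {a<..<b}")
      case True
      have *: "(\<lambda>n. exp (- (1 / (real (Suc n) * d)))) \<longlonglongrightarrow> 1" if "0 < d" for d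
      proof -
        have "(\<lambda>n. 1 / d * inverse (real (Suc n))) \<longlonglongrightarrow> 1 / d * 0"
          by (intro tendsto_intros LIMSEQ_inverse_real_of_nat)
        then have "(\<lambda>n. exp (- (1 / d * inverse (real (Suc n))))) \<longlonglongrightarrow> exp (- (1 / d * 0))"
          by (intro tendsto_exp tendsto_minus)
        then show ?thesis by (simp add: field_simps)
      qed
      have "(\<lambda>n. exp (- (1 / (real (Suc n) * (x - a)))) * exp (- (1 / (real (Suc n) * (b - x))))) \<longlonglongrightarrow> 1 * 1"
        using True by (intro tendsto_mult *) auto
      moreover have "\<phi> n x = exp (- (1 / (real (Suc n) * (x - a)))) * exp (- (1 / (real (Suc n) * (b - x))))" for n
        using in_iff[of x n] True by (simp add: \<phi>_def expinv_def algebra_simps)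
      ultimately show ?thesis using True by simp
    next
      case False
      then have "\<phi> n x = 0" for n
        using in_iff[of x n] by (auto simp: \<phi>_def expinv_def)
      then show ?thesis using False by simp
    qed
    \<comment> \<open>The bumps lie between 0 and the indicator of the interval, on which u is
      integrable.\<close>
    have "(\<lambda>n. \<integral>x. u x * \<phi> n x \<partial>lborel) \<longlonglongrightarrow> (\<integral>x. u x * indicator {a<..<b} x \<partial>lborel)"
    proof (rule Bochner_Integration.integral_dominated_convergence)
      show "integrable lborel (\<lambda>x. \<bar>indicator {a<..<b} x * u x\<bar>)"
        by (intro integrable_abs int) auto
      show "AE x in lborel. (\<lambda>n. u x * \<phi> n x) \<longlonglongrightarrow> u x * indicator {a<..<b} x"
        by (intro AE_I2 tendsto_intros lim)
      show "AE x in lborel. norm (u x * \<phi> n x) \<le> \<bar>indicator {a<..<b} x * u x\<bar>" for n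
      proof (rule AE_I2)
        fix x
        have "\<bar>\<phi> n x\<bar> \<le> indicator {a<..<b} x"
          using in_iff[of x n] e1
          by (auto simp: \<phi>_def abs_mult indicator_def expinv_def mult_le_one)
        then show "norm (u x * \<phi> n x) \<le> \<bar>indicator {a<..<b} x * u x\<bar>"
          using mult_left_mono[of "\<bar>\<phi> n x\<bar>" "indicator {a<..<b} x" "\<bar>u x\<bar>"]
          by (simp add: abs_mult mult.commute)
      qed
    qed auto
    moreover have "(\<integral>x. u x * \<phi> n x \<partial>lborel) = 0" for n
      unfolding \<phi>_def by (intro zero test_function_bump) simp
    ultimately have "(\<integral>x. u x * indicator {a<..<b} x \<partial>lborel) = 0"
      by (simp add: LIMSEQ_const_iff)
    then show ?thesis by (simp add: mult.commute)
  qed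
  have ivl: "(\<integral>x. indicator {a..b} x * u x \<partial>lborel) = 0" for a b
  proof -
    have "(\<integral>x. indicator {a..b} x * u x \<partial>lborel) = (\<integral>x. indicator {a<..<b} x * u x \<partial>lborel)"
    proof (rule integral_cong_AE)
      show "AE x in lborel. indicator {a..b} x * u x = indicator {a<..<b} x * u x"
        using AE_lborel_singleton[of a] AE_lborel_singleton[of b]
        by eventually_elim (auto simp: indicator_def)
    qed auto
    then show ?thesis by (simp add: open_ivl)
  qed
  \<comment> \<open>After truncation u is integrable, and vanishing integrals spread from intervals
    to all Borel sets. Countably many N then cover the line.\<close>
  have "AE x in lborel. indicator {- real N..real N} x * u x = 0" for N :: nat
  proof (rule density_unique_real)
    define I where "I = {- real N..real N}"
    have I [measurable]: "I \<in> sets borel" by (simp add: I_def)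
    show "integrable lborel (\<lambda>x. indicator {- real N..real N} x * u x)" by (intro int) auto
    then have intI: "integrable lborel (\<lambda>x. indicator A x * (indicator I x * u x))" if "A \<in> sets borel" for A
      using integrable_mult_indicator[of A lborel "\<lambda>x. indicator I x * u x"] that by (simp add: I_def)
    fix A :: "real set" assume "A \<in> sets lborel"
    then have "A \<in> sets borel" by simp
    then have "(\<integral>x. indicator A x * (indicator I x * u x) \<partial>lborel) = 0"
    proof (induction A rule: borel_set_induct)
      case empty then show ?case by simp
    next
      case (interval a b)
      have "(\<lambda>x. indicator {a..b} x * (indicator I x * u x)) = (\<lambda>x. indicator {max a (- N)..min b N} x * u x)"
        by (auto simp: indicator_def I_def fun_eq_iff)
      then show ?case using ivl[of "max a (- N)" "min b N"] by simp
    next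
      case (compl A)
      have "(\<integral>x. indicator (- A) x * (indicator I x * u x) \<partial>lborel)
        = (\<integral>x. indicator UNIV x * (indicator I x * u x) - indicator A x * (indicator I x * u x) \<partial>lborel)"
        by (rule Bochner_Integration.integral_cong) (auto simp: indicator_def)
      also have "\<dots> = (\<integral>x. indicator UNIV x * (indicator I x * u x) \<partial>lborel) - (\<integral>x. indicator A x * (indicator I x * u x) \<partial>lborel)"
        using compl by (intro Bochner_Integration.integral_diff intI) auto
      also have "\<dots> = 0" using compl ivl[of "- N" N] by (simp add: I_def)
      finally show ?case .
    next
      case (union B)
      note [measurable] = union(2)
      have "(\<lambda>n. \<integral>x. indicator (\<Union>i<n. B i) x * (indicator I x * u x) \<partial>lborel)
        \<longlonglongrightarrow> (\<integral>x. indicator (\<Union>i. B i) x * (indicator I x * u x) \<partial>lborel)"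
      proof (rule Bochner_Integration.integral_dominated_convergence)
        show "integrable lborel (\<lambda>x. \<bar>indicator UNIV x * (indicator I x * u x)\<bar>)"
          by (intro integrable_abs intI) auto
        show "AE x in lborel. (\<lambda>n. indicator (\<Union>i<n. B i) x * (indicator I x * u x))
            \<longlonglongrightarrow> indicator (\<Union>i. B i) x * (indicator I x * u x)"
          by (intro AE_I2 tendsto_intros LIMSEQ_indicator_UN)
      qed (auto simp: indicator_def)
      moreover have "(\<integral>x. indicator (\<Union>i<n. B i) x * (indicator I x * u x) \<partial>lborel) = 0" for n
      proof -
        have "disjoint_family_on B {..<n}"
          using union(1) by (auto simp: disjoint_family_on_def)
        then have "indicator (\<Union>i<n. B i) x = (\<Sum>i<n. indicator (B i) x :: real)" for x
          by (rule indicator_UN_disjoint[OF finite_lessThan])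
        then have "(\<integral>x. indicator (\<Union>i<n. B i) x * (indicator I x * u x) \<partial>lborel)
          = (\<integral>x. (\<Sum>i<n. indicator (B i) x * (indicator I x * u x)) \<partial>lborel)"
          by (simp add: sum_distrib_right)
        also have "\<dots> = (\<Sum>i<n. \<integral>x. indicator (B i) x * (indicator I x * u x) \<partial>lborel)"
          using union(2) by (intro Bochner_Integration.integral_sum intI) auto
        finally show ?thesis using union(3) by simp
      qed
      ultimately show ?case by (simp add: LIMSEQ_const_iff)
    qed
    then show "(\<integral>x\<in>A. (indicator {- real N..real N} x * u x) \<partial>lborel) = (\<integral>x\<in>A. 0 \<partial>lborel)"
      by (simp add: set_lebesgue_integral_def I_def)
  qed auto
  then have "AE x in lborel. \<forall>N::nat. indicator {- real N..real N} x * u x = 0"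
    unfolding AE_all_countable by blast
  then show ?thesis
  proof eventually_elim
    case (elim x)
    obtain N :: nat where "\<bar>x\<bar> \<le> real N" using real_arch_simple by blast
    then show ?case using elim[rule_format, of N] by (simp add: indicator_def abs_le_iff minus_le_iff split: if_splits)
  qed
qed

section \<open>Weighted integrable functions and dilations\<close>

lemma weight_ge_1: "0 \<le> a \<Longrightarrow> 1 \<le> weight a x"
  unfolding weight_def by (rule ge_one_powr_ge_zero) auto

lemma weight_pos: "0 < weight a x"
  by (simp add: weight_def add_pos_nonneg)

lemma weight_nonneg [simp]: "0 \<le> weight a x"
  by (simp add: weight_def)

lemma weight_continuous: "continuous_on UNIV (weight a)"
  unfolding weight_def by (intro continuous_intros) auto

lemma weight_measurable [measurable]: "weight a \<in> borel_measurable borel"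
  by (rule borel_measurable_continuous_onI[OF weight_continuous])

lemma weight_mono: "0 \<le> a \<Longrightarrow> \<bar>x\<bar> \<le> \<bar>y\<bar> \<Longrightarrow> weight a x \<le> weight a y"
  unfolding weight_def by (intro powr_mono2) auto

lemma weight_submult:
  assumes "0 \<le> a"
  shows "weight a (x + y) \<le> weight a x * weight a y"
proof -
  have "1 + \<bar>x + y\<bar> \<le> (1 + \<bar>x\<bar>) * (1 + \<bar>y\<bar>)"
    using abs_triangle_ineq[of x y] mult_nonneg_nonneg[of "\<bar>x\<bar>" "\<bar>y\<bar>"]
    by (simp add: algebra_simps del: mult_nonneg_nonneg)
  then have "weight a (x + y) \<le> ((1 + \<bar>x\<bar>) * (1 + \<bar>y\<bar>)) powr a"
    unfolding weight_def using assms by (intro powr_mono2) auto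
  then show ?thesis by (simp add: weight_def powr_mult)
qed

lemma weight_scale:
  assumes "0 \<le> a" "1 \<le> c"
  shows "weight a (c * x) \<le> c powr a * weight a x"
proof -
  have "weight a (c * x) \<le> (c * (1 + \<bar>x\<bar>)) powr a"
    unfolding weight_def using assms by (intro powr_mono2) (auto simp: abs_mult algebra_simps)
  then show ?thesis using assms by (simp add: weight_def powr_mult)
qed

lemma power_le_weight:
  assumes "real k \<le> a"
  shows "\<bar>x\<bar> ^ k \<le> weight a x"
proof -
  have "\<bar>x\<bar> ^ k \<le> (1 + \<bar>x\<bar>) ^ k" by (intro power_mono) auto
  also have "\<dots> = (1 + \<bar>x\<bar>) powr real k" by (simp add: powr_realpow add_pos_nonneg)
  also have "\<dots> \<le> weight a x" unfolding weight_def using assms by (intro powr_mono) auto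
  finally show ?thesis .
qed

lemma powr_le_weight: "0 \<le> a \<Longrightarrow> \<bar>x\<bar> powr a \<le> weight a x"
  unfolding weight_def by (intro powr_mono2) auto

lemma L1w_measurable: "h \<in> L1w a \<Longrightarrow> h \<in> borel_measurable borel"
  and L1w_integrable: "h \<in> L1w a \<Longrightarrow> integrable lborel (\<lambda>x. h x * weight a x)"
  by (simp_all add: L1w_def)

lemma L1wI: "h \<in> borel_measurable borel \<Longrightarrow> integrable lborel (\<lambda>x. \<bar>h x\<bar> * weight a x) \<Longrightarrow> h \<in> L1w a"
  using integrable_abs_iff[of "\<lambda>x. h x * weight a x" lborel] by (simp add: L1w_def abs_mult)

lemma L1w_integrable_abs: "h \<in> L1w a \<Longrightarrow> integrable lborel (\<lambda>x. \<bar>h x\<bar> * weight a x)"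
  using integrable_abs[OF L1w_integrable[of h a]] by (simp add: abs_mult)

lemma L1w_lincomb: "h \<in> L1w a \<Longrightarrow> k \<in> L1w a \<Longrightarrow> (\<lambda>x. c * h x + d * k x) \<in> L1w a"
  unfolding L1w_def by (auto simp: distrib_right mult.assoc)

lemma L1w_norm_nonneg: "0 \<le> L1w_norm a h"
  by (simp add: L1w_norm_def)

text \<open>Duality between the weighted space and functions of growth at most the weight; every
  functional in the proof is an instance.\<close>

lemma L1w_pairing:
  fixes \<psi> :: "real \<Rightarrow> 'b::{banach, second_countable_topology}"
  assumes h: "h \<in> L1w a" and [measurable]: "\<psi> \<in> borel_measurable borel"
    and \<psi>: "\<And>x. norm (\<psi> x) \<le> C * weight a x"
  shows "integrable lborel (\<lambda>x. h x *\<^sub>R \<psi> x)"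
    and "norm (\<integral>x. h x *\<^sub>R \<psi> x \<partial>lborel) \<le> C * L1w_norm a h"
proof -
  note [measurable] = L1w_measurable[OF h]
  have le: "norm (h x *\<^sub>R \<psi> x) \<le> C * (\<bar>h x\<bar> * weight a x)" for x
    using mult_left_mono[OF \<psi>[of x], of "\<bar>h x\<bar>"] by (simp add: ac_simps)
  have i: "integrable lborel (\<lambda>x. C * (\<bar>h x\<bar> * weight a x))"
    using L1w_integrable_abs[OF h] by simp
  show *: "integrable lborel (\<lambda>x. h x *\<^sub>R \<psi> x)"
    by (rule Bochner_Integration.integrable_bound[OF i])
      (auto intro!: AE_I2 order_trans[OF le] simp del: norm_scaleR)
  have "norm (\<integral>x. h x *\<^sub>R \<psi> x \<partial>lborel) \<le> (\<integral>x. norm (h x *\<^sub>R \<psi> x) \<partial>lborel)"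
    by (rule integral_norm_bound)
  also have "\<dots> \<le> (\<integral>x. C * (\<bar>h x\<bar> * weight a x) \<partial>lborel)"
    by (intro integral_mono integrable_norm * i le)
  finally show "norm (\<integral>x. h x *\<^sub>R \<psi> x \<partial>lborel) \<le> C * L1w_norm a h"
    by (simp add: L1w_norm_def)
qed

text \<open>The space \<open>L1w a\<close> is identified with \<open>l1\<close> by multiplication with the weight.\<close>

definition to_l1 :: "real \<Rightarrow> (real \<Rightarrow> real) \<Rightarrow> l1" where
  "to_l1 a h = abs_l1 (\<lambda>x. h x * weight a x)"

definition of_l1 :: "real \<Rightarrow> l1 \<Rightarrow> real \<Rightarrow> real" where
  "of_l1 a u x = rep_l1 u x / weight a x"

lemma rep_l1_measurable [measurable]: "rep_l1 u \<in> borel_measurable borel"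
  using borel_measurable_integrable[OF integrable_rep_l1[of u]] by simp

lemma of_l1_weight: "of_l1 a u x * weight a x = rep_l1 u x"
  using weight_pos[of a x] by (simp add: of_l1_def)

lemma of_l1_in_L1w [simp]: "of_l1 a u \<in> L1w a"
  unfolding L1w_def mem_Collect_eq of_l1_weight by (simp add: of_l1_def[abs_def])

lemma of_l1_measurable [measurable]: "of_l1 a u \<in> borel_measurable borel"
  by (rule L1w_measurable[OF of_l1_in_L1w])

lemma norm_to_l1: "h \<in> L1w a \<Longrightarrow> norm (to_l1 a h) = L1w_norm a h"
  unfolding to_l1_def L1w_norm_def
  by (subst norm_abs_l1) (auto simp: abs_mult L1w_integrable)

lemma to_of_l1 [simp]: "to_l1 a (of_l1 a u) = u"
  unfolding to_l1_def of_l1_weight by (rule abs_rep_l1)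

lemma norm_of_l1: "L1w_norm a (of_l1 a u) = norm u"
  using norm_to_l1[OF of_l1_in_L1w[of a u]] by simp

lemma of_to_l1:
  assumes "h \<in> L1w a"
  shows "AE x in lborel. of_l1 a (to_l1 a h) x = h x"
  using rep_abs_l1[OF L1w_integrable[OF assms]]
proof eventually_elim
  case (elim x)
  then show ?case using weight_pos[of a x] by (simp add: to_l1_def of_l1_def)
qed

lemma to_l1_cong:
  "h \<in> L1w a \<Longrightarrow> k \<in> L1w a \<Longrightarrow> AE x in lborel. h x = k x \<Longrightarrow> to_l1 a h = to_l1 a k"
  unfolding to_l1_def by (intro abs_l1_eqI L1w_integrable) (auto elim: eventually_mono)

lemma to_l1_lincomb:
  "h \<in> L1w a \<Longrightarrow> k \<in> L1w a \<Longrightarrow> to_l1 a (\<lambda>x. c * h x + d * k x) = c *\<^sub>R to_l1 a h + d *\<^sub>R to_l1 a k"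
  unfolding to_l1_def
  by (simp add: abs_l1_scaleR abs_l1_add L1w_integrable distrib_right mult.assoc)

lemma of_l1_lincomb:
  "AE x in lborel. of_l1 a (c *\<^sub>R u + d *\<^sub>R v) x = c * of_l1 a u x + d * of_l1 a v x"
  using of_to_l1[OF L1w_lincomb[OF of_l1_in_L1w of_l1_in_L1w, of c a u d v]]
  by (simp add: to_l1_lincomb)

text \<open>The operators are defined on functions, so compatibility with almost everywhere equality
  is a hypothesis of its own. The second conclusion says that the representative chosen by
  \<open>of_l1\<close> does not matter.\<close>

lemma lift_operator:
  assumes \<Phi>: "\<And>h. h \<in> L1w a \<Longrightarrow> \<Phi> h \<in> L1w a"
    and lin: "\<And>h k c d. h \<in> L1w a \<Longrightarrow> k \<in> L1w a \<Longrightarrow>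
      AE x in lborel. \<Phi> (\<lambda>y. c * h y + d * k y) x = c * \<Phi> h x + d * \<Phi> k x"
    and cong: "\<And>h k. h \<in> L1w a \<Longrightarrow> k \<in> L1w a \<Longrightarrow> AE x in lborel. h x = k x \<Longrightarrow> AE x in lborel. \<Phi> h x = \<Phi> k x"
    and bound: "\<And>h. h \<in> L1w a \<Longrightarrow> L1w_norm a (\<Phi> h) \<le> C * L1w_norm a h"
  shows "bounded_linear (\<lambda>u. to_l1 a (\<Phi> (of_l1 a u)))"
    and "\<And>h. h \<in> L1w a \<Longrightarrow> to_l1 a (\<Phi> (of_l1 a (to_l1 a h))) = to_l1 a (\<Phi> h)"
    and "\<And>u. norm (to_l1 a (\<Phi> (of_l1 a u))) \<le> C * norm u"
proof -
  have *: "to_l1 a (\<Phi> (of_l1 a (c *\<^sub>R u + d *\<^sub>R v)))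
      = c *\<^sub>R to_l1 a (\<Phi> (of_l1 a u)) + d *\<^sub>R to_l1 a (\<Phi> (of_l1 a v))" for c d u v
  proof -
    have "AE x in lborel. \<Phi> (of_l1 a (c *\<^sub>R u + d *\<^sub>R v)) x = \<Phi> (\<lambda>y. c * of_l1 a u y + d * of_l1 a v y) x"
      by (intro cong of_l1_lincomb L1w_lincomb of_l1_in_L1w)
    moreover have "AE x in lborel. \<Phi> (\<lambda>y. c * of_l1 a u y + d * of_l1 a v y) x
        = c * \<Phi> (of_l1 a u) x + d * \<Phi> (of_l1 a v) x"
      by (intro lin of_l1_in_L1w)
    ultimately have "AE x in lborel. \<Phi> (of_l1 a (c *\<^sub>R u + d *\<^sub>R v)) x = c * \<Phi> (of_l1 a u) x + d * \<Phi> (of_l1 a v) x"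
      by eventually_elim simp
    then have "to_l1 a (\<Phi> (of_l1 a (c *\<^sub>R u + d *\<^sub>R v))) = to_l1 a (\<lambda>x. c * \<Phi> (of_l1 a u) x + d * \<Phi> (of_l1 a v) x)"
      by (intro to_l1_cong \<Phi> of_l1_in_L1w L1w_lincomb)
    then show ?thesis by (simp add: to_l1_lincomb \<Phi>)
  qed
  show bd: "norm (to_l1 a (\<Phi> (of_l1 a u))) \<le> C * norm u" for u
    using bound[of "of_l1 a u"] by (simp add: norm_to_l1 \<Phi> norm_of_l1)
  show "bounded_linear (\<lambda>u. to_l1 a (\<Phi> (of_l1 a u)))"
  proof (rule bounded_linear_intro[where K = C])
    show "to_l1 a (\<Phi> (of_l1 a (u + v))) = to_l1 a (\<Phi> (of_l1 a u)) + to_l1 a (\<Phi> (of_l1 a v))" for u v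
      using *[of 1 u 1 v] by simp
    show "to_l1 a (\<Phi> (of_l1 a (c *\<^sub>R u))) = c *\<^sub>R to_l1 a (\<Phi> (of_l1 a u))" for c u
      using *[of c u 0 u] by simp
    show "norm (to_l1 a (\<Phi> (of_l1 a u))) \<le> norm u * C" for u
      using bd[of u] by (simp add: mult.commute)
  qed
  show "to_l1 a (\<Phi> (of_l1 a (to_l1 a h))) = to_l1 a (\<Phi> h)" if "h \<in> L1w a" for h
    using that by (intro to_l1_cong \<Phi> cong of_to_l1 of_l1_in_L1w)
qed

text \<open>The values may lie in any Banach space with a countable base, so that powers, test
  functions and complex exponentials share the same lemmas.\<close>

definition pairing :: "real \<Rightarrow> (real \<Rightarrow> 'b::{banach, second_countable_topology}) \<Rightarrow> l1 \<Rightarrow> 'b" where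
  "pairing a \<psi> u = (\<integral>x. of_l1 a u x *\<^sub>R \<psi> x \<partial>lborel)"

lemma pairing_linear:
  fixes \<psi> :: "real \<Rightarrow> 'b::{banach, second_countable_topology}"
  assumes [measurable]: "\<psi> \<in> borel_measurable borel" and \<psi>: "\<And>x. norm (\<psi> x) \<le> C * weight a x"
  shows "bounded_linear (pairing a \<psi>)"
    and "h \<in> L1w a \<Longrightarrow> pairing a \<psi> (to_l1 a h) = (\<integral>x. h x *\<^sub>R \<psi> x \<partial>lborel)"
    and "norm (pairing a \<psi> u) \<le> C * norm u"
proof -
  note int = L1w_pairing(1)[OF _ assms]
  have cong: "(\<integral>x. h x *\<^sub>R \<psi> x \<partial>lborel) = (\<integral>x. k x *\<^sub>R \<psi> x \<partial>lborel)"
    if "h \<in> L1w a" "k \<in> L1w a" "AE x in lborel. h x = k x" for h k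
    using that by (intro integral_cong_AE borel_measurable_integrable int) (auto elim: eventually_mono)
  have *: "pairing a \<psi> (c *\<^sub>R u + d *\<^sub>R v) = c *\<^sub>R pairing a \<psi> u + d *\<^sub>R pairing a \<psi> v" for c d u v
  proof -
    have "pairing a \<psi> (c *\<^sub>R u + d *\<^sub>R v) = (\<integral>x. (c * of_l1 a u x + d * of_l1 a v x) *\<^sub>R \<psi> x \<partial>lborel)"
      unfolding pairing_def by (intro cong of_l1_lincomb L1w_lincomb of_l1_in_L1w)
    also have "\<dots> = (\<integral>x. c *\<^sub>R (of_l1 a u x *\<^sub>R \<psi> x) + d *\<^sub>R (of_l1 a v x *\<^sub>R \<psi> x) \<partial>lborel)"
      by (simp add: scaleR_add_left)
    also have "\<dots> = c *\<^sub>R pairing a \<psi> u + d *\<^sub>R pairing a \<psi> v"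
      unfolding pairing_def
      by (subst Bochner_Integration.integral_add)
        (auto intro!: int integrable_scaleR_right simp del: scaleR_scaleR)
    finally show ?thesis .
  qed
  show bd: "norm (pairing a \<psi> u) \<le> C * norm u" for u
    unfolding pairing_def using L1w_pairing(2)[OF of_l1_in_L1w assms, of u] by (simp add: norm_of_l1)
  show "bounded_linear (pairing a \<psi>)"
  proof (rule bounded_linear_intro[where K = C])
    show "pairing a \<psi> (u + v) = pairing a \<psi> u + pairing a \<psi> v" for u v
      using *[of 1 u 1 v] by simp
    show "pairing a \<psi> (c *\<^sub>R u) = c *\<^sub>R pairing a \<psi> u" for c u
      using *[of c u 0 u] by simp
    show "norm (pairing a \<psi> u) \<le> norm u * C" for u
      using bd[of u] by (simp add: mult.commute)
  qed
  show "pairing a \<psi> (to_l1 a h) = (\<integral>x. h x *\<^sub>R \<psi> x \<partial>lborel)" if "h \<in> L1w a"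
    unfolding pairing_def using that by (intro cong of_to_l1 of_l1_in_L1w)
qed

text \<open>The inner factor exp (- t / 4) makes the dilation preserve mass and gives the generator
  - 1 / 4 (x h)'. The outer factor exp (- t) adds the - h that remains of the collision operator
  besides \<open>K\<close>.\<close>

definition dil :: "real \<Rightarrow> (real \<Rightarrow> real) \<Rightarrow> real \<Rightarrow> real" where
  "dil t h x = exp (- t) * (exp (- t / 4) * h (exp (- t / 4) * x))"

lemma dil_add: "dil (s + t) h = dil s (dil t h)"
proof
  fix x
  have "exp (- (s + t)) = exp (- s) * exp (- t)" "exp (- (s + t) / 4) = exp (- s / 4) * exp (- t / 4)"
    by (simp_all flip: exp_add add: add_divide_distrib)
  then show "dil (s + t) h x = dil s (dil t h) x" by (simp add: dil_def ac_simps)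
qed

lemma dil_measurable:
  assumes [measurable]: "h \<in> borel_measurable borel"
  shows "dil t h \<in> borel_measurable borel"
  unfolding dil_def[abs_def] by measurable

lemma dil_cong_AE:
  assumes [measurable]: "h \<in> borel_measurable borel" "k \<in> borel_measurable borel"
    and "AE x in lborel. h x = k x"
  shows "AE x in lborel. dil t h x = dil t k x"
proof -
  have "AE x in lborel. h (0 + exp (- t / 4) * x) = k (0 + exp (- t / 4) * x)"
    by (rule AE_borel_affine[OF _ _ assms(3)]) auto
  then show ?thesis by eventually_elim (simp add: dil_def)
qed

lemma dil_integral:
  fixes \<psi> :: "real \<Rightarrow> 'b::{banach, second_countable_topology}"
  shows "(\<integral>x. dil t h x *\<^sub>R \<psi> x \<partial>lborel) = exp (- t) *\<^sub>R (\<integral>x. h x *\<^sub>R \<psi> (exp (t / 4) * x) \<partial>lborel)"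
proof -
  define c where "c = exp (t / 4)"
  have c: "0 < c" "exp (- t / 4) = inverse c"
    by (simp_all add: c_def exp_minus)
  have "(\<integral>x. dil t h x *\<^sub>R \<psi> x \<partial>lborel) = c *\<^sub>R (\<integral>x. dil t h (c * x) *\<^sub>R \<psi> (c * x) \<partial>lborel)"
    using lborel_integral_real_affine[of c "\<lambda>x. dil t h x *\<^sub>R \<psi> x" 0] c(1) by simp
  also have "(\<lambda>x. dil t h (c * x) *\<^sub>R \<psi> (c * x)) = (\<lambda>x. inverse c *\<^sub>R exp (- t) *\<^sub>R (h x *\<^sub>R \<psi> (c * x)))"
    unfolding dil_def c(2) using c(1) by (simp add: fun_eq_iff mult.assoc[symmetric])
  also have "c *\<^sub>R (\<integral>x. inverse c *\<^sub>R exp (- t) *\<^sub>R (h x *\<^sub>R \<psi> (c * x)) \<partial>lborel)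
    = exp (- t) *\<^sub>R (\<integral>x. h x *\<^sub>R \<psi> (c * x) \<partial>lborel)"
    using c(1) by (simp only: integral_scaleR_right) simp
  finally show ?thesis by (simp only: c_def)
qed

lemma dil_integrable:
  fixes \<psi> :: "real \<Rightarrow> 'b::{banach, second_countable_topology}"
  assumes "integrable lborel (\<lambda>x. h x *\<^sub>R \<psi> (exp (t / 4) * x))"
  shows "integrable lborel (\<lambda>x. dil t h x *\<^sub>R \<psi> x)"
proof -
  define c where "c = exp (t / 4)"
  have c: "0 < c" "exp (- t / 4) = inverse c"
    by (simp_all add: c_def exp_minus)
  have "integrable lborel (\<lambda>x. h (inverse c * x) *\<^sub>R \<psi> (c * (inverse c * x)))"
    using lborel_integrable_real_affine[OF assms, of "inverse c" 0] c(1) by (simp add: c_def)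
  then have "integrable lborel (\<lambda>x. exp (- t) *\<^sub>R inverse c *\<^sub>R (h (inverse c * x) *\<^sub>R \<psi> x))"
    using c(1) by (intro integrable_scaleR_right) (simp add: mult.assoc[symmetric])
  then show ?thesis unfolding dil_def c(2) by (simp add: mult.assoc)
qed

text \<open>Changing variables moves the dilation onto the weight. For t \<ge> 0 the constant M is
  exp (t / 4)^a; for t < 0 the arguments shrink and M = 1 suffices.\<close>

lemma dil_weight_bound:
  assumes "0 \<le> a" "h \<in> L1w a" "1 \<le> M" "\<And>x. weight a (exp (t / 4) * x) \<le> M * weight a x"
  shows "dil t h \<in> L1w a" "L1w_norm a (dil t h) \<le> exp (- t) * M * L1w_norm a h"
proof -
  note [measurable] = L1w_measurable[OF assms(2)]
  have abs: "\<bar>dil t h x\<bar> = dil t (\<lambda>x. \<bar>h x\<bar>) x" for x by (simp add: dil_def abs_mult)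
  have abs_h: "(\<lambda>x. \<bar>h x\<bar>) \<in> L1w a"
    using assms(2) L1w_integrable_abs[OF assms(2)] by (simp add: L1w_def)
  have i: "integrable lborel (\<lambda>x. \<bar>h x\<bar> *\<^sub>R weight a (exp (t / 4) * x))"
    by (rule L1w_pairing(1)[OF abs_h, of _ M]) (use assms(4) in auto)
  from dil_integrable[OF i] show "dil t h \<in> L1w a"
    by (intro L1wI dil_measurable) (simp_all add: abs)
  have "L1w_norm a (dil t h) = exp (- t) * (\<integral>x. \<bar>h x\<bar> *\<^sub>R weight a (exp (t / 4) * x) \<partial>lborel)"
    using dil_integral[of t "\<lambda>x. \<bar>h x\<bar>" "weight a"] by (simp add: L1w_norm_def abs)
  also have "\<dots> \<le> exp (- t) * (\<integral>x. M * (\<bar>h x\<bar> * weight a x) \<partial>lborel)"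
  proof (intro mult_left_mono integral_mono i)
    show "integrable lborel (\<lambda>x. M * (\<bar>h x\<bar> * weight a x))"
      using L1w_integrable_abs[OF assms(2)] by simp
    show "\<bar>h x\<bar> *\<^sub>R weight a (exp (t / 4) * x) \<le> M * (\<bar>h x\<bar> * weight a x)" for x
      using mult_left_mono[OF assms(4)[of x], of "\<bar>h x\<bar>"] by (simp add: ac_simps)
  qed simp
  finally show "L1w_norm a (dil t h) \<le> exp (- t) * M * L1w_norm a h"
    by (simp add: L1w_norm_def)
qed

lemma dil_in_L1w:
  assumes a: "0 \<le> a" and h: "h \<in> L1w a"
  shows "dil t h \<in> L1w a"
proof (cases "0 \<le> t")
  case True
  then show ?thesis
    using a by (intro dil_weight_bound(1)[OF a h, of "exp (t / 4) powr a"] weight_scale ge_one_powr_ge_zero) auto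
next
  case False
  then show ?thesis
    using a by (intro dil_weight_bound(1)[OF a h, of 1]) (auto intro!: weight_mono simp: abs_mult mult_left_le_one_le)
qed

lemma dil_decay:
  assumes a: "0 \<le> a" and h: "h \<in> L1w a" and t: "0 \<le> t"
  shows "L1w_norm a (dil t h) \<le> exp (- (1 - a / 4) * t) * L1w_norm a h"
proof -
  have "L1w_norm a (dil t h) \<le> exp (- t) * exp (t / 4) powr a * L1w_norm a h"
    using a t by (intro dil_weight_bound(2)[OF a h] weight_scale ge_one_powr_ge_zero) auto
  also have "exp (- t) * exp (t / 4) powr a = exp (- (1 - a / 4) * t)"
    by (simp add: powr_def exp_add[symmetric] algebra_simps)
  finally show ?thesis .
qed

text \<open>A bound in both time directions, with \<omega> = 1 for the abstract group. For t \<ge> 0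
  the condition a \<le> 4 makes the exponent of \<open>dil_decay\<close> nonpositive; for t < 0 only
  the factor exp (- t) grows.\<close>

lemma dil_growth:
  assumes a: "0 \<le> a" "a \<le> 4" and h: "h \<in> L1w a"
  shows "L1w_norm a (dil t h) \<le> exp \<bar>t\<bar> * L1w_norm a h"
proof (cases "0 \<le> t")
  case True
  have "L1w_norm a (dil t h) \<le> exp (- (1 - a / 4) * t) * L1w_norm a h"
    by (rule dil_decay[OF a(1) h True])
  also have "\<dots> \<le> exp \<bar>t\<bar> * L1w_norm a h"
    using True a mult_nonneg_nonneg[of "1 - a / 4" t]
    by (intro mult_right_mono L1w_norm_nonneg) (auto simp: algebra_simps)
  finally show ?thesis .
next
  case False
  then have "L1w_norm a (dil t h) \<le> exp (- t) * 1 * L1w_norm a h"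
    using a by (intro dil_weight_bound(2)[OF a(1) h]) (auto intro!: weight_mono simp: abs_mult mult_left_le_one_le)
  then show ?thesis using False by simp
qed

definition dil_op :: "real \<Rightarrow> real \<Rightarrow> l1 \<Rightarrow> l1" where
  "dil_op a t u = to_l1 a (dil t (of_l1 a u))"

lemma
  assumes "0 \<le> a" "a \<le> 4"
  shows dil_op_linear: "bounded_linear (dil_op a t)"
    and dil_op_to_l1: "h \<in> L1w a \<Longrightarrow> dil_op a t (to_l1 a h) = to_l1 a (dil t h)"
    and dil_op_growth: "norm (dil_op a t u) \<le> exp \<bar>t\<bar> * norm u"
proof -
  have D: "dil t h \<in> L1w a" if "h \<in> L1w a" for h
    using that by (rule dil_in_L1w[OF assms(1)])
  have lin: "AE x in lborel. dil t (\<lambda>y. c * h y + d * k y) x = c * dil t h x + d * dil t k x" for h k c d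
    by (simp add: dil_def algebra_simps)
  have cong: "AE x in lborel. dil t h x = dil t k x"
    if "h \<in> L1w a" "k \<in> L1w a" "AE x in lborel. h x = k x" for h k
    using that by (intro dil_cong_AE L1w_measurable)
  note L = lift_operator[OF D lin cong dil_growth[OF assms]]
  show "bounded_linear (dil_op a t)" unfolding dil_op_def[abs_def] by (rule L(1))
  show "dil_op a t (to_l1 a h) = to_l1 a (dil t h)" if "h \<in> L1w a"
    unfolding dil_op_def using L(2) that by blast
  show "norm (dil_op a t u) \<le> exp \<bar>t\<bar> * norm u" unfolding dil_op_def by (rule L(3))
qed

lemma dil_op_decay: "0 \<le> a \<Longrightarrow> 0 \<le> t \<Longrightarrow> norm (dil_op a t u) \<le> exp (- (1 - a / 4) * t) * norm u"
  using dil_decay[OF _ of_l1_in_L1w[of a u], of t] by (simp add: dil_op_def norm_to_l1 dil_in_L1w norm_of_l1)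

lemma dil_op_add: "0 \<le> a \<Longrightarrow> a \<le> 4 \<Longrightarrow> dil_op a (s + t) u = dil_op a s (dil_op a t u)"
  using dil_op_to_l1[of a "dil t (of_l1 a u)" s] by (simp add: dil_op_def dil_add dil_in_L1w)

lemma dil_op_zero: "dil_op a 0 u = u"
  by (simp add: dil_op_def dil_def[abs_def])

lemma dil_op_pairing:
  fixes \<psi> :: "real \<Rightarrow> 'b::{banach, second_countable_topology}"
  assumes "0 \<le> a" "\<psi> \<in> borel_measurable borel" "\<And>x. norm (\<psi> x) \<le> C * weight a x"
  shows "pairing a \<psi> (dil_op a t u) = exp (- t) *\<^sub>R pairing a (\<lambda>x. \<psi> (exp (t / 4) * x)) u"
  unfolding dil_op_def pairing_linear(2)[OF assms(2,3) dil_in_L1w[OF assms(1) of_l1_in_L1w]] dil_integral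
  by (simp add: pairing_def)

text \<open>Dividing the indicator by the weight gives a bounded function with compact support. Its
  dilations for bounded times stay bounded on a common interval and converge away from the two
  endpoints.\<close>

lemma dil_op_tendsto_interval:
  assumes a: "0 \<le> a" "a \<le> 4"
  shows "((\<lambda>t. dil_op a t (abs_l1 (indicator {c..d}))) \<longlongrightarrow> abs_l1 (indicator {c..d})) (at 0)"
  unfolding tendsto_at_iff_sequentially
proof (intro allI impI)
  fix X :: "nat \<Rightarrow> real" assume X0: "X \<longlonglongrightarrow> 0"
  define g where "g x = indicator {c..d} x / weight a x" for x
  have int_ind: "integrable lborel (indicator {c..d} :: real \<Rightarrow> real)"
    by (intro integrable_real_indicator emeasure_bounded_finite) auto
  have gw: "g x * weight a x = indicator {c..d} x" for x
    using weight_pos[of a x] by (simp add: g_def)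
  have [measurable]: "g \<in> borel_measurable borel" unfolding g_def[abs_def] by measurable
  have g: "g \<in> L1w a" unfolding L1w_def mem_Collect_eq gw using int_ind by simp
  have "abs_l1 (indicator {c..d}) = to_l1 a g" unfolding to_l1_def gw by simp
  then have eq: "((\<lambda>t. dil_op a t (abs_l1 (indicator {c..d}))) \<circ> X) i
      = abs_l1 (\<lambda>x. dil (X i) g x * weight a x)" for i
    using dil_op_to_l1[OF a g] by (simp add: to_l1_def)
  obtain B where B: "\<And>i. \<bar>X i\<bar> \<le> B"
    using convergent_imp_bounded[OF X0] by (auto simp: bounded_iff)
  \<comment> \<open>A point x whose rescaling lies in {c..d} is at most exp (|X i| / 4) times a
    point of that interval.\<close>
  define R where "R = exp B * max \<bar>c\<bar> \<bar>d\<bar>"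
  have "(\<lambda>i. abs_l1 (\<lambda>x. dil (X i) g x * weight a x)) \<longlonglongrightarrow> abs_l1 (indicator {c..d})"
  proof (rule abs_l1_dominated_convergence)
    show "(\<lambda>x. dil (X i) g x * weight a x) \<in> borel_measurable lborel" for i
      using dil_measurable[of g "X i"] by simp
    show "integrable lborel (\<lambda>x. exp B * exp B * weight a R * indicator {- R..R} x)"
      by (intro integrable_mult_right integrable_real_indicator emeasure_bounded_finite) auto
    show "AE x in lborel. \<bar>dil (X i) g x * weight a x\<bar> \<le> exp B * exp B * weight a R * indicator {- R..R} x" for i
    proof (rule AE_I2)
      fix x
      define y where "y = exp (- X i / 4) * x"
      show "\<bar>dil (X i) g x * weight a x\<bar> \<le> exp B * exp B * weight a R * indicator {- R..R} x"
      proof (cases "y \<in> {c..d}")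
        case True
        have "- X i \<le> B" "- X i / 4 \<le> B" "X i / 4 \<le> B"
          using B[of i] by auto
        then have e: "exp (- X i) \<le> exp B" "exp (- X i / 4) \<le> exp B" "exp (X i / 4) \<le> exp B" by auto
        have "x = exp (X i / 4) * y" by (simp add: y_def mult.assoc[symmetric] exp_add[symmetric])
        then have "\<bar>x\<bar> = exp (X i / 4) * \<bar>y\<bar>" by (simp add: abs_mult)
        also have "\<dots> \<le> exp B * max \<bar>c\<bar> \<bar>d\<bar>"
          using True by (intro mult_mono e(3)) auto
        finally have xR: "\<bar>x\<bar> \<le> R" by (simp add: R_def)
        have "\<bar>g y\<bar> \<le> 1" using weight_ge_1[OF a(1), of y] by (simp add: g_def indicator_def)
        then have "\<bar>dil (X i) g x\<bar> \<le> exp B * (exp B * 1)"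
          unfolding dil_def y_def abs_mult abs_exp_cancel using e by (intro mult_mono) auto
        moreover have "weight a x \<le> weight a R" using xR by (intro weight_mono[OF a(1)]) auto
        ultimately have "\<bar>dil (X i) g x\<bar> * weight a x \<le> (exp B * exp B) * weight a R"
          by (intro mult_mono) auto
        then show ?thesis using xR by (simp add: abs_mult abs_le_iff minus_le_iff)
      next
        case False
        then show ?thesis by (simp add: dil_def g_def y_def)
      qed
    qed
    show "AE x in lborel. (\<lambda>i. dil (X i) g x * weight a x) \<longlonglongrightarrow> indicator {c..d} x"
      using AE_lborel_singleton[of c] AE_lborel_singleton[of d]
    proof eventually_elim
      case (elim x)
      have y: "(\<lambda>i. exp (- X i / 4) * x) \<longlonglongrightarrow> x"
        using tendsto_mult[OF tendsto_exp[OF tendsto_divide[OF tendsto_minus[OF X0] tendsto_const, of 4]] tendsto_const[of x]]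
        by simp
      have "isCont (indicator {c..d} :: real \<Rightarrow> real) x"
        using elim by (auto simp: isCont_indicator frontier_def interior_atLeastAtMost_real)
      moreover have "isCont (weight a) x"
        using weight_continuous[of a] by (simp add: continuous_on_eq_continuous_at)
      ultimately have "isCont g x"
        unfolding g_def[abs_def] using weight_pos[of a x] by (intro continuous_intros) auto
      then have "(\<lambda>i. g (exp (- X i / 4) * x)) \<longlonglongrightarrow> g x"
        using y by (rule isCont_tendsto_compose)
      then have "(\<lambda>i. dil (X i) g x * weight a x) \<longlonglongrightarrow> exp (- 0) * (exp (- 0 / 4) * g x) * weight a x"
        unfolding dil_def by (intro tendsto_intros X0) auto
      then show ?case by (simp add: gw)
    qed
  qed simp
  moreover have "(\<lambda>t. dil_op a t (abs_l1 (indicator {c..d}))) \<circ> X = (\<lambda>i. abs_l1 (\<lambda>x. dil (X i) g x * weight a x))"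
    using eq by (intro ext)
  ultimately show "((\<lambda>t. dil_op a t (abs_l1 (indicator {c..d}))) \<circ> X) \<longlonglongrightarrow> abs_l1 (indicator {c..d})"
    by simp
qed

text \<open>The set of good vectors is a subspace that contains the intervals, and it is closed
  because the operators are uniformly bounded for small times.\<close>

lemma dil_op_tendsto_0:
  assumes a: "0 \<le> a" "a \<le> 4"
  shows "((\<lambda>t. dil_op a t u) \<longlongrightarrow> u) (at 0)"
proof -
  interpret T: bounded_linear "dil_op a t" for t by (rule dil_op_linear[OF a])
  define V where "V = {u. ((\<lambda>t. dil_op a t u) \<longlongrightarrow> u) (at 0)}"
  have "u \<in> V"
  proof (rule l1_closed_subspace_UNIV)
    show "subspace V"
      unfolding subspace_def V_def by (auto simp: T.zero T.add T.scaleR intro!: tendsto_intros)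
    show "abs_l1 (indicator {c..d}) \<in> V" for c d
      unfolding V_def using dil_op_tendsto_interval[OF a] by simp
    show "closed V"
      unfolding closed_sequential_limits
    proof (intro allI impI, elim conjE)
      fix v u assume v: "\<forall>n. v n \<in> V" and lim: "v \<longlonglongrightarrow> u"
      show "u \<in> V"
        unfolding V_def mem_Collect_eq
      proof (rule tendstoI)
        fix e :: real assume e: "0 < e"
        have "\<forall>\<^sub>F n in sequentially. dist (v n) u < e / 6"
          using lim e by (intro tendstoD) auto
        \<comment> \<open>With the operator norm below 2, the three errors add up to at most (2 + 1
          + 1) e / 6.\<close>
        then obtain n where n: "norm (v n - u) < e / 6"
          by (auto simp: eventually_sequentially dist_norm)
        have "\<forall>\<^sub>F t in at 0. dist (dil_op a t (v n)) (v n) < e / 6"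
          using v e unfolding V_def by (intro tendstoD) auto
        moreover have "\<forall>\<^sub>F t in at 0. exp \<bar>t\<bar> < (2 :: real)"
        proof (rule order_tendstoD)
          show "((\<lambda>t::real. exp \<bar>t\<bar>) \<longlongrightarrow> exp \<bar>0\<bar>) (at 0)" by (intro tendsto_intros)
        qed simp
        ultimately show "\<forall>\<^sub>F t in at 0. dist (dil_op a t u) u < e"
        proof eventually_elim
          case (elim t)
          have "dil_op a t u - u = dil_op a t (u - v n) + (dil_op a t (v n) - v n) + (v n - u)"
            by (simp add: T.diff)
          then have "norm (dil_op a t u - u) \<le> norm (dil_op a t (u - v n)) + norm (dil_op a t (v n) - v n) + norm (v n - u)"
            by (metis add_mono norm_triangle_le norm_triangle_ineq order_refl)
          also have "norm (dil_op a t (u - v n)) \<le> exp \<bar>t\<bar> * norm (u - v n)" by (rule dil_op_growth[OF a])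
          also have "exp \<bar>t\<bar> * norm (u - v n) \<le> 2 * norm (u - v n)"
            using elim by (intro mult_right_mono) auto
          finally show ?case
            using n elim e by (simp add: dist_norm norm_minus_commute)
        qed
      qed
    qed
  qed
  then show ?thesis by (simp add: V_def)
qed

section \<open>The gain operator\<close>

lemma nn_integral_even:
  fixes f :: "real \<Rightarrow> real"
  assumes [measurable]: "f \<in> borel_measurable borel" and even: "\<And>x. f (- x) = f x"
  shows "(\<integral>\<^sup>+x. ennreal (f x) \<partial>lborel) = 2 * (\<integral>\<^sup>+x. ennreal (f x) * indicator {0..} x \<partial>lborel)"
proof -
  have "(\<integral>\<^sup>+x. ennreal (f x) \<partial>lborel)
    = (\<integral>\<^sup>+x. ennreal (f x) * indicator {0..} x + ennreal (f x) * indicator {..0} x \<partial>lborel)"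
  proof (rule nn_integral_cong_AE)
    show "AE x in lborel. ennreal (f x) = ennreal (f x) * indicator {0..} x + ennreal (f x) * indicator {..0} x"
      using AE_lborel_singleton[of 0] by eventually_elim (auto simp: indicator_def)
  qed
  also have "\<dots> = (\<integral>\<^sup>+x. ennreal (f x) * indicator {0..} x \<partial>lborel) + (\<integral>\<^sup>+x. ennreal (f x) * indicator {..0} x \<partial>lborel)"
    by (rule nn_integral_add) auto
  also have "(\<integral>\<^sup>+x. ennreal (f x) * indicator {..0} x \<partial>lborel) = (\<integral>\<^sup>+x. ennreal (f x) * indicator {0..} x \<partial>lborel)"
    by (subst nn_integral_real_affine[where c = "- 1" and t = 0])
      (auto simp: even indicator_def intro!: nn_integral_cong)
  finally show ?thesis by (simp add: mult_2)
qed

lemma integrable_one_plus_abs_powr: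
  fixes p :: real
  assumes "p < - 1"
  shows "integrable lborel (\<lambda>x. (1 + \<bar>x\<bar>) powr p)"
proof (rule integrableI_nonneg)
  have [measurable]: "(\<lambda>x::real. (1 + \<bar>x\<bar>) powr p) \<in> borel_measurable borel" by measurable
  show "(\<lambda>x::real. (1 + \<bar>x\<bar>) powr p) \<in> borel_measurable lborel" by simp
  have "((\<lambda>x::real. (1 + x) powr (p + 1) / (p + 1)) \<longlongrightarrow> 0 / (p + 1)) at_top"
    using assms by (intro tendsto_divide tendsto_const tendsto_neg_powr filterlim_tendsto_add_at_top[OF tendsto_const] filterlim_ident) auto
  then have "(\<integral>\<^sup>+x. ennreal ((1 + \<bar>x\<bar>) powr p) * indicator {0..} x \<partial>lborel) = 0 / (p + 1) - (1 + 0) powr (p + 1) / (p + 1)"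
    using assms by (intro nn_integral_FTC_atLeast) (auto intro!: derivative_eq_intros)
  then show "(\<integral>\<^sup>+x. ennreal ((1 + \<bar>x\<bar>) powr p) \<partial>lborel) < \<infinity>"
    by (subst nn_integral_even) (auto simp: ennreal_mult_less_top)
qed auto

section \<open>The profile H and convolution with it\<close>

lemma H_nonneg [simp]: "0 \<le> H x"
  by (simp add: H_def)

lemma H_continuous: "continuous_on UNIV H"
  unfolding H_def by (intro continuous_intros) (auto simp: add_nonneg_eq_0_iff)

lemma H_measurable [measurable]: "H \<in> borel_measurable borel"
  by (rule borel_measurable_continuous_onI[OF H_continuous])

lemma H_even: "H (- x) = H x"
  by (simp add: H_def)

text \<open>A primitive of H is (x / (1 + x^2) + arctan x) / pi; it contributes 1 / 2 on the
  half-line.\<close>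

lemma H_nn_integral: "(\<integral>\<^sup>+x. ennreal (H x) \<partial>lborel) = 1"
proof -
  have "(\<integral>\<^sup>+x. ennreal (H x) * indicator {0..} x \<partial>lborel)
    = ennreal (1 / 2 - (1 / pi) * (0 / (1 + 0\<^sup>2) + arctan 0))"
  proof (rule nn_integral_FTC_atLeast)
    fix x :: real assume "0 \<le> x"
    have "1 + x\<^sup>2 \<noteq> 0" by (metis power_one sum_power2_eq_zero_iff zero_neq_one)
    have "((\<lambda>x. (1 / pi) * (x / (1 + x\<^sup>2) + arctan x)) has_real_derivative
      (1 / pi) * ((1 * (1 + x\<^sup>2) - x * (2 * x)) / ((1 + x\<^sup>2) * (1 + x\<^sup>2)) + inverse (1 + x\<^sup>2) * 1)) (at x)"
      using \<open>1 + x\<^sup>2 \<noteq> 0\<close> by (auto intro!: derivative_eq_intros)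
    also have "(1 * (1 + x\<^sup>2) - x * (2 * x)) / ((1 + x\<^sup>2) * (1 + x\<^sup>2)) + inverse (1 + x\<^sup>2) * 1 = 2 / (1 + x\<^sup>2)\<^sup>2"
      using \<open>1 + x\<^sup>2 \<noteq> 0\<close> by (simp add: divide_simps) (simp add: algebra_simps power2_eq_square)
    finally show "((\<lambda>x. (1 / pi) * (x / (1 + x\<^sup>2) + arctan x)) has_real_derivative H x) (at x)"
      by (simp add: H_def)
  next
    have "((\<lambda>x::real. x / (1 + x\<^sup>2)) \<longlongrightarrow> 0) at_top" by real_asymp
    then have "((\<lambda>x. (1 / pi) * (x / (1 + x\<^sup>2) + arctan x)) \<longlongrightarrow> (1 / pi) * (0 + pi / 2)) at_top"
      by (intro tendsto_intros tendsto_arctan_at_top)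
    then show "((\<lambda>x. (1 / pi) * (x / (1 + x\<^sup>2) + arctan x)) \<longlongrightarrow> 1 / 2) at_top" by simp
  qed auto
  then have "(\<integral>\<^sup>+x. ennreal (H x) \<partial>lborel) = ennreal 2 * ennreal (1 / 2)"
    unfolding nn_integral_even[OF H_measurable H_even] by simp
  also have "\<dots> = ennreal (2 * (1 / 2))" by (rule ennreal_mult[symmetric]) auto
  finally show ?thesis by simp
qed

lemma H_integral: "(\<integral>x. H x \<partial>lborel) = 1"
  using H_nn_integral by (simp add: integral_eq_nn_integral)

text \<open>H is at most a multiple of (1 + |x|)^(- 4), so the upper bound on a is the condition a -
  4 < - 1. The constant is 2 / pi times the 4 from (1 + |x|)^4 \<le> 4 (1 + x^2)^2.\<close>

lemma H_weight_integrable: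
  assumes "a < 3"
  shows "integrable lborel (\<lambda>x. H x * weight a x)"
proof (rule Bochner_Integration.integrable_bound)
  show "integrable lborel (\<lambda>x. 8 / pi * (1 + \<bar>x\<bar>) powr (a - 4))"
    using assms by (intro integrable_mult_right integrable_one_plus_abs_powr) simp
  show "AE x in lborel. norm (H x * weight a x) \<le> norm (8 / pi * (1 + \<bar>x\<bar>) powr (a - 4))"
  proof (rule AE_I2)
    fix x :: real
    have "(1 + \<bar>x\<bar>)\<^sup>2 \<le> 2 * (1 + x\<^sup>2)"
      using sum_squares_bound[of 1 "\<bar>x\<bar>"] by (simp add: power2_sum)
    then have "((1 + \<bar>x\<bar>)\<^sup>2)\<^sup>2 \<le> (2 * (1 + x\<^sup>2))\<^sup>2" by (rule power_mono) simp
    then have le: "(1 + \<bar>x\<bar>) ^ 4 \<le> 4 * (1 + x\<^sup>2)\<^sup>2" by (simp only: power_mult_distrib flip: power_mult) simp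
    have "H x * weight a x = H x * (1 + \<bar>x\<bar>) ^ 4 * (1 + \<bar>x\<bar>) powr (a - 4)"
      by (simp add: weight_def powr_diff powr_realpow[of _ 4, simplified] add_pos_nonneg field_simps)
    also have "\<dots> \<le> 8 / pi * (1 + \<bar>x\<bar>) powr (a - 4)"
    proof (rule mult_right_mono)
      have p: "1 + x\<^sup>2 \<noteq> 0" using zero_le_power2[of x] by linarith
      have "H x * (1 + \<bar>x\<bar>) ^ 4 \<le> H x * (4 * (1 + x\<^sup>2)\<^sup>2)" using le by (intro mult_left_mono) auto
      also have "\<dots> = 8 / pi" using p by (simp add: H_def)
      finally show "H x * (1 + \<bar>x\<bar>) ^ 4 \<le> 8 / pi" .
    qed simp
    finally show "norm (H x * weight a x) \<le> norm (8 / pi * (1 + \<bar>x\<bar>) powr (a - 4))" by simp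
  qed
qed simp

text \<open>The gain term with its factor 2; the substitution of x + y / 2 by a single variable
  contributes the other 2.\<close>

definition conv :: "(real \<Rightarrow> real) \<Rightarrow> real \<Rightarrow> real" where
  "conv h x = 4 * (\<integral>y. h y * H (2 * x - y) \<partial>lborel)"

text \<open>Mass zero removes the loss term with H, and the unit mass of H turns the other loss term
  into - h.\<close>

lemma Q0_eq_conv:
  assumes "(\<integral>x. h x \<partial>lborel) = 0"
  shows "2 * Q0 h H x = conv h x - h x"
proof -
  have "(\<integral>y. h y * H (2 * x - y) \<partial>lborel) = (1 / 2) * (\<integral>y. h (x + y / 2) * H (x - y / 2) \<partial>lborel)"
    using lborel_integral_real_affine[of "1 / 2" "\<lambda>y. h y * H (2 * x - y)" x]
    by (simp add: algebra_simps)
  then show ?thesis by (simp add: Q0_def conv_def assms H_integral algebra_simps)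
qed

text \<open>\<open>conv_dual \<psi>\<close> is the adjoint of \<open>conv\<close>: substitute \<open>z = 2 x - y\<close> in the inner integral.\<close>

definition conv_dual :: "(real \<Rightarrow> 'b::{banach, second_countable_topology}) \<Rightarrow> real \<Rightarrow> 'b" where
  "conv_dual \<psi> y = 2 *\<^sub>R (\<integral>z. H z *\<^sub>R \<psi> ((y + z) / 2) \<partial>lborel)"

lemma conv_dual_eq: "conv_dual \<psi> y = 4 *\<^sub>R (\<integral>x. H (2 * x - y) *\<^sub>R \<psi> x \<partial>lborel)"
  using lborel_integral_real_affine[of "1 / 2" "\<lambda>x. H (2 * x - y) *\<^sub>R \<psi> x" "y / 2"]
  by (simp add: conv_dual_def add_divide_distrib)

lemma weight_average_le: "0 \<le> a \<Longrightarrow> weight a ((y + z) / 2) \<le> weight a y * weight a z"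
  by (rule order_trans[OF weight_mono weight_submult]) auto

context
  fixes a :: real
  assumes a: "0 \<le> a" "a < 3"
begin

lemma H_psi_integrable:
  fixes \<psi> :: "real \<Rightarrow> 'b::{banach, second_countable_topology}"
  assumes [measurable]: "\<psi> \<in> borel_measurable borel" and \<psi>: "\<And>x. norm (\<psi> x) \<le> C * weight a x"
  shows "integrable lborel (\<lambda>z. H z *\<^sub>R \<psi> ((y + z) / 2))"
    and "integrable lborel (\<lambda>x. H (2 * x - y) *\<^sub>R \<psi> x)"
proof -
  have C: "0 \<le> C"
    using order_trans[OF norm_ge_zero \<psi>[of 0]] weight_pos[of a 0] by (simp add: zero_le_mult_iff)
  show *: "integrable lborel (\<lambda>z. H z *\<^sub>R \<psi> ((y + z) / 2))"
  proof (rule Bochner_Integration.integrable_bound)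
    show "integrable lborel (\<lambda>z. C * weight a y * (H z * weight a z))"
      using H_weight_integrable[OF a(2)] by simp
    show "AE z in lborel. norm (H z *\<^sub>R \<psi> ((y + z) / 2)) \<le> norm (C * weight a y * (H z * weight a z))"
    proof (rule AE_I2)
      fix z
      have "norm (\<psi> ((y + z) / 2)) \<le> C * weight a ((y + z) / 2)" by (rule \<psi>)
      also have "\<dots> \<le> C * (weight a y * weight a z)"
        using C a by (intro mult_left_mono weight_average_le)
      finally have "H z * norm (\<psi> ((y + z) / 2)) \<le> H z * (C * (weight a y * weight a z))"
        by (rule mult_left_mono) simp
      then show "norm (H z *\<^sub>R \<psi> ((y + z) / 2)) \<le> norm (C * weight a y * (H z * weight a z))"
        using C by (simp add: abs_mult ac_simps)
    qed
  qed measurable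
  show "integrable lborel (\<lambda>x. H (2 * x - y) *\<^sub>R \<psi> x)"
    using lborel_integrable_real_affine[OF *, of 2 "- y"] by simp
qed

text \<open>Only submultiplicativity of the weight enters, so the constant is far from 2^(1 - a). It
  gives boundedness, and it is used again on bounded intervals.\<close>

lemma conv_dual_weight_le: "conv_dual (weight a) y \<le> 2 * (\<integral>z. H z * weight a z \<partial>lborel) * weight a y"
proof -
  have "conv_dual (weight a) y = 2 * (\<integral>z. H z * weight a ((y + z) / 2) \<partial>lborel)"
    by (simp add: conv_dual_def)
  also have "\<dots> \<le> 2 * (\<integral>z. weight a y * (H z * weight a z) \<partial>lborel)"
  proof (intro mult_left_mono integral_mono)
    show "integrable lborel (\<lambda>z. H z * weight a ((y + z) / 2))"
      using H_psi_integrable(1)[of "weight a" 1 y] by simp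
    show "integrable lborel (\<lambda>z. weight a y * (H z * weight a z))"
      using H_weight_integrable[OF a(2)] by simp
    show "H z * weight a ((y + z) / 2) \<le> weight a y * (H z * weight a z)" for z
      using mult_left_mono[OF weight_average_le[OF a(1), of y z], of "H z"] by (simp add: ac_simps)
  qed simp
  finally show ?thesis unfolding integral_mult_right_zero by (simp only: ac_simps)
qed

lemma conv_dual_nonneg: "0 \<le> conv_dual (weight a) y"
  unfolding conv_dual_def by (simp add: integral_nonneg_AE)

lemma conv_dual_measurable:
  fixes \<psi> :: "real \<Rightarrow> 'b::{banach, second_countable_topology}"
  assumes [measurable]: "\<psi> \<in> borel_measurable borel"
  shows "conv_dual \<psi> \<in> borel_measurable borel"
  unfolding conv_dual_def by measurable

text \<open>Integrating the absolute value in x gives |h| times a quarter of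
  \<open>conv_dual\<close> of |\<psi>|, and this dual is at most a multiple of the weight.\<close>

lemma conv_fubini:
  fixes \<psi> :: "real \<Rightarrow> 'b::{banach, second_countable_topology}"
  assumes h: "h \<in> L1w a" and \<psi>m: "\<psi> \<in> borel_measurable borel"
    and \<psi>: "\<And>x. norm (\<psi> x) \<le> C * weight a x"
  shows "integrable (lborel \<Otimes>\<^sub>M lborel) (\<lambda>(y, x). (h y * H (2 * x - y)) *\<^sub>R \<psi> x)"
proof (rule lborel_pair.Fubini_integrable)
  note [measurable] = L1w_measurable[OF h] \<psi>m
  have [measurable]: "conv_dual (\<lambda>x. norm (\<psi> x)) \<in> borel_measurable borel"
    by (rule conv_dual_measurable) measurable
  have nn: "\<And>x. norm (norm (\<psi> x)) \<le> C * weight a x" using \<psi> by simp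
  have C: "0 \<le> C"
    using order_trans[OF norm_ge_zero \<psi>[of 0]] weight_pos[of a 0] by (simp add: zero_le_mult_iff)
  show "(\<lambda>(y, x). (h y * H (2 * x - y)) *\<^sub>R \<psi> x) \<in> borel_measurable (lborel \<Otimes>\<^sub>M lborel)" by measurable
  have eq: "(\<integral>x. norm (case (y, x) of (y, x) \<Rightarrow> (h y * H (2 * x - y)) *\<^sub>R \<psi> x) \<partial>lborel)
    = \<bar>h y\<bar> * (conv_dual (\<lambda>x. norm (\<psi> x)) y / 4)" for y
    unfolding conv_dual_eq by (simp add: abs_mult mult.assoc)
  have le: "conv_dual (\<lambda>x. norm (\<psi> x)) y \<le> C * (2 * (\<integral>z. H z * weight a z \<partial>lborel) * weight a y)" for y
  proof -
    have "conv_dual (\<lambda>x. norm (\<psi> x)) y \<le> C * conv_dual (weight a) y"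
    proof -
      have "(\<integral>z. H z *\<^sub>R norm (\<psi> ((y + z) / 2)) \<partial>lborel) \<le> (\<integral>z. C * (H z *\<^sub>R weight a ((y + z) / 2)) \<partial>lborel)"
      proof (rule integral_mono)
        show "integrable lborel (\<lambda>z. H z *\<^sub>R norm (\<psi> ((y + z) / 2)))"
          by (rule H_psi_integrable(1)[OF _ nn]) measurable
        show "integrable lborel (\<lambda>z. C * (H z *\<^sub>R weight a ((y + z) / 2)))"
          by (intro integrable_mult_right H_psi_integrable(1)[of _ 1]) auto
        show "H z *\<^sub>R norm (\<psi> ((y + z) / 2)) \<le> C * (H z *\<^sub>R weight a ((y + z) / 2))" for z
          using mult_left_mono[OF \<psi>[of "(y + z) / 2"], of "H z"] by (simp add: ac_simps)
      qed
      then show ?thesis by (simp add: conv_dual_def)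
    qed
    also have "\<dots> \<le> C * (2 * (\<integral>z. H z * weight a z \<partial>lborel) * weight a y)"
      using C by (intro mult_left_mono conv_dual_weight_le)
    finally show ?thesis .
  qed
  show "integrable lborel (\<lambda>y. \<integral>x. norm (case (y, x) of (y, x) \<Rightarrow> (h y * H (2 * x - y)) *\<^sub>R \<psi> x) \<partial>lborel)"
    unfolding eq
  proof (rule Bochner_Integration.integrable_bound)
    show "integrable lborel (\<lambda>y. C * (\<integral>z. H z * weight a z \<partial>lborel) / 2 * (\<bar>h y\<bar> * weight a y))"
      using L1w_integrable_abs[OF h] by simp
    show "AE y in lborel. norm (\<bar>h y\<bar> * (conv_dual (\<lambda>x. norm (\<psi> x)) y / 4))
      \<le> norm (C * (\<integral>z. H z * weight a z \<partial>lborel) / 2 * (\<bar>h y\<bar> * weight a y))"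
    proof (rule AE_I2)
      fix y
      have "0 \<le> conv_dual (\<lambda>x. norm (\<psi> x)) y"
        unfolding conv_dual_def by (simp add: integral_nonneg_AE)
      then have "norm (\<bar>h y\<bar> * (conv_dual (\<lambda>x. norm (\<psi> x)) y / 4)) = \<bar>h y\<bar> * (conv_dual (\<lambda>x. norm (\<psi> x)) y / 4)"
        by (simp add: abs_mult)
      also have "\<dots> \<le> \<bar>h y\<bar> * (C * (2 * (\<integral>z. H z * weight a z \<partial>lborel) * weight a y) / 4)"
        by (intro mult_left_mono divide_right_mono le) auto
      also have "\<dots> = C * (\<integral>z. H z * weight a z \<partial>lborel) / 2 * (\<bar>h y\<bar> * weight a y)" by simp
      finally show "norm (\<bar>h y\<bar> * (conv_dual (\<lambda>x. norm (\<psi> x)) y / 4))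
        \<le> norm (C * (\<integral>z. H z * weight a z \<partial>lborel) / 2 * (\<bar>h y\<bar> * weight a y))" by simp
    qed
  qed measurable
  show "AE y in lborel. integrable lborel (\<lambda>x. case (y, x) of (y, x) \<Rightarrow> (h y * H (2 * x - y)) *\<^sub>R \<psi> x)"
    using H_psi_integrable(2)[OF \<psi>m \<psi>] by (auto simp: scaleR_scaleR[symmetric] simp del: scaleR_scaleR)
qed

lemma conv_measurable: "h \<in> borel_measurable borel \<Longrightarrow> conv h \<in> borel_measurable borel"
proof -
  assume [measurable]: "h \<in> borel_measurable borel"
  show ?thesis unfolding conv_def[abs_def] by measurable
qed

lemma L1w_abs: "h \<in> L1w a \<Longrightarrow> (\<lambda>x. \<bar>h x\<bar>) \<in> L1w a"
  using L1w_integrable_abs[of h a] L1w_measurable[of h a] by (intro L1wI borel_measurable_abs) auto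

lemma H_le: "H x \<le> 1"
proof -
  have "1 \<le> (1 + x\<^sup>2)\<^sup>2" by simp
  then have "2 \<le> pi * (1 + x\<^sup>2)\<^sup>2" using pi_ge_two mult_mono[of 2 pi 1 "(1 + x\<^sup>2)\<^sup>2"] by simp
  then show ?thesis by (simp add: H_def divide_le_eq)
qed

lemma L1w_integrable_1: "h \<in> L1w a \<Longrightarrow> integrable lborel h"
  using L1w_pairing(1)[of h a "\<lambda>_. 1 :: real" 1] weight_ge_1[OF a(1)] by simp

lemma conv_integrand:
  assumes h: "h \<in> L1w a"
  shows "integrable lborel (\<lambda>y. h y * H (2 * x - y))"
proof (rule Bochner_Integration.integrable_bound[OF L1w_integrable_1[OF h]])
  note [measurable] = L1w_measurable[OF h]
  show "(\<lambda>y. h y * H (2 * x - y)) \<in> borel_measurable lborel" by measurable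
  show "AE y in lborel. norm (h y * H (2 * x - y)) \<le> norm (h y)"
    by (simp add: abs_mult mult_left_le H_le)
qed

text \<open>Carries moments and Fourier coefficients through the operator by letting the adjoint act
  on powers and exponentials.\<close>

lemma conv_pairing:
  fixes \<psi> :: "real \<Rightarrow> 'b::{banach, second_countable_topology}"
  assumes h: "h \<in> L1w a" and \<psi>m: "\<psi> \<in> borel_measurable borel"
    and \<psi>: "\<And>x. norm (\<psi> x) \<le> C * weight a x"
  shows "integrable lborel (\<lambda>x. conv h x *\<^sub>R \<psi> x)"
    and "(\<integral>x. conv h x *\<^sub>R \<psi> x \<partial>lborel) = (\<integral>y. h y *\<^sub>R conv_dual \<psi> y \<partial>lborel)"
proof -
  note F = conv_fubini[OF assms]
  have sw: "conv h x *\<^sub>R \<psi> x = 4 *\<^sub>R (\<integral>y. (h y * H (2 * x - y)) *\<^sub>R \<psi> x \<partial>lborel)" for x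
    by (subst integral_scaleR_left[OF conv_integrand[OF h]]) (simp add: conv_def)
  show "integrable lborel (\<lambda>x. conv h x *\<^sub>R \<psi> x)"
    unfolding sw using lborel_pair.integrable_snd[OF F] by (intro integrable_scaleR_right)
  have "(\<integral>x. conv h x *\<^sub>R \<psi> x \<partial>lborel) = 4 *\<^sub>R (\<integral>x. \<integral>y. (h y * H (2 * x - y)) *\<^sub>R \<psi> x \<partial>lborel \<partial>lborel)"
    unfolding sw by simp
  also have "\<dots> = 4 *\<^sub>R (\<integral>y. \<integral>x. (h y * H (2 * x - y)) *\<^sub>R \<psi> x \<partial>lborel \<partial>lborel)"
    by (subst lborel_pair.Fubini_integral[OF F]) simp
  also have "\<dots> = (\<integral>y. 4 *\<^sub>R h y *\<^sub>R (\<integral>x. H (2 * x - y) *\<^sub>R \<psi> x \<partial>lborel) \<partial>lborel)"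
    by (simp flip: scaleR_scaleR)
  also have "\<dots> = (\<integral>y. h y *\<^sub>R conv_dual \<psi> y \<partial>lborel)"
    by (simp add: conv_dual_eq mult.commute)
  finally show "(\<integral>x. conv h x *\<^sub>R \<psi> x \<partial>lborel) = (\<integral>y. h y *\<^sub>R conv_dual \<psi> y \<partial>lborel)" .
qed

text \<open>The bound keeps the adjoint weight inside the integral, so that it can be estimated
  pointwise: by a constant multiple of the weight everywhere, and sharply for large |y|.\<close>

lemma conv_bound:
  assumes h: "h \<in> L1w a"
  shows "conv h \<in> L1w a"
    and "L1w_norm a (conv h) \<le> (\<integral>y. \<bar>h y\<bar> * conv_dual (weight a) y \<partial>lborel)"
proof -
  have w: "\<And>x. norm (weight a x) \<le> 1 * weight a x" by simp
  note P = conv_pairing[OF L1w_abs[OF h] weight_measurable w]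
  have le: "\<bar>conv h x\<bar> \<le> conv (\<lambda>x. \<bar>h x\<bar>) x" for x
    using integral_abs_bound[of lborel "\<lambda>y. h y * H (2 * x - y)"] by (simp add: conv_def abs_mult)
  have i: "integrable lborel (\<lambda>x. \<bar>conv h x\<bar> * weight a x)"
  proof (rule Bochner_Integration.integrable_bound[OF P(1)])
    show "(\<lambda>x. \<bar>conv h x\<bar> * weight a x) \<in> borel_measurable lborel"
      using conv_measurable[OF L1w_measurable[OF h]] by simp
    show "AE x in lborel. norm (\<bar>conv h x\<bar> * weight a x) \<le> norm (conv (\<lambda>x. \<bar>h x\<bar>) x *\<^sub>R weight a x)"
    proof (rule AE_I2)
      fix x
      have "\<bar>conv h x\<bar> * weight a x \<le> \<bar>conv (\<lambda>x. \<bar>h x\<bar>) x\<bar> * weight a x"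
        by (rule mult_right_mono[OF order_trans[OF le abs_ge_self]]) simp
      then show "norm (\<bar>conv h x\<bar> * weight a x) \<le> norm (conv (\<lambda>x. \<bar>h x\<bar>) x *\<^sub>R weight a x)"
        by (simp add: abs_mult)
    qed
  qed
  show "conv h \<in> L1w a" by (rule L1wI[OF conv_measurable[OF L1w_measurable[OF h]] i])
  have "L1w_norm a (conv h) \<le> (\<integral>x. conv (\<lambda>x. \<bar>h x\<bar>) x *\<^sub>R weight a x \<partial>lborel)"
    unfolding L1w_norm_def
  proof (rule integral_mono[OF i P(1)])
    show "\<bar>conv h x\<bar> * weight a x \<le> conv (\<lambda>x. \<bar>h x\<bar>) x *\<^sub>R weight a x" for x
      using mult_right_mono[OF le[of x], of "weight a x"] by simp
  qed
  then show "L1w_norm a (conv h) \<le> (\<integral>y. \<bar>h y\<bar> * conv_dual (weight a) y \<partial>lborel)"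
    unfolding P(2) by simp
qed

lemma conv_norm_le:
  assumes h: "h \<in> L1w a"
  shows "L1w_norm a (conv h) \<le> 2 * (\<integral>z. H z * weight a z \<partial>lborel) * L1w_norm a h"
proof -
  have w: "\<And>x. norm (weight a x) \<le> 1 * weight a x" by simp
  have "L1w_norm a (conv h) \<le> (\<integral>y. \<bar>h y\<bar> * conv_dual (weight a) y \<partial>lborel)"
    by (rule conv_bound(2)[OF h])
  also have "\<dots> \<le> (\<integral>y. 2 * (\<integral>z. H z * weight a z \<partial>lborel) * (\<bar>h y\<bar> * weight a y) \<partial>lborel)"
  proof (rule integral_mono)
    show "integrable lborel (\<lambda>y. 2 * (\<integral>z. H z * weight a z \<partial>lborel) * (\<bar>h y\<bar> * weight a y))"
      using L1w_integrable_abs[OF h] by simp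
    show "integrable lborel (\<lambda>y. \<bar>h y\<bar> * conv_dual (weight a) y)"
      using L1w_pairing(1)[OF L1w_abs[OF h] conv_dual_measurable[OF weight_measurable[of a]],
          of "2 * (\<integral>z. H z * weight a z \<partial>lborel)"]
        conv_dual_weight_le conv_dual_nonneg by simp
    show "\<bar>h y\<bar> * conv_dual (weight a) y \<le> 2 * (\<integral>z. H z * weight a z \<partial>lborel) * (\<bar>h y\<bar> * weight a y)" for y
      using mult_left_mono[OF conv_dual_weight_le[of y], of "\<bar>h y\<bar>"] by (simp add: ac_simps)
  qed
  finally show ?thesis by (simp add: L1w_norm_def)
qed

end

definition conv_op :: "real \<Rightarrow> l1 \<Rightarrow> l1" where
  "conv_op a u = to_l1 a (conv (of_l1 a u))"

lemma
  assumes a: "0 \<le> a" "a < 3"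
  shows conv_op_linear: "bounded_linear (conv_op a)"
    and conv_op_to_l1: "h \<in> L1w a \<Longrightarrow> conv_op a (to_l1 a h) = to_l1 a (conv h)"
proof -
  have D: "conv h \<in> L1w a" if "h \<in> L1w a" for h
    using that by (rule conv_bound(1)[OF a])
  have lin: "AE x in lborel. conv (\<lambda>y. c * h y + d * k y) x = c * conv h x + d * conv k x"
    if "h \<in> L1w a" "k \<in> L1w a" for h k c d
  proof (rule AE_I2)
    fix x
    have "(\<integral>y. (c * h y + d * k y) * H (2 * x - y) \<partial>lborel)
      = (\<integral>y. c * (h y * H (2 * x - y)) + d * (k y * H (2 * x - y)) \<partial>lborel)"
      by (simp add: distrib_right mult.assoc)
    also have "\<dots> = c * (\<integral>y. h y * H (2 * x - y) \<partial>lborel) + d * (\<integral>y. k y * H (2 * x - y) \<partial>lborel)"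
      using conv_integrand[OF a that(1), of x] conv_integrand[OF a that(2), of x] by simp
    finally show "conv (\<lambda>y. c * h y + d * k y) x = c * conv h x + d * conv k x"
      by (simp add: conv_def)
  qed
  have cong: "AE x in lborel. conv h x = conv k x"
    if "h \<in> L1w a" "k \<in> L1w a" "AE x in lborel. h x = k x" for h k
  proof (rule AE_I2)
    fix x
    note [measurable] = L1w_measurable[OF that(1)] L1w_measurable[OF that(2)]
    show "conv h x = conv k x"
      unfolding conv_def using that(3) by (intro arg_cong2[of _ _ _ _ "(*)"] refl integral_cong_AE) auto
  qed
  note L = lift_operator[OF D lin cong conv_norm_le[OF a]]
  show "bounded_linear (conv_op a)" unfolding conv_op_def[abs_def] by (rule L(1))
  show "conv_op a (to_l1 a h) = to_l1 a (conv h)" if "h \<in> L1w a"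
    unfolding conv_op_def using L(2) that by blast
qed

lemma conv_op_pairing:
  fixes \<psi> :: "real \<Rightarrow> 'b::{banach, second_countable_topology}"
  assumes a: "0 \<le> a" "a < 3" and \<psi>: "\<psi> \<in> borel_measurable borel" "\<And>x. norm (\<psi> x) \<le> C * weight a x"
  shows "pairing a \<psi> (conv_op a u) = pairing a (conv_dual \<psi>) u"
  unfolding conv_op_def pairing_linear(2)[OF \<psi> conv_bound(1)[OF a of_l1_in_L1w]]
    conv_pairing(2)[OF a of_l1_in_L1w \<psi>]
  by (simp add: pairing_def)

section \<open>Moments and Fourier transform\<close>

definition moment :: "real \<Rightarrow> nat \<Rightarrow> l1 \<Rightarrow> real" where
  "moment a k = pairing a (\<lambda>x. x ^ k)"

definition fourier :: "real \<Rightarrow> real \<Rightarrow> l1 \<Rightarrow> complex" where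
  "fourier a \<xi> = pairing a (\<lambda>x. iexp (\<xi> * x))"

text \<open>The moments are bundled because \<open>K\<close> couples them: the adjoint maps x^k to a
  polynomial with lower order terms, so it is the joint kernel that is invariant.\<close>

definition moments :: "real \<Rightarrow> l1 \<Rightarrow> real \<times> real \<times> real" where
  "moments a u = (moment a 0 u, moment a 1 u, moment a 2 u)"

lemma moments_eq_0_iff: "moments a u = 0 \<longleftrightarrow> moment a 0 u = 0 \<and> moment a 1 u = 0 \<and> moment a 2 u = 0"
  by (simp add: moments_def zero_prod_def)

context
  fixes a :: real
  assumes a: "2 < a" "a < 3"
begin

lemma exponent_bounds: "0 \<le> a" "a \<le> 4" "0 < a"
  using a by auto

lemma power_weight: "k \<le> 2 \<Longrightarrow> norm (x ^ k :: real) \<le> 1 * weight a x"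
  using power_le_weight[of k a x] a by (simp add: power_abs)

lemma moment_linear: "k \<le> 2 \<Longrightarrow> bounded_linear (moment a k)"
  unfolding moment_def by (rule pairing_linear(1)[OF _ power_weight]) auto

lemma moment_to_l1: "k \<le> 2 \<Longrightarrow> h \<in> L1w a \<Longrightarrow> moment a k (to_l1 a h) = (\<integral>x. x ^ k * h x \<partial>lborel)"
  unfolding moment_def by (subst pairing_linear(2)[OF _ power_weight]) (auto simp: mult.commute)

lemma moments_linear: "bounded_linear (moments a)"
  unfolding moments_def[abs_def] by (intro bounded_linear_Pair moment_linear) auto

lemma of_l1_power_integrable: "k \<le> 2 \<Longrightarrow> integrable lborel (\<lambda>x. of_l1 a u x * x ^ k)"
  using L1w_pairing(1)[of "of_l1 a u" a "\<lambda>x. x ^ k" 1] power_weight by simp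

lemma pairing_quadratic:
  fixes c0 c1 c2 :: real
  shows "pairing a (\<lambda>x. c0 + c1 * x + c2 * x\<^sup>2) u = c0 * moment a 0 u + c1 * moment a 1 u + c2 * moment a 2 u"
proof -
  have "(\<lambda>x. of_l1 a u x *\<^sub>R (c0 + c1 * x + c2 * x\<^sup>2))
    = (\<lambda>x. c0 * (of_l1 a u x * x ^ 0) + c1 * (of_l1 a u x * x ^ 1) + c2 * (of_l1 a u x * x ^ 2))"
    by (simp add: algebra_simps)
  then show ?thesis
    unfolding pairing_def moment_def
    using of_l1_power_integrable[of 0 u] of_l1_power_integrable[of 1 u] of_l1_power_integrable[of 2 u]
    by (simp add: Bochner_Integration.integral_add)
qed

text \<open>A dilation multiplies the k-th moment by exp (k t / 4) exp (- t).\<close>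

lemma moments_dil_op:
  assumes "moments a u = 0"
  shows "moments a (dil_op a t u) = 0"
proof -
  have "moment a k (dil_op a t u) = exp (- t) * (exp (t / 4) ^ k * moment a k u)" if "k \<le> 2" for k
  proof -
    have "moment a k (dil_op a t u) = exp (- t) *\<^sub>R pairing a (\<lambda>x. (exp (t / 4) * x) ^ k) u"
      unfolding moment_def by (rule dil_op_pairing[OF exponent_bounds(1) _ power_weight[OF that]]) simp
    also have "pairing a (\<lambda>x. (exp (t / 4) * x) ^ k) u = (\<integral>x. exp (t / 4) ^ k * (of_l1 a u x * x ^ k) \<partial>lborel)"
      unfolding pairing_def real_scaleR_def power_mult_distrib by (simp only: mult.left_commute)
    also have "\<dots> = exp (t / 4) ^ k * moment a k u"
      unfolding integral_mult_right_zero by (simp add: moment_def pairing_def)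
    finally show ?thesis by simp
  qed
  then show ?thesis using assms by (simp add: moments_eq_0_iff)
qed

lemma H_power_integrable: "k \<le> 2 \<Longrightarrow> integrable lborel (\<lambda>z. H z * z ^ k)"
proof (rule Bochner_Integration.integrable_bound[OF H_weight_integrable[OF a(2)]])
  assume k: "k \<le> 2"
  show "AE z in lborel. norm (H z * z ^ k) \<le> norm (H z * weight a z)"
  proof (rule AE_I2)
    fix z
    show "norm (H z * z ^ k) \<le> norm (H z * weight a z)"
      using mult_left_mono[OF power_weight[OF k, of z], of "H z"] by (simp add: abs_mult)
  qed
qed simp

text \<open>The adjoint maps each power up to the square to a quadratic polynomial whose
  coefficients are moments of H, and pairing with such a polynomial gives 0 when the three moments
  vanish.\<close>

lemma moments_conv_op:
  assumes "moments a u = 0"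
  shows "moments a (conv_op a u) = 0"
proof -
  define \<mu> where "\<mu> k = (\<integral>z. H z * z ^ k \<partial>lborel)" for k :: nat
  have \<mu>0: "\<mu> 0 = 1" by (simp add: \<mu>_def H_integral)
  have m: "moment a k (conv_op a u) = pairing a (conv_dual (\<lambda>x. x ^ k)) u" if "k \<le> 2" for k
    unfolding moment_def by (rule conv_op_pairing[OF exponent_bounds(1) a(2) _ power_weight[OF that]]) simp
  have D0: "conv_dual (\<lambda>x. x ^ 0 :: real) = (\<lambda>y. 2 + 0 * y + 0 * y\<^sup>2)"
    using \<mu>0 by (simp add: conv_dual_def \<mu>_def fun_eq_iff)
  have 0: "moment a 0 (conv_op a u) = 0"
    using assms unfolding m[OF zero_le] D0 pairing_quadratic by (simp add: moments_eq_0_iff)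
  have D1: "conv_dual (\<lambda>x. x ^ 1 :: real) = (\<lambda>y. \<mu> 1 + 1 * y + 0 * y\<^sup>2)"
  proof
    fix y :: real
    have "conv_dual (\<lambda>x. x ^ 1 :: real) y = (\<integral>z. y * (H z * z ^ 0) + H z * z ^ 1 \<partial>lborel)"
      unfolding conv_dual_def by (simp add: integral_mult_right_zero[symmetric] algebra_simps del: integral_mult_right_zero)
    also have "\<dots> = y * \<mu> 0 + \<mu> 1"
      unfolding \<mu>_def using H_power_integrable[of 0] H_power_integrable[of 1] by simp
    finally show "conv_dual (\<lambda>x. x ^ 1 :: real) y = \<mu> 1 + 1 * y + 0 * y\<^sup>2" by (simp add: \<mu>0)
  qed
  have "(1::nat) \<le> 2" by simp
  then have 1: "moment a 1 (conv_op a u) = 0"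
    using assms unfolding m[OF \<open>1 \<le> 2\<close>] D1 pairing_quadratic by (simp add: moments_eq_0_iff)
  have D2: "conv_dual (\<lambda>x. x ^ 2 :: real) = (\<lambda>y. \<mu> 2 / 2 + \<mu> 1 * y + 1 / 2 * y\<^sup>2)"
  proof
    fix y :: real
    have "conv_dual (\<lambda>x. x ^ 2 :: real) y = 2 * (\<integral>z. H z * ((y + z) / 2)\<^sup>2 \<partial>lborel)"
      by (simp add: conv_dual_def)
    also have "(\<lambda>z. H z * ((y + z) / 2)\<^sup>2) = (\<lambda>z. y\<^sup>2 / 4 * (H z * z ^ 0) + y / 2 * (H z * z ^ 1) + 1 / 4 * (H z * z ^ 2))"
      by (auto simp: fun_eq_iff power2_eq_square field_simps)
    also have "(\<integral>z. y\<^sup>2 / 4 * (H z * z ^ 0) + y / 2 * (H z * z ^ 1) + 1 / 4 * (H z * z ^ 2) \<partial>lborel)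
      = y\<^sup>2 / 4 * \<mu> 0 + y / 2 * \<mu> 1 + 1 / 4 * \<mu> 2"
      unfolding \<mu>_def using H_power_integrable[of 0] H_power_integrable[of 1] H_power_integrable[of 2]
      by (simp add: Bochner_Integration.integral_add)
    finally show "conv_dual (\<lambda>x. x ^ 2 :: real) y = \<mu> 2 / 2 + \<mu> 1 * y + 1 / 2 * y\<^sup>2"
      by (simp add: \<mu>0 algebra_simps)
  qed
  have 2: "moment a 2 (conv_op a u) = 0"
    using assms unfolding m[OF order_refl] D2 pairing_quadratic by (simp add: moments_eq_0_iff)
  from 0 1 2 show ?thesis by (simp add: moments_eq_0_iff)
qed

lemma iexp_weight: "norm (iexp (\<xi> * x)) \<le> 1 * weight a x"
  using weight_ge_1[OF exponent_bounds(1), of x] by simp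

lemma iexp_measurable [measurable]: "(\<lambda>x::real. iexp (\<xi> * x)) \<in> borel_measurable borel"
  by (intro borel_measurable_continuous_onI continuous_intros)

lemma fourier_linear: "bounded_linear (fourier a \<xi>)"
  unfolding fourier_def by (rule pairing_linear(1)[OF iexp_measurable iexp_weight])

lemma fourier_dil_op: "fourier a \<xi> (dil_op a t u) = exp (- t) *\<^sub>R fourier a (\<xi> * exp (t / 4)) u"
  unfolding fourier_def
  by (subst dil_op_pairing[OF exponent_bounds(1) iexp_measurable iexp_weight]) (simp add: mult.assoc)

text \<open>The convolution theorem: the transform at \<xi> is twice the product of the transforms
  of u and H at \<xi> / 2, and the latter is at most 1 in modulus.\<close>

lemma fourier_conv_op:
  "norm (fourier a \<xi> (conv_op a u)) \<le> 2 * norm (fourier a (\<xi> / 2) u)"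
proof -
  define G where "G = (\<integral>z. H z *\<^sub>R iexp (\<xi> / 2 * z) \<partial>lborel)"
  have "norm G \<le> (\<integral>z. norm (H z *\<^sub>R iexp (\<xi> / 2 * z)) \<partial>lborel)"
    unfolding G_def by (rule integral_norm_bound)
  also have "\<dots> = 1" using H_integral by simp
  finally have G: "norm G \<le> 1" .
  have dual: "conv_dual (\<lambda>x. iexp (\<xi> * x)) y = iexp (\<xi> / 2 * y) * (2 *\<^sub>R G)" for y
  proof -
    have "(\<lambda>z. H z *\<^sub>R iexp (\<xi> * ((y + z) / 2))) = (\<lambda>z. iexp (\<xi> / 2 * y) * (H z *\<^sub>R iexp (\<xi> / 2 * z)))"
      by (auto simp: fun_eq_iff exp_add[symmetric] field_simps)
    then have "(\<integral>z. H z *\<^sub>R iexp (\<xi> * ((y + z) / 2)) \<partial>lborel) = iexp (\<xi> / 2 * y) * G"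
      unfolding G_def by (simp only: integral_mult_right_zero)
    then show ?thesis unfolding conv_dual_def by (simp add: mult_scaleR_right)
  qed
  have "fourier a \<xi> (conv_op a u) = pairing a (\<lambda>y. iexp (\<xi> / 2 * y) * (2 *\<^sub>R G)) u"
    unfolding fourier_def conv_op_pairing[OF exponent_bounds(1) a(2) iexp_measurable iexp_weight] dual ..
  also have "\<dots> = (\<integral>x. (of_l1 a u x *\<^sub>R iexp (\<xi> / 2 * x)) * (2 *\<^sub>R G) \<partial>lborel)"
    by (simp only: pairing_def mult_scaleR_left)
  also have "\<dots> = fourier a (\<xi> / 2) u * (2 *\<^sub>R G)"
    unfolding fourier_def pairing_def by (rule integral_mult_left_zero)
  finally have "norm (fourier a \<xi> (conv_op a u)) = norm (fourier a (\<xi> / 2) u) * (2 * norm G)"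
    by (simp add: norm_mult)
  also have "\<dots> \<le> norm (fourier a (\<xi> / 2) u) * (2 * 1)"
    using G by (intro mult_left_mono) auto
  finally show ?thesis by simp
qed

text \<open>An exponent between 2 and 3 interpolates: the cubic bound serves s < 1, the quadratic
  one s \<ge> 1.\<close>

lemma min_powr_le:
  fixes s :: real
  assumes "0 \<le> s"
  shows "min (s ^ 3 / 6) (s ^ 2) \<le> s powr a"
proof (cases "s = 0")
  case False
  with assms have s: "0 < s" by simp
  show ?thesis
  proof (cases "1 \<le> s")
    case True
    have "s ^ 2 = s powr 2" using s by (simp add: powr_realpow[of s 2, simplified])
    also have "\<dots> \<le> s powr a" using True a by (intro powr_mono) auto
    finally show ?thesis by simp
  next
    case False
    have "s ^ 3 / 6 \<le> s ^ 3" using s by simp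
    also have "s ^ 3 = s powr 3" using s by (simp add: powr_realpow[of s 3, simplified])
    also have "\<dots> \<le> s powr a" using False s a by (intro powr_mono') auto
    finally show ?thesis by simp
  qed
qed simp

text \<open>Vanishing moments allow subtracting the Taylor polynomial of degree 2 from the
  exponential, and the remainder is at most |\<xi> x|^a. This places the given norm above the weak
  norm, with constant 1.\<close>

lemma fourier_le:
  assumes "moments a u = 0"
  shows "norm (fourier a \<xi> u) \<le> norm u * \<bar>\<xi>\<bar> powr a"
proof -
  define r where "r x = iexp (\<xi> * x) - (\<Sum>k\<le>2. (\<i> * complex_of_real (\<xi> * x)) ^ k / fact k)" for x
  have rm [measurable]: "r \<in> borel_measurable borel"
    unfolding r_def by (intro borel_measurable_continuous_onI continuous_intros) auto
  have r: "norm (r x) \<le> \<bar>\<xi>\<bar> powr a * weight a x" for x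
  proof -
    have "norm (r x) \<le> min (\<bar>\<xi> * x\<bar> ^ 3 / 6) (\<bar>\<xi> * x\<bar> ^ 2)"
      \<comment> \<open>For n = 2 the two remainder bounds are s^3 / 3! and 2 s^2 / 2!.\<close>
      using iexp_approx1[of "\<xi> * x" 2] iexp_approx2[of "\<xi> * x" 2]
      by (simp add: r_def eval_nat_numeral fact_numeral)
    also have "\<dots> \<le> \<bar>\<xi> * x\<bar> powr a" by (rule min_powr_le) simp
    also have "\<dots> = \<bar>\<xi>\<bar> powr a * \<bar>x\<bar> powr a" by (simp add: abs_mult powr_mult)
    also have "\<dots> \<le> \<bar>\<xi>\<bar> powr a * weight a x"
      by (intro mult_left_mono powr_le_weight exponent_bounds) simp
    finally show ?thesis .
  qed
  have i: "integrable lborel (\<lambda>x. of_l1 a u x *\<^sub>R (\<i> * complex_of_real (\<xi> * x)) ^ k)" if "k \<le> 2" for k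
  proof -
    have "integrable lborel (\<lambda>x. (\<i> * complex_of_real \<xi>) ^ k * complex_of_real (of_l1 a u x * x ^ k))"
      by (intro integrable_mult_right integrable_of_real of_l1_power_integrable that)
    then show ?thesis by (simp add: power_mult_distrib scaleR_conv_of_real ac_simps)
  qed
  have z: "(\<integral>x. of_l1 a u x *\<^sub>R (\<i> * complex_of_real (\<xi> * x)) ^ k \<partial>lborel) = 0" if "k \<le> 2" for k
  proof -
    have "(\<integral>x. of_l1 a u x *\<^sub>R (\<i> * complex_of_real (\<xi> * x)) ^ k \<partial>lborel)
      = (\<integral>x. (\<i> * complex_of_real \<xi>) ^ k * complex_of_real (of_l1 a u x * x ^ k) \<partial>lborel)"
      by (simp add: power_mult_distrib scaleR_conv_of_real ac_simps)
    also have "\<dots> = (\<i> * complex_of_real \<xi>) ^ k * complex_of_real (moment a k u)"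
      unfolding integral_mult_right_zero integral_complex_of_real by (simp add: moment_def pairing_def)
    also have "moment a k u = 0"
      using assms that by (auto simp: moments_eq_0_iff le_Suc_eq numeral_2_eq_2)
    finally show ?thesis by simp
  qed
  have "pairing a r u = (\<integral>x. of_l1 a u x *\<^sub>R iexp (\<xi> * x)
      - (\<Sum>k\<le>2. (of_l1 a u x *\<^sub>R (\<i> * complex_of_real (\<xi> * x)) ^ k) / fact k) \<partial>lborel)"
    by (simp only: pairing_def r_def scaleR_diff_right scaleR_sum_right divide_inverse mult_scaleR_left)
  also have "\<dots> = fourier a \<xi> u
      - (\<integral>x. (\<Sum>k\<le>2. (of_l1 a u x *\<^sub>R (\<i> * complex_of_real (\<xi> * x)) ^ k) / fact k) \<partial>lborel)"
    unfolding fourier_def pairing_def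
    by (intro Bochner_Integration.integral_diff L1w_pairing(1)[OF of_l1_in_L1w iexp_measurable iexp_weight]
        Bochner_Integration.integrable_sum integrable_divide i) auto
  also have "(\<integral>x. (\<Sum>k\<le>2. (of_l1 a u x *\<^sub>R (\<i> * complex_of_real (\<xi> * x)) ^ k) / fact k) \<partial>lborel)
    = (\<Sum>k\<le>2. (\<integral>x. (of_l1 a u x *\<^sub>R (\<i> * complex_of_real (\<xi> * x)) ^ k) / fact k \<partial>lborel))"
    by (intro Bochner_Integration.integral_sum integrable_divide i) auto
  also have "\<dots> = 0"
  proof (intro sum.neutral ballI)
    fix k :: nat assume "k \<in> {..2}"
    then show "(\<integral>x. (of_l1 a u x *\<^sub>R (\<i> * complex_of_real (\<xi> * x)) ^ k) / fact k \<partial>lborel) = 0"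
      using z[of k] by (simp only: integral_divide_zero) simp
  qed
  finally have "fourier a \<xi> u = pairing a r u" by simp
  then show ?thesis
    using pairing_linear(3)[OF rm r, of u] by (simp add: mult.commute)
qed

end

text \<open>The inverse Fourier transform \<open>(1 + |\<xi>|) exp (- |\<xi>|)\<close> of \<open>H\<close>, restricted to the half-line.\<close>

definition H_hat :: "real \<Rightarrow> real" where
  "H_hat \<xi> = indicator {0..} \<xi> * ((1 + \<xi>) * exp (- \<xi>)) / pi"

lemma H_hat_nonneg [simp]: "0 \<le> H_hat \<xi>"
  by (simp add: H_hat_def indicator_def)

lemma H_hat_measurable [measurable]: "H_hat \<in> borel_measurable borel"
  unfolding H_hat_def[abs_def] by measurable

lemma H_hat_powr_integrable:
  assumes "0 \<le> b" "b \<le> 3"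
  shows "integrable lborel (\<lambda>\<xi>. H_hat \<xi> * \<bar>\<xi>\<bar> powr b)"
proof (rule Bochner_Integration.integrable_bound)
  show "integrable lborel (\<lambda>\<xi>::real. indicator {0..} \<xi> * ((1 + \<xi>) ^ 4 * exp (- \<xi>)))"
  proof (rule integrableI_nonneg)
    \<comment> \<open>A primitive of (1 + \<xi>)^4 exp (- \<xi>): minus exp (- \<xi>) times the sum
      of all derivatives of the polynomial. The fourth power is the 3 that bounds b plus the factor
      1 + \<xi> of \<open>H_hat\<close>.\<close>
    have "((\<lambda>\<xi>::real. - ((1 + \<xi>) ^ 4 + 4 * (1 + \<xi>) ^ 3 + 12 * (1 + \<xi>) ^ 2 + 24 * (1 + \<xi>) + 24) * exp (- \<xi>)) \<longlongrightarrow> 0) at_top"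
      by real_asymp
    then have "(\<integral>\<^sup>+\<xi>. ennreal ((1 + \<xi>) ^ 4 * exp (- \<xi>)) * indicator {0..} \<xi> \<partial>lborel)
      = ennreal (0 - (- ((1 + 0) ^ 4 + 4 * (1 + 0) ^ 3 + 12 * (1 + 0) ^ 2 + 24 * (1 + 0) + 24) * exp (- 0)))"
      by (intro nn_integral_FTC_atLeast) (auto intro!: derivative_eq_intros simp: algebra_simps eval_nat_numeral)
    then show "(\<integral>\<^sup>+\<xi>. ennreal (indicator {0..} \<xi> * ((1 + \<xi>) ^ 4 * exp (- \<xi>))) \<partial>lborel) < \<infinity>"
      by (simp add: ennreal_mult' ennreal_indicator mult.commute)
  qed (auto simp: indicator_def)
  show "AE \<xi> in lborel. norm (H_hat \<xi> * \<bar>\<xi>\<bar> powr b) \<le> norm (indicator {0..} \<xi> * ((1 + \<xi>) ^ 4 * exp (- \<xi>)))"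
  proof (rule AE_I2)
    fix \<xi> :: real
    show "norm (H_hat \<xi> * \<bar>\<xi>\<bar> powr b) \<le> norm (indicator {0..} \<xi> * ((1 + \<xi>) ^ 4 * exp (- \<xi>)))"
    proof (cases "0 \<le> \<xi>")
      case True
      have "\<xi> powr b \<le> (1 + \<xi>) powr b" using True assms by (intro powr_mono2) auto
      also have "\<dots> \<le> (1 + \<xi>) powr 3" using True assms by (intro powr_mono) auto
      also have "\<dots> = (1 + \<xi>) ^ 3" using True by (simp add: powr_realpow[of _ 3, simplified])
      finally have "((1 + \<xi>) * exp (- \<xi>)) * \<xi> powr b \<le> ((1 + \<xi>) * exp (- \<xi>)) * (1 + \<xi>) ^ 3"
        using True by (intro mult_left_mono) auto
      moreover have "H_hat \<xi> * \<xi> powr b \<le> ((1 + \<xi>) * exp (- \<xi>)) * \<xi> powr b"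
      proof (rule mult_right_mono)
        have "(1 + \<xi>) * exp (- \<xi>) / pi \<le> (1 + \<xi>) * exp (- \<xi>) / 1"
          using True pi_ge_two by (intro divide_left_mono) auto
        then show "H_hat \<xi> \<le> (1 + \<xi>) * exp (- \<xi>)" using True by (simp add: H_hat_def)
      qed simp
      ultimately have "H_hat \<xi> * \<xi> powr b \<le> (1 + \<xi>) ^ 4 * exp (- \<xi>)"
        by (simp add: eval_nat_numeral ac_simps)
      then show ?thesis using True by (simp add: abs_mult)
    qed (simp add: H_hat_def)
  qed
qed simp

lemma H_hat_integrable: "integrable lborel H_hat"
proof -
  have "AE \<xi> in lborel. H_hat \<xi> * \<bar>\<xi>\<bar> powr 0 = H_hat \<xi>"
    using AE_lborel_singleton[of 0] by eventually_elim simp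
  then show ?thesis
    using H_hat_powr_integrable[of 0] by (subst integrable_cong_AE[where g = "\<lambda>\<xi>. H_hat \<xi> * \<bar>\<xi>\<bar> powr 0"]) auto
qed

text \<open>Fourier inversion for H, proved directly by integrating (1 + \<xi>) exp (- \<xi>) cos
  (\<xi> y) with an explicit primitive.\<close>

lemma H_eq_cos_integral: "H y = (\<integral>\<xi>. H_hat \<xi> * cos (\<xi> * y) \<partial>lborel)"
proof -
  define q where "q = 1 + y\<^sup>2"
  have q: "0 < q" "y\<^sup>2 = q - 1" by (auto simp: q_def add_pos_nonneg)
  \<comment> \<open>With z = 1 - i y, a primitive of (1 + \<xi>) exp (- z \<xi>) is - exp (- z
    \<xi>) ((1 + \<xi>) / z + 1 / z^2). The bracket equals p1 + i p2, and F is the real part of the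
    whole.\<close>
  define p1 where "p1 \<xi> = (1 + \<xi>) / q + (1 - y\<^sup>2) / q\<^sup>2" for \<xi>
  define p2 where "p2 \<xi> = y * (1 + \<xi>) / q + 2 * y / q\<^sup>2" for \<xi>
  define F where "F \<xi> = - exp (- \<xi>) * (p1 \<xi> * cos (\<xi> * y) - p2 \<xi> * sin (\<xi> * y))" for \<xi>
  define f where "f \<xi> = (1 + \<xi>) * exp (- \<xi>) * cos (\<xi> * y)" for \<xi>
  have id1: "p1 \<xi> - 1 / q + p2 \<xi> * y = 1 + \<xi>" for \<xi>
  proof -
    have "p1 \<xi> - 1 / q + p2 \<xi> * y = (1 + \<xi>) * (1 + y\<^sup>2) / q + (1 + y\<^sup>2) / q\<^sup>2 - 1 / q"
      by (simp add: p1_def p2_def add_divide_distrib diff_divide_distrib power2_eq_square algebra_simps)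
    also have "\<dots> = 1 + \<xi>" using q by (simp add: q_def[symmetric] power2_eq_square)
    finally show ?thesis .
  qed
  have id2: "p1 \<xi> * y - p2 \<xi> + y / q = 0" for \<xi>
  proof -
    have "p1 \<xi> * y - p2 \<xi> + y / q = y * ((1 - y\<^sup>2) / q\<^sup>2 - 2 / q\<^sup>2 + 1 / q)"
      by (simp add: p1_def p2_def algebra_simps)
    also have "(1 - y\<^sup>2) / q\<^sup>2 - 2 / q\<^sup>2 + 1 / q = 0"
      using q(1) unfolding q(2) by (simp add: power2_eq_square field_simps)
    finally show ?thesis by simp
  qed
  have dF: "(F has_real_derivative f \<xi>) (at \<xi>)" for \<xi>
  proof -
    have d: "(p1 has_real_derivative 1 / q) (at \<xi>)" "(p2 has_real_derivative y / q) (at \<xi>)"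
      unfolding p1_def p2_def using q(1) by (auto intro!: derivative_eq_intros)
    have "(F has_real_derivative exp (- \<xi>) * ((p1 \<xi> - 1 / q + p2 \<xi> * y) * cos (\<xi> * y)
        + (p1 \<xi> * y - p2 \<xi> + y / q) * sin (\<xi> * y))) (at \<xi>)"
      unfolding F_def by (rule derivative_eq_intros d refl)+ (simp add: algebra_simps)
    then show ?thesis unfolding id1 id2 by (simp add: f_def ac_simps)
  qed
  have limF: "(F \<longlongrightarrow> 0) at_top"
  proof (rule Lim_null_comparison)
    show "\<forall>\<^sub>F \<xi> in at_top. norm (F \<xi>) \<le> exp (- \<xi>) * (\<bar>p1 \<xi>\<bar> + \<bar>p2 \<xi>\<bar>)"
    proof (intro always_eventually allI)
      fix \<xi>
      have "\<bar>p1 \<xi> * cos (\<xi> * y) - p2 \<xi> * sin (\<xi> * y)\<bar> \<le> \<bar>p1 \<xi> * cos (\<xi> * y)\<bar> + \<bar>p2 \<xi> * sin (\<xi> * y)\<bar>"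
        by (rule abs_triangle_ineq4)
      also have "\<dots> \<le> \<bar>p1 \<xi>\<bar> + \<bar>p2 \<xi>\<bar>" by (intro add_mono) (auto simp: abs_mult mult_left_le)
      finally show "norm (F \<xi>) \<le> exp (- \<xi>) * (\<bar>p1 \<xi>\<bar> + \<bar>p2 \<xi>\<bar>)"
        by (simp add: F_def abs_mult)
    qed
    have 1: "((\<lambda>\<xi>::real. exp (- \<xi>) * (1 + \<xi>)) \<longlongrightarrow> 0) at_top" "((\<lambda>\<xi>::real. exp (- \<xi>)) \<longlongrightarrow> 0) at_top"
      by real_asymp+
    have *: "((\<lambda>\<xi>. exp (- \<xi>) * \<bar>c * (1 + \<xi>) + d\<bar>) \<longlongrightarrow> 0) at_top" for c d :: real
    proof -
      have "((\<lambda>\<xi>. \<bar>c * (exp (- \<xi>) * (1 + \<xi>)) + d * exp (- \<xi>)\<bar>) \<longlongrightarrow> \<bar>c * 0 + d * 0\<bar>) at_top"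
        by (intro tendsto_intros 1)
      moreover have "\<bar>c * (exp (- \<xi>) * (1 + \<xi>)) + d * exp (- \<xi>)\<bar> = exp (- \<xi>) * \<bar>c * (1 + \<xi>) + d\<bar>" for \<xi>
        by (simp add: abs_mult[of "exp (- \<xi>)", simplified, symmetric] algebra_simps)
      ultimately show ?thesis by simp
    qed
    have "((\<lambda>\<xi>. exp (- \<xi>) * \<bar>p1 \<xi>\<bar> + exp (- \<xi>) * \<bar>p2 \<xi>\<bar>) \<longlongrightarrow> 0 + 0) at_top"
      using *[of "1 / q" "(1 - y\<^sup>2) / q\<^sup>2"] *[of "y / q" "2 * y / q\<^sup>2"]
      by (intro tendsto_add) (simp_all add: p1_def p2_def)
    then show "((\<lambda>\<xi>. exp (- \<xi>) * (\<bar>p1 \<xi>\<bar> + \<bar>p2 \<xi>\<bar>)) \<longlongrightarrow> 0) at_top"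
      by (simp add: distrib_left)
  qed
  have Hf: "H_hat \<xi> * cos (\<xi> * y) = indicator {0..} \<xi> *\<^sub>R (f \<xi> / pi)" for \<xi>
    by (simp add: H_hat_def f_def)
  have iH: "integrable lborel (\<lambda>\<xi>. H_hat \<xi> * cos (\<xi> * y))"
    by (rule Bochner_Integration.integrable_bound[OF H_hat_integrable]) (auto simp: abs_mult mult_left_le)
  then have "integrable lborel (\<lambda>\<xi>. pi * (H_hat \<xi> * cos (\<xi> * y)))" by simp
  then have "set_integrable lborel {0..} f"
    unfolding Hf set_integrable_def by simp
  then have si: "set_integrable lborel (einterval 0 \<infinity>) f"
    by (rule set_integrable_subset) (auto simp: einterval_def)
  have "(LBINT \<xi>=0..\<infinity>. f \<xi>) = 0 - F 0"
  proof (rule interval_integral_FTC_integrable[OF _ _ _ si])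
    show "(F has_vector_derivative f \<xi>) (at \<xi>)" for \<xi>
      using dF[of \<xi>] by (simp add: has_real_derivative_iff_has_vector_derivative)
    show "isCont f \<xi>" for \<xi> unfolding f_def by (intro continuous_intros)
    have "(F \<longlongrightarrow> F 0) (at_right 0)"
      using DERIV_isCont[OF dF[of 0]] by (auto simp: isCont_def intro: tendsto_mono[OF at_le])
    then show "((F \<circ> real_of_ereal) \<longlongrightarrow> F 0) (at_right 0)"
      by (simp add: zero_ereal_def ereal_tendsto_simps)
    show "((F \<circ> real_of_ereal) \<longlongrightarrow> 0) (at_left \<infinity>)"
      using limF by (simp add: ereal_tendsto_simps)
  qed simp
  moreover have "F 0 = - (2 / q\<^sup>2)"
    unfolding F_def p1_def q(2) using q(1) by (simp add: power2_eq_square field_simps)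
  ultimately have "(LBINT \<xi>=0..\<infinity>. f \<xi>) = 2 / q\<^sup>2" by simp
  moreover have "(LBINT \<xi>=0..\<infinity>. f \<xi>) = (\<integral>\<xi>. indicator {0..} \<xi> *\<^sub>R f \<xi> \<partial>lborel)"
  proof -
    have "(LBINT \<xi>=0..\<infinity>. f \<xi>) = (\<integral>\<xi>. indicator {0<..} \<xi> *\<^sub>R f \<xi> \<partial>lborel)"
      using interval_integral_to_infinity_eq[where a = 0 and f = f and M = lborel]
      by (simp add: set_lebesgue_integral_def zero_ereal_def[symmetric])
    also have "\<dots> = (\<integral>\<xi>. indicator {0..} \<xi> *\<^sub>R f \<xi> \<partial>lborel)"
    proof (rule integral_cong_AE)
      show "AE \<xi> in lborel. indicator {0<..} \<xi> *\<^sub>R f \<xi> = indicator {0..} \<xi> *\<^sub>R f \<xi>"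
        using AE_lborel_singleton[of 0] by eventually_elim (auto simp: indicator_def)
    qed (auto simp: f_def[abs_def])
    finally show ?thesis .
  qed
  moreover have "(\<integral>\<xi>. H_hat \<xi> * cos (\<xi> * y) \<partial>lborel) = (\<integral>\<xi>. indicator {0..} \<xi> *\<^sub>R f \<xi> \<partial>lborel) / pi"
    unfolding Hf by simp
  ultimately show ?thesis by (simp add: H_def q_def)
qed

section \<open>Regularising and asymptotic bounds\<close>

context
  fixes a :: real
  assumes a: "2 < a" "a < 3"
begin

text \<open>Inserting the inversion formula for H and exchanging integrals bounds the values of the
  convolution by the weak norm, uniformly in x. This is the smoothing that makes the truncated part
  subordinate to the weak norm.\<close>

lemma conv_sup_bound:
  assumes F: "\<And>\<xi>. norm (fourier a \<xi> u) \<le> B * \<bar>\<xi>\<bar> powr a"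
  shows "\<bar>conv (of_l1 a u) x\<bar> \<le> 4 * (\<integral>\<xi>. H_hat \<xi> * \<bar>\<xi>\<bar> powr a \<partial>lborel) * B"
proof -
  define h where "h = of_l1 a u"
  have [measurable]: "h \<in> borel_measurable borel" by (simp add: h_def)
  have a0: "0 \<le> a" using a by simp
  have hi: "integrable lborel h"
    unfolding h_def by (rule L1w_integrable_1[OF a0 a(2) of_l1_in_L1w])
  have "integrable (lborel \<Otimes>\<^sub>M lborel) (\<lambda>(y, \<xi>). h y * H_hat \<xi>)"
  proof (rule lborel_pair.Fubini_integrable)
    show "integrable lborel (\<lambda>y. \<integral>\<xi>. norm (case (y, \<xi>) of (y, \<xi>) \<Rightarrow> h y * H_hat \<xi>) \<partial>lborel)"
      using hi by (simp add: abs_mult)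
    show "AE y in lborel. integrable lborel (\<lambda>\<xi>. case (y, \<xi>) of (y, \<xi>) \<Rightarrow> h y * H_hat \<xi>)"
      using H_hat_integrable by simp
  qed measurable
  then have F2: "integrable (lborel \<Otimes>\<^sub>M lborel) (\<lambda>(y, \<xi>). h y * (H_hat \<xi> * cos (\<xi> * (2 * x - y))))"
  proof (rule Bochner_Integration.integrable_bound)
    show "AE p in lborel \<Otimes>\<^sub>M lborel. norm (case p of (y, \<xi>) \<Rightarrow> h y * (H_hat \<xi> * cos (\<xi> * (2 * x - y))))
      \<le> norm (case p of (y, \<xi>) \<Rightarrow> h y * H_hat \<xi>)"
      by (intro AE_I2) (auto simp: abs_mult intro!: mult_left_mono mult_left_le)
  qed measurable
  have ie: "integrable lborel (\<lambda>y. h y *\<^sub>R iexp (\<xi> * y))" for \<xi>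
    unfolding h_def by (rule L1w_pairing(1)[OF of_l1_in_L1w iexp_measurable[OF a] iexp_weight[OF a]])
  have inner: "\<bar>\<integral>y. h y * (H_hat \<xi> * cos (\<xi> * (2 * x - y))) \<partial>lborel\<bar> \<le> B * (H_hat \<xi> * \<bar>\<xi>\<bar> powr a)" for \<xi>
  proof -
    \<comment> \<open>As the real part of a product of exponentials, the cosine turns the inner
      integral into a phase times the transform at - \<xi>.\<close>
    have c: "cos (\<xi> * (2 * x - y)) = Re (iexp (2 * \<xi> * x) * iexp (- \<xi> * y))" for y
      by (simp add: exp_add[symmetric] Re_exp algebra_simps)
    have "(\<integral>y. h y * (H_hat \<xi> * cos (\<xi> * (2 * x - y))) \<partial>lborel)
      = (\<integral>y. H_hat \<xi> * Re (iexp (2 * \<xi> * x) * (h y *\<^sub>R iexp (- \<xi> * y))) \<partial>lborel)"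
      unfolding c mult_scaleR_right by (simp add: ac_simps)
    also have "\<dots> = H_hat \<xi> * Re (iexp (2 * \<xi> * x) * (\<integral>y. h y *\<^sub>R iexp (- \<xi> * y) \<partial>lborel))"
      using ie[of "- \<xi>"] by (subst integral_mult_right_zero, subst integral_Re) (simp_all only: integral_mult_right_zero integrable_mult_right)
    also have "(\<integral>y. h y *\<^sub>R iexp (- \<xi> * y) \<partial>lborel) = fourier a (- \<xi>) u"
      by (simp add: fourier_def pairing_def h_def)
    finally have "\<bar>\<integral>y. h y * (H_hat \<xi> * cos (\<xi> * (2 * x - y))) \<partial>lborel\<bar>
      = H_hat \<xi> * \<bar>Re (iexp (2 * \<xi> * x) * fourier a (- \<xi>) u)\<bar>" by (simp add: abs_mult)
    also have "\<dots> \<le> H_hat \<xi> * norm (iexp (2 * \<xi> * x) * fourier a (- \<xi>) u)"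
      by (intro mult_left_mono abs_Re_le_cmod) simp
    also have "\<dots> = H_hat \<xi> * norm (fourier a (- \<xi>) u)" by (simp add: norm_mult)
    also have "\<dots> \<le> H_hat \<xi> * (B * \<bar>\<xi>\<bar> powr a)"
      using F[of "- \<xi>"] by (intro mult_left_mono) auto
    finally show ?thesis by (simp add: ac_simps)
  qed
  have "(\<integral>y. h y * H (2 * x - y) \<partial>lborel) = (\<integral>y. \<integral>\<xi>. h y * (H_hat \<xi> * cos (\<xi> * (2 * x - y))) \<partial>lborel \<partial>lborel)"
    unfolding H_eq_cos_integral by simp
  also have "\<dots> = (\<integral>\<xi>. \<integral>y. h y * (H_hat \<xi> * cos (\<xi> * (2 * x - y))) \<partial>lborel \<partial>lborel)"
    by (rule lborel_pair.Fubini_integral[OF F2, symmetric])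
  finally have "\<bar>\<integral>y. h y * H (2 * x - y) \<partial>lborel\<bar> \<le> (\<integral>\<xi>. \<bar>\<integral>y. h y * (H_hat \<xi> * cos (\<xi> * (2 * x - y))) \<partial>lborel\<bar> \<partial>lborel)"
    by simp
  also have "\<dots> \<le> (\<integral>\<xi>. B * (H_hat \<xi> * \<bar>\<xi>\<bar> powr a) \<partial>lborel)"
  proof (rule integral_mono[OF _ _ inner])
    show "integrable lborel (\<lambda>\<xi>. \<bar>\<integral>y. h y * (H_hat \<xi> * cos (\<xi> * (2 * x - y))) \<partial>lborel\<bar>)"
      using lborel_pair.integrable_snd[OF F2] by (intro integrable_abs)
    show "integrable lborel (\<lambda>\<xi>. B * (H_hat \<xi> * \<bar>\<xi>\<bar> powr a))"
      using a by (intro integrable_mult_right H_hat_powr_integrable) auto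
  qed
  finally show ?thesis by (simp add: conv_def h_def abs_mult mult.commute)
qed

text \<open>As \<open>|y|\<close> tends to infinity, \<open>weight a ((y + z) / 2) / weight a y\<close> tends to \<open>2 powr (- a)\<close>.\<close>

lemma conv_dual_weight_asymptotic:
  assumes \<kappa>: "2 powr (1 - a) < \<kappa>"
  shows "\<exists>R>0. \<forall>y. R < \<bar>y\<bar> \<longrightarrow> conv_dual (weight a) y \<le> \<kappa> * weight a y"
proof -
  have a0: "0 \<le> a" using a by simp
  \<comment> \<open>A majorant of the ratio of weights that depends on y only through r = 1 + |y|,
    so that a single limit in r is uniform in y.\<close>
  define \<Phi> where "\<Phi> r = (\<integral>z. H z * (1 + (1 + \<bar>z\<bar>) / r) powr a \<partial>lborel)" for r :: real
  have dom: "integrable lborel (\<lambda>z. 2 powr a * (H z * weight a z))"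
    using H_weight_integrable[OF a(2)] by simp
  have bnd: "norm (H z * (1 + (1 + \<bar>z\<bar>) / r) powr a) \<le> 2 powr a * (H z * weight a z)" if "1 \<le> r" for r z
  proof -
    have "(1 + \<bar>z\<bar>) / r \<le> (1 + \<bar>z\<bar>) / 1" using that by (intro divide_left_mono) auto
    then have "(1 + (1 + \<bar>z\<bar>) / r) powr a \<le> (2 * (1 + \<bar>z\<bar>)) powr a"
      using a0 that by (intro powr_mono2) auto
    also have "(2 * (1 + \<bar>z\<bar>)) powr a = 2 powr a * weight a z"
      unfolding weight_def by (subst powr_mult) auto
    finally have "(1 + (1 + \<bar>z\<bar>) / r) powr a \<le> 2 powr a * weight a z" .
    from mult_left_mono[OF this, of "H z"] show ?thesis by (simp add: abs_mult ac_simps)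
  qed
  have "(\<Phi> \<longlongrightarrow> (\<integral>z. H z * (1 + 0) powr a \<partial>lborel)) at_top"
    unfolding \<Phi>_def
  proof (rule integral_dominated_convergence_at_top[OF _ _ dom])
    show "\<forall>\<^sub>F r in at_top. AE z in lborel. norm (H z * (1 + (1 + \<bar>z\<bar>) / r) powr a) \<le> 2 powr a * (H z * weight a z)"
      using eventually_ge_at_top[of 1] by eventually_elim (intro AE_I2 bnd)
    show "AE z in lborel. ((\<lambda>r. H z * (1 + (1 + \<bar>z\<bar>) / r) powr a) \<longlongrightarrow> H z * (1 + 0) powr a) at_top"
    proof (rule AE_I2)
      fix z :: real
      have "((\<lambda>r. (1 + \<bar>z\<bar>) / r) \<longlongrightarrow> 0) at_top"
        by (rule tendsto_divide_0[OF tendsto_const filterlim_at_top_imp_at_infinity[OF filterlim_ident]])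
      then show "((\<lambda>r. H z * (1 + (1 + \<bar>z\<bar>) / r) powr a) \<longlongrightarrow> H z * (1 + 0) powr a) at_top"
        by (intro tendsto_intros) auto
    qed
  qed measurable
  then have "((\<lambda>r. 2 powr (1 - a) * \<Phi> r) \<longlongrightarrow> 2 powr (1 - a) * 1) at_top"
    by (intro tendsto_intros) (simp add: H_integral)
  then have "\<forall>\<^sub>F r in at_top. 2 powr (1 - a) * \<Phi> r < \<kappa>"
    using \<kappa> by (intro order_tendstoD) auto
  then obtain r0 where r0: "\<And>r. r0 \<le> r \<Longrightarrow> 2 powr (1 - a) * \<Phi> r < \<kappa>"
    by (auto simp: eventually_at_top_linorder)
  have "conv_dual (weight a) y \<le> \<kappa> * weight a y" if y: "max 1 r0 < \<bar>y\<bar>" for y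
  proof -
    define r where "r = 1 + \<bar>y\<bar>"
    have r: "1 \<le> r" "r0 \<le> r" using y by (auto simp: r_def)
    have le: "weight a ((y + z) / 2) \<le> 2 powr (- a) * weight a y * (1 + (1 + \<bar>z\<bar>) / r) powr a" for z
    proof -
      \<comment> \<open>Since 1 + |y + z| / 2 \<le> (2 + |y| + |z|) / 2, the power a separates into
        2^(- a), the weight of y and the factor inside \<Phi>.\<close>
      have "r * (1 + (1 + \<bar>z\<bar>) / r) = 2 + \<bar>y\<bar> + \<bar>z\<bar>"
        using r(1) unfolding r_def by (simp add: field_simps)
      then have "1 + \<bar>(y + z) / 2\<bar> \<le> 1 / 2 * (r * (1 + (1 + \<bar>z\<bar>) / r))"
        using abs_triangle_ineq[of y z] by simp
      then have "weight a ((y + z) / 2) \<le> (1 / 2 * (r * (1 + (1 + \<bar>z\<bar>) / r))) powr a"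
        unfolding weight_def using a0 by (intro powr_mono2) auto
      also have "\<dots> = (1 / 2) powr a * (r powr a * (1 + (1 + \<bar>z\<bar>) / r) powr a)"
        using r by (simp only: powr_mult)
      also have "(1 / 2) powr a = (2::real) powr (- a)" by (simp only: powr_divide powr_minus powr_one_eq_one inverse_eq_divide)
      finally show ?thesis by (simp add: weight_def r_def mult.assoc)
    qed
    have "conv_dual (weight a) y = 2 * (\<integral>z. H z * weight a ((y + z) / 2) \<partial>lborel)"
      by (simp add: conv_dual_def)
    also have "\<dots> \<le> 2 * (\<integral>z. 2 powr (- a) * weight a y * (H z * (1 + (1 + \<bar>z\<bar>) / r) powr a) \<partial>lborel)"
    proof (intro mult_left_mono integral_mono)
      show "integrable lborel (\<lambda>z. H z * weight a ((y + z) / 2))"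
        using H_psi_integrable(1)[OF a0 a(2), of "weight a" 1 y] by simp
      show "integrable lborel (\<lambda>z. 2 powr (- a) * weight a y * (H z * (1 + (1 + \<bar>z\<bar>) / r) powr a))"
        by (intro integrable_mult_right Bochner_Integration.integrable_bound[OF dom])
          (use bnd[OF r(1)] in \<open>auto intro!: AE_I2 intro: order_trans[OF _ abs_ge_self]\<close>)
      show "H z * weight a ((y + z) / 2) \<le> 2 powr (- a) * weight a y * (H z * (1 + (1 + \<bar>z\<bar>) / r) powr a)" for z
        using mult_left_mono[OF le[of z], of "H z"] by (simp add: ac_simps)
    qed simp
    also have "\<dots> = 2 * 2 powr (- a) * \<Phi> r * weight a y"
      unfolding integral_mult_right_zero \<Phi>_def by simp
    also have "2 * 2 powr (- a) = (2::real) powr (1 - a)" using powr_add[of "2::real" 1 "- a"] by simp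
    also have "2 powr (1 - a) * \<Phi> r * weight a y \<le> \<kappa> * weight a y"
      using r0[OF r(2)] by (intro mult_right_mono) auto
    finally show ?thesis .
  qed
  then show ?thesis by (intro exI[of _ "max 1 r0"]) auto
qed

text \<open>The operator \<open>P\<close> of the abstract decay estimate.\<close>

definition cut :: "real \<Rightarrow> l1 \<Rightarrow> l1" where
  "cut R u = to_l1 a (\<lambda>x. indicator {- R..R} x * of_l1 a u x)"

lemma
  shows cut_linear: "bounded_linear (cut R)"
    and cut_to_l1: "h \<in> L1w a \<Longrightarrow> cut R (to_l1 a h) = to_l1 a (\<lambda>x. indicator {- R..R} x * h x)"
    and cut_le: "norm (cut R u) \<le> norm u"
    and cut_in_L1w: "h \<in> L1w a \<Longrightarrow> (\<lambda>x. indicator {- R..R} x * h x) \<in> L1w a"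
proof -
  have D: "(\<lambda>x. indicator {- R..R} x * h x) \<in> L1w a" if "h \<in> L1w a" for h
  proof (rule L1wI)
    note [measurable] = L1w_measurable[OF that]
    show "(\<lambda>x. indicator {- R..R} x * h x) \<in> borel_measurable borel" by measurable
    show "integrable lborel (\<lambda>x. \<bar>indicator {- R..R} x * h x\<bar> * weight a x)"
    proof (rule Bochner_Integration.integrable_bound[OF L1w_integrable_abs[OF that]])
      show "AE x in lborel. norm (\<bar>indicator {- R..R} x * h x\<bar> * weight a x) \<le> norm (\<bar>h x\<bar> * weight a x)"
        by (rule AE_I2) (simp add: indicator_def)
    qed simp
  qed
  have lin: "AE x in lborel. indicator {- R..R} x * (c * h x + d * k x)
      = c * (indicator {- R..R} x * h x) + d * (indicator {- R..R} x * k x)" for h k :: "real \<Rightarrow> real" and c d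
    by (simp add: algebra_simps)
  have cong: "AE x in lborel. indicator {- R..R} x * h x = indicator {- R..R} x * k x"
    if "h \<in> L1w a" "k \<in> L1w a" "AE x in lborel. h x = k x" for h k
    using that(3) by eventually_elim simp
  have bd: "L1w_norm a (\<lambda>x. indicator {- R..R} x * h x) \<le> 1 * L1w_norm a h" if "h \<in> L1w a" for h
    unfolding L1w_norm_def mult_1
    using D[OF that, THEN L1w_integrable_abs] L1w_integrable_abs[OF that]
    by (intro integral_mono) (auto simp: indicator_def)
  note L = lift_operator[OF D lin cong bd]
  show "bounded_linear (cut R)" unfolding cut_def[abs_def] by (rule L(1))
  show "cut R (to_l1 a h) = to_l1 a (\<lambda>x. indicator {- R..R} x * h x)" if "h \<in> L1w a"
    unfolding cut_def using L(2) that by blast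
  have "norm (cut R u) \<le> 1 * norm u" unfolding cut_def by (rule L(3))
  then show "norm (cut R u) \<le> norm u" by simp
  show "(\<lambda>x. indicator {- R..R} x * h x) \<in> L1w a" if "h \<in> L1w a" by (rule D[OF that])
qed

text \<open>Outside a large interval the adjoint weight is at most \<kappa> times the weight;
  inside, the crude bound costs a constant times the truncated norm.\<close>

lemma conv_op_norm_cut:
  assumes \<kappa>: "2 powr (1 - a) < \<kappa>"
  shows "\<exists>R>0. \<exists>C\<ge>0. \<forall>u. norm (conv_op a u) \<le> \<kappa> * norm u + C * norm (cut R u)"
proof -
  have a0: "0 \<le> a" using a by simp
  obtain R where R: "0 < R" "\<And>y. R < \<bar>y\<bar> \<Longrightarrow> conv_dual (weight a) y \<le> \<kappa> * weight a y"
    using conv_dual_weight_asymptotic[OF \<kappa>] by blast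
  define C where "C = 2 * (\<integral>z. H z * weight a z \<partial>lborel)"
  have C: "0 \<le> C" unfolding C_def by (simp add: integral_nonneg_AE)
  have \<kappa>0: "0 \<le> \<kappa>" using \<kappa> by (meson less_eq_real_def order_trans powr_ge_zero)
  have pt: "conv_dual (weight a) y \<le> \<kappa> * weight a y + C * (indicator {- R..R} y * weight a y)" for y
  proof (cases "R < \<bar>y\<bar>")
    case True
    then have "y \<notin> {- R..R}" by auto
    then show ?thesis using R(2)[OF True] by simp
  next
    case False
    then have "y \<in> {- R..R}" by auto
    moreover have "0 \<le> \<kappa> * weight a y" using \<kappa>0 by simp
    ultimately show ?thesis using conv_dual_weight_le[OF a0 a(2), of y] by (simp add: C_def)
  qed
  have "norm (conv_op a u) \<le> \<kappa> * norm u + C * norm (cut R u)" for u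
  proof -
    define h where "h = of_l1 a u"
    have h: "h \<in> L1w a" by (simp add: h_def)
    note i1 = L1w_integrable_abs[OF h] and i2 = L1w_integrable_abs[OF cut_in_L1w[OF h, of R]]
    have i2': "integrable lborel (\<lambda>y. indicator {- R..R} y * (\<bar>h y\<bar> * weight a y))"
      using i2 by (simp add: abs_mult mult.assoc)
    have "norm (conv_op a u) = L1w_norm a (conv h)"
      unfolding conv_op_def h_def by (rule norm_to_l1[OF conv_bound(1)[OF a0 a(2) of_l1_in_L1w]])
    also have "\<dots> \<le> (\<integral>y. \<bar>h y\<bar> * conv_dual (weight a) y \<partial>lborel)"
      by (rule conv_bound(2)[OF a0 a(2) h])
    also have "\<dots> \<le> (\<integral>y. \<kappa> * (\<bar>h y\<bar> * weight a y) + C * (indicator {- R..R} y * (\<bar>h y\<bar> * weight a y)) \<partial>lborel)"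
    proof (rule integral_mono)
      show "integrable lborel (\<lambda>y. \<bar>h y\<bar> * conv_dual (weight a) y)"
        using L1w_pairing(1)[OF L1w_abs[OF a0 a(2) h] conv_dual_measurable[OF a0 a(2) weight_measurable[of a]], of C]
          conv_dual_weight_le[OF a0 a(2)] conv_dual_nonneg[OF a0 a(2)] by (simp add: C_def)
      show "integrable lborel (\<lambda>y. \<kappa> * (\<bar>h y\<bar> * weight a y) + C * (indicator {- R..R} y * (\<bar>h y\<bar> * weight a y)))"
        by (intro Bochner_Integration.integrable_add integrable_mult_right i1 i2')
      show "\<bar>h y\<bar> * conv_dual (weight a) y \<le> \<kappa> * (\<bar>h y\<bar> * weight a y) + C * (indicator {- R..R} y * (\<bar>h y\<bar> * weight a y))" for y
        using mult_left_mono[OF pt[of y], of "\<bar>h y\<bar>"] by (simp add: algebra_simps)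
    qed
    also have "\<dots> = \<kappa> * (\<integral>y. \<bar>h y\<bar> * weight a y \<partial>lborel) + C * (\<integral>y. indicator {- R..R} y * (\<bar>h y\<bar> * weight a y) \<partial>lborel)"
      by (subst Bochner_Integration.integral_add)
        (simp_all only: integrable_mult_right i1 i2' integral_mult_right_zero)
    also have "(\<integral>y. \<bar>h y\<bar> * weight a y \<partial>lborel) = norm u"
      using norm_of_l1[of a u] by (simp add: L1w_norm_def h_def)
    also have "(\<integral>y. indicator {- R..R} y * (\<bar>h y\<bar> * weight a y) \<partial>lborel) = norm (cut R u)"
      unfolding cut_def h_def[symmetric] norm_to_l1[OF cut_in_L1w[OF h]] L1w_norm_def
      by (simp add: abs_mult mult.assoc)
    finally show ?thesis .
  qed
  with R(1) C show ?thesis by blast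
qed

text \<open>On a bounded interval the weighted norm is at most the supremum times the length 2 R and
  the largest weight, so \<open>conv_sup_bound\<close> applies.\<close>

lemma cut_dil_conv_bound:
  assumes "0 < R"
  shows "\<exists>L\<ge>0. \<forall>t u B. 0 \<le> t \<longrightarrow> (\<forall>\<xi>. norm (fourier a \<xi> u) \<le> B * \<bar>\<xi>\<bar> powr a)
    \<longrightarrow> norm (cut R (dil_op a t (conv_op a u))) \<le> L * exp (- (1 - a / 4) * t) * B"
proof -
  have a0: "0 \<le> a" "a \<le> 4" using a by auto
  define L0 where "L0 = 4 * (\<integral>\<xi>. H_hat \<xi> * \<bar>\<xi>\<bar> powr a \<partial>lborel)"
  have L0: "0 \<le> L0" unfolding L0_def by (simp add: integral_nonneg_AE)
  have "norm (cut R (dil_op a t (conv_op a u))) \<le> (2 * R * weight a R * L0) * exp (- (1 - a / 4) * t) * B"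
    if t: "0 \<le> t" and F: "\<And>\<xi>. norm (fourier a \<xi> u) \<le> B * \<bar>\<xi>\<bar> powr a" for t u B
  proof -
    define k where "k = dil t (conv (of_l1 a u))"
    have k: "k \<in> L1w a"
      unfolding k_def by (intro dil_in_L1w conv_bound(1) a0 a(2) of_l1_in_L1w)
    have B: "0 \<le> B" using order_trans[OF norm_ge_zero F[of 1]] by simp
    have "dil_op a t (conv_op a u) = to_l1 a k"
      unfolding conv_op_def k_def by (intro dil_op_to_l1 conv_bound(1) a0 a(2) of_l1_in_L1w)
    then have "norm (cut R (dil_op a t (conv_op a u))) = L1w_norm a (\<lambda>x. indicator {- R..R} x * k x)"
      using k by (simp add: cut_to_l1 norm_to_l1 cut_in_L1w)
    also have "\<dots> \<le> (\<integral>x. (exp (- (1 - a / 4) * t) * (L0 * B) * weight a R) * indicator {- R..R} x \<partial>lborel)"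
      unfolding L1w_norm_def
    proof (rule integral_mono)
      show "integrable lborel (\<lambda>x. \<bar>indicator {- R..R} x * k x\<bar> * weight a x)"
        by (rule L1w_integrable_abs[OF cut_in_L1w[OF k]])
      show "integrable lborel (\<lambda>x. (exp (- (1 - a / 4) * t) * (L0 * B) * weight a R) * indicator {- R..R} x)"
        by (intro integrable_mult_right integrable_real_indicator emeasure_bounded_finite) auto
      fix x
      show "\<bar>indicator {- R..R} x * k x\<bar> * weight a x \<le> (exp (- (1 - a / 4) * t) * (L0 * B) * weight a R) * indicator {- R..R} x"
      proof (cases "x \<in> {- R..R}")
        case True
        have "\<bar>k x\<bar> = exp (- t) * exp (- t / 4) * \<bar>conv (of_l1 a u) (exp (- t / 4) * x)\<bar>"
          by (simp add: k_def dil_def abs_mult)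
        also have "\<dots> \<le> exp (- t) * exp (- t / 4) * (L0 * B)"
          unfolding L0_def by (intro mult_left_mono conv_sup_bound F) auto
        \<comment> \<open>The supremum of a dilated function decays like exp (- 5 t / 4), which is
          faster than the required rate 1 - a / 4.\<close>
        also have "\<dots> \<le> exp (- (1 - a / 4) * t) * (L0 * B)"
        proof (rule mult_right_mono)
          have "exp (- t) * exp (- t / 4) = exp (- t - t / 4)" by (simp flip: exp_add)
          also have "\<dots> \<le> exp (- (1 - a / 4) * t)"
          proof -
            have "- (1 - a / 4) * t = - t + a * t / 4" by (simp add: algebra_simps)
            moreover have "0 \<le> a * t" using t a0(1) by (rule mult_nonneg_nonneg[rotated])
            ultimately have "- t - t / 4 \<le> - (1 - a / 4) * t" using t by linarith
            then show ?thesis by simp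
          qed
          finally show "exp (- t) * exp (- t / 4) \<le> exp (- (1 - a / 4) * t)" .
        qed (use L0 B in simp)
        finally have "\<bar>k x\<bar> * weight a x \<le> exp (- (1 - a / 4) * t) * (L0 * B) * weight a R"
          using True L0 B by (intro mult_mono weight_mono a0) auto
        then show ?thesis using True by (simp add: abs_mult)
      qed simp
    qed
    also have "\<dots> = (2 * R * weight a R * L0) * exp (- (1 - a / 4) * t) * B"
      using assms unfolding integral_mult_right_zero by simp
    finally show ?thesis .
  qed
  moreover have "0 \<le> 2 * R * weight a R * L0" using assms L0 by simp
  ultimately show ?thesis by blast
qed

end

section \<open>The generator of the dilation group\<close>

text \<open>The derivative selected by choice comes with local integrability only; its measurability
  follows from that of its truncations.\<close>

lemma locally_integrable_measurable:
  assumes "locally_integrable f"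
  shows "f \<in> borel_measurable borel"
proof (rule borel_measurable_LIMSEQ_real)
  show "(\<lambda>x. indicator {- real n..real n} x *\<^sub>R f x) \<in> borel_measurable borel" for n
  proof -
    have "integrable lborel (\<lambda>x. indicator {- real n..real n} x *\<^sub>R f x)"
      using assms compact_Icc[of "- real n" "real n"]
      unfolding locally_integrable_def set_integrable_def by blast
    from borel_measurable_integrable[OF this] show ?thesis by simp
  qed
  fix x :: real
  obtain N where "\<bar>x\<bar> \<le> real N" using real_arch_simple by blast
  then have "\<forall>\<^sub>F n in sequentially. indicator {- real n..real n} x *\<^sub>R f x = f x"
    unfolding eventually_sequentially by (intro exI[of _ N]) (auto simp: indicator_def)
  then show "(\<lambda>n. indicator {- real n..real n} x *\<^sub>R f x) \<longlonglongrightarrow> f x"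
    by (rule tendsto_eventually)
qed

lemma integrable_locally_integrable:
  assumes "integrable lborel f"
  shows "locally_integrable f"
  unfolding locally_integrable_def set_integrable_def
proof (intro allI impI)
  fix K :: "real set" assume "compact K"
  then have "K \<in> sets lborel" by (simp add: borel_compact)
  then show "integrable lborel (\<lambda>x. indicator K x *\<^sub>R f x)"
    using assms by (rule integrable_mult_indicator)
qed

lemma locally_integrable_diff:
  "locally_integrable f \<Longrightarrow> locally_integrable g \<Longrightarrow> locally_integrable (\<lambda>x. f x - g x)"
  unfolding locally_integrable_def by (auto intro: set_integral_diff)

lemma locally_integrable_times_test:
  assumes f: "locally_integrable f" and \<phi>: "test_function \<phi>"
  shows "integrable lborel (\<lambda>x. f x * \<phi> x)"
proof -
  obtain R where R: "\<And>x. R < \<bar>x\<bar> \<Longrightarrow> \<phi> x = 0" using test_function_support[OF \<phi>] by metis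
  obtain B where B: "\<And>x. \<bar>\<phi> x\<bar> \<le> B" using test_function_bounded[OF \<phi>] by metis
  note [measurable] = locally_integrable_measurable[OF f] test_function_measurable(1)[OF \<phi>]
  have "integrable lborel (\<lambda>x. B * (indicator {- R..R} x *\<^sub>R f x))"
    using f compact_Icc[of "- R" R] by (auto simp: locally_integrable_def set_integrable_def)
  then show ?thesis
  proof (rule Bochner_Integration.integrable_bound)
    show "AE x in lborel. norm (f x * \<phi> x) \<le> norm (B * (indicator {- R..R} x *\<^sub>R f x))"
    proof (rule AE_I2)
      fix x
      show "norm (f x * \<phi> x) \<le> norm (B * (indicator {- R..R} x *\<^sub>R f x))"
      proof (cases "R < \<bar>x\<bar>")
        case False
        then have "x \<in> {- R..R}" by auto
        then show ?thesis using mult_left_mono[OF order_trans[OF B[of x] abs_ge_self], of "\<bar>f x\<bar>"]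
          by (simp add: abs_mult mult.commute)
      qed (simp add: R)
    qed
  qed measurable
qed

text \<open>Makes the representative chosen in \<open>Lop\<close> agree almost everywhere with one
  known to lie in the weighted space.\<close>

lemma has_distr_deriv_unique:
  assumes "has_distr_deriv f g" "has_distr_deriv f g'"
  shows "AE x in lborel. g x = g' x"
proof -
  have l: "locally_integrable g" "locally_integrable g'"
    using assms unfolding has_distr_deriv_def by blast+
  have "AE x in lborel. g x - g' x = 0"
  proof (rule locally_integrable_zero_AE)
    show d: "locally_integrable (\<lambda>x. g x - g' x)" by (rule locally_integrable_diff[OF l])
    show "(\<lambda>x. g x - g' x) \<in> borel_measurable borel" by (rule locally_integrable_measurable[OF d])
    fix \<phi> assume \<phi>: "test_function \<phi>"
    have "(\<integral>x. f x * deriv \<phi> x \<partial>lborel) = - (\<integral>x. g x * \<phi> x \<partial>lborel)"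
      "(\<integral>x. f x * deriv \<phi> x \<partial>lborel) = - (\<integral>x. g' x * \<phi> x \<partial>lborel)"
      using assms \<phi> unfolding has_distr_deriv_def by blast+
    then show "(\<integral>x. (g x - g' x) * \<phi> x \<partial>lborel) = 0"
      using locally_integrable_times_test[OF l(1) \<phi>] locally_integrable_times_test[OF l(2) \<phi>]
      by (simp add: left_diff_distrib)
  qed
  then show ?thesis by eventually_elim simp
qed

text \<open>A bound for the difference quotients of the dilation factor, uniform for bounded
  times.\<close>

lemma abs_exp_minus_1_le: "\<bar>exp u - 1\<bar> \<le> \<bar>u\<bar> * exp \<bar>u\<bar>" for u :: real
proof (cases "0 \<le> u")
  case True
  have "(1 - u) * exp u \<le> exp (- u) * exp u"
    using exp_ge_add_one_self[of "- u"] by (intro mult_right_mono) auto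
  also have "exp (- u) * exp u = 1" by (simp flip: exp_add)
  finally have "exp u - 1 \<le> u * exp u" by (simp add: left_diff_distrib)
  then show ?thesis using True by simp
next
  case False
  have "1 - exp u \<le> - u" using exp_ge_add_one_self[of u] by linarith
  also have "\<dots> \<le> - u * exp (- u)" using False by (simp add: mult_le_cancel_left1)
  finally show ?thesis using False by simp
qed

context
  fixes a :: real
  assumes a: "2 < a" "a < 3"
begin

lemma weight_exponent_bounds: "0 \<le> a" "a \<le> 4"
  using a by auto

lemma test_function_weight:
  assumes "test_function \<phi>"
  obtains B where "\<And>x. norm (\<phi> x) \<le> B * weight a x"
proof -
  obtain B where B: "0 \<le> B" "\<And>x. \<bar>\<phi> x\<bar> \<le> B" using test_function_bounded[OF assms] by metis
  have "norm (\<phi> x) \<le> B * weight a x" for x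
    using order_trans[OF B(2) mult_left_mono[OF weight_ge_1[OF weight_exponent_bounds(1), of x] B(1), unfolded mult_1_right]] by simp
  then show thesis by (rule that)
qed

lemma pairing_test_linear:
  assumes \<phi>: "test_function \<phi>"
  shows "bounded_linear (pairing a \<phi>)"
    and "h \<in> L1w a \<Longrightarrow> pairing a \<phi> (to_l1 a h) = (\<integral>x. h x * \<phi> x \<partial>lborel)"
proof -
  obtain B where B: "\<And>x. norm (\<phi> x) \<le> B * weight a x" using test_function_weight[OF \<phi>] by metis
  note L = pairing_linear[OF test_function_measurable(1)[OF \<phi>] B]
  show "bounded_linear (pairing a \<phi>)" by (rule L(1))
  show "h \<in> L1w a \<Longrightarrow> pairing a \<phi> (to_l1 a h) = (\<integral>x. h x * \<phi> x \<partial>lborel)" by (simp add: L(2))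
qed

text \<open>Test functions separate the points of \<open>l1\<close>, so identities between vectors
  may be checked weakly.\<close>

lemma pairing_test_eq_0:
  assumes "\<And>\<phi>. test_function \<phi> \<Longrightarrow> pairing a \<phi> u = 0"
  shows "u = 0"
proof -
  have "AE x in lborel. of_l1 a u x = 0"
  proof (rule locally_integrable_zero_AE)
    show "locally_integrable (of_l1 a u)"
      by (intro integrable_locally_integrable L1w_integrable_1[OF weight_exponent_bounds(1) a(2)] of_l1_in_L1w)
    show "(\<integral>x. of_l1 a u x * \<phi> x \<partial>lborel) = 0" if "test_function \<phi>" for \<phi>
      using assms[OF that] by (simp add: pairing_def)
  qed measurable
  then have "to_l1 a (of_l1 a u) = to_l1 a (\<lambda>x. 0 * of_l1 a u x + 0 * of_l1 a u x)"
    by (intro to_l1_cong of_l1_in_L1w L1w_lincomb) (auto elim: eventually_mono)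
  then show ?thesis unfolding to_l1_lincomb[OF of_l1_in_L1w of_l1_in_L1w] by simp
qed

lemma x_of_l1_integrable: "integrable lborel (\<lambda>x. x * of_l1 a u x)"
  using of_l1_power_integrable[OF a, of 1 u] by (simp add: mult.commute)

text \<open>Differentiation under the integral: \<phi> is Lipschitz, so the quotients are dominated
  by a multiple of |x h|, which is integrable because the weight dominates |x|. The derivative falls
  on \<phi>, so no regularity of h is involved.\<close>

lemma dil_pairing_deriv_0:
  assumes \<phi>: "test_function \<phi>"
  shows "((\<lambda>t. pairing a (\<lambda>x. \<phi> (exp (t / 4) * x)) u) has_real_derivative
    (1 / 4) * (\<integral>x. (x * of_l1 a u x) * deriv \<phi> x \<partial>lborel)) (at 0)"
  unfolding has_field_derivative_iff tendsto_at_iff_sequentially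
proof (intro allI impI)
  fix X :: "nat \<Rightarrow> real" assume X: "\<forall>i. X i \<in> UNIV - {0}" "X \<longlonglongrightarrow> 0"
  note [measurable] = test_function_measurable[OF \<phi>]
  define h where "h = of_l1 a u"
  have [measurable]: "h \<in> borel_measurable borel" by (simp add: h_def)
  obtain B where B: "0 \<le> B" "\<And>x. \<bar>deriv \<phi> x\<bar> \<le> B" using test_function_bounded[OF \<phi>] by metis
  obtain M where M: "\<And>i. \<bar>X i\<bar> \<le> M"
    using convergent_imp_bounded[OF X(2)] by (auto simp: bounded_iff)
  have int: "integrable lborel (\<lambda>x. h x * \<phi> (exp (s / 4) * x))" for s
    unfolding h_def
    by (intro locally_integrable_times_test test_function_scale[OF \<phi>] integrable_locally_integrable
        L1w_integrable_1[OF weight_exponent_bounds(1) a(2)] of_l1_in_L1w) simp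
  have eq: "((\<lambda>y. (pairing a (\<lambda>x. \<phi> (exp (y / 4) * x)) u - pairing a (\<lambda>x. \<phi> (exp (0 / 4) * x)) u) / (y - 0)) \<circ> X) i
    = (\<integral>x. h x * ((\<phi> (exp (X i / 4) * x) - \<phi> x) / X i) \<partial>lborel)" for i
    using int[of "X i"] int[of 0]
    by (simp add: pairing_def h_def[symmetric] right_diff_distrib diff_divide_distrib)
  have fun_eq: "(\<lambda>y. (pairing a (\<lambda>x. \<phi> (exp (y / 4) * x)) u - pairing a (\<lambda>x. \<phi> (exp (0 / 4) * x)) u) / (y - 0)) \<circ> X
    = (\<lambda>i. \<integral>x. h x * ((\<phi> (exp (X i / 4) * x) - \<phi> x) / X i) \<partial>lborel)"
    by (rule ext) (rule eq)
  have lip: "\<bar>\<phi> x - \<phi> y\<bar> \<le> B * \<bar>x - y\<bar>" for x y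
    using field_differentiable_bound[of UNIV \<phi> "deriv \<phi>" B x y] B test_function_DERIV[OF \<phi>] by auto
  have "(\<lambda>i. \<integral>x. h x * ((\<phi> (exp (X i / 4) * x) - \<phi> x) / X i) \<partial>lborel)
    \<longlonglongrightarrow> (\<integral>x. h x * (1 / 4 * x * deriv \<phi> x) \<partial>lborel)"
  proof (rule Bochner_Integration.integral_dominated_convergence)
    show "integrable lborel (\<lambda>x. B * exp M * \<bar>x * h x\<bar>)"
      unfolding h_def by (intro integrable_mult_right integrable_abs x_of_l1_integrable)
    show "AE x in lborel. norm (h x * ((\<phi> (exp (X i / 4) * x) - \<phi> x) / X i)) \<le> B * exp M * \<bar>x * h x\<bar>" for i
    proof (rule AE_I2)
      fix x
      have "\<bar>exp (X i / 4) - 1\<bar> \<le> \<bar>X i / 4\<bar> * exp \<bar>X i / 4\<bar>" by (rule abs_exp_minus_1_le)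
      also have "\<dots> \<le> \<bar>X i\<bar> * exp M"
        using M[of i] by (intro mult_mono) auto
      finally have e: "\<bar>exp (X i / 4) - 1\<bar> \<le> \<bar>X i\<bar> * exp M" .
      have "\<bar>\<phi> (exp (X i / 4) * x) - \<phi> x\<bar> \<le> B * \<bar>exp (X i / 4) * x - x\<bar>" by (rule lip)
      also have "\<bar>exp (X i / 4) * x - x\<bar> = \<bar>exp (X i / 4) - 1\<bar> * \<bar>x\<bar>"
        by (simp add: left_diff_distrib flip: abs_mult)
      also have "B * (\<bar>exp (X i / 4) - 1\<bar> * \<bar>x\<bar>) \<le> B * ((\<bar>X i\<bar> * exp M) * \<bar>x\<bar>)"
        using B(1) e by (intro mult_left_mono mult_right_mono) auto
      finally have "\<bar>\<phi> (exp (X i / 4) * x) - \<phi> x\<bar> / \<bar>X i\<bar> \<le> B * exp M * \<bar>x\<bar>"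
        using X(1) by (simp add: divide_le_eq ac_simps)
      from mult_left_mono[OF this, of "\<bar>h x\<bar>"]
      show "norm (h x * ((\<phi> (exp (X i / 4) * x) - \<phi> x) / X i)) \<le> B * exp M * \<bar>x * h x\<bar>"
        by (simp add: abs_mult ac_simps)
    qed
    show "AE x in lborel. (\<lambda>i. h x * ((\<phi> (exp (X i / 4) * x) - \<phi> x) / X i)) \<longlonglongrightarrow> h x * (1 / 4 * x * deriv \<phi> x)"
    proof (rule AE_I2)
      fix x
      have "((\<lambda>t. \<phi> (exp (t / 4) * x)) has_real_derivative deriv \<phi> (exp (0 / 4) * x) * (exp (0 / 4) * (1 / 4) * x)) (at 0)"
        by (rule DERIV_chain2[OF test_function_DERIV[OF \<phi>]]) (auto intro!: derivative_eq_intros)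
      then have "((\<lambda>t. (\<phi> (exp (t / 4) * x) - \<phi> x) / t) \<longlongrightarrow> 1 / 4 * x * deriv \<phi> x) (at 0)"
        by (simp add: has_field_derivative_iff ac_simps)
      then have "(\<lambda>i. (\<phi> (exp (X i / 4) * x) - \<phi> x) / X i) \<longlonglongrightarrow> 1 / 4 * x * deriv \<phi> x"
        unfolding tendsto_at_iff_sequentially using X by (auto simp: o_def)
      then show "(\<lambda>i. h x * ((\<phi> (exp (X i / 4) * x) - \<phi> x) / X i)) \<longlonglongrightarrow> h x * (1 / 4 * x * deriv \<phi> x)"
        by (rule tendsto_mult_left)
    qed
  qed measurable
  moreover have "(\<integral>x. h x * (1 / 4 * x * deriv \<phi> x) \<partial>lborel) = (1 / 4) * (\<integral>x. (x * h x) * deriv \<phi> x \<partial>lborel)"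
    unfolding integral_mult_right_zero[symmetric] by (simp add: ac_simps)
  ultimately show "((\<lambda>y. (pairing a (\<lambda>x. \<phi> (exp (y / 4) * x)) u - pairing a (\<lambda>x. \<phi> (exp (0 / 4) * x)) u) / (y - 0)) \<circ> X)
    \<longlonglongrightarrow> (1 / 4) * (\<integral>x. (x * of_l1 a u x) * deriv \<phi> x \<partial>lborel)"
    unfolding h_def[symmetric] by (simp only: fun_eq)
qed

lemma pairing_dil_op_test:
  assumes \<phi>: "test_function \<phi>"
  shows "pairing a \<phi> (dil_op a t u) = exp (- t) * pairing a (\<lambda>x. \<phi> (exp (t / 4) * x)) u"
proof -
  obtain B where "\<And>x. norm (\<phi> x) \<le> B * weight a x" using test_function_weight[OF \<phi>] by metis
  from dil_op_pairing[OF weight_exponent_bounds(1) test_function_measurable(1)[OF \<phi>] this] show ?thesis by simp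
qed

lemma pairing_dil_op_deriv_0:
  assumes \<phi>: "test_function \<phi>"
  shows "((\<lambda>t. pairing a \<phi> (dil_op a t u)) has_real_derivative
    (1 / 4) * (\<integral>x. (x * of_l1 a u x) * deriv \<phi> x \<partial>lborel) - pairing a \<phi> u) (at 0)"
  unfolding pairing_dil_op_test[OF \<phi>]
  by (rule derivative_eq_intros dil_pairing_deriv_0[OF \<phi>] refl)+ simp

lemma pairing_of_to_l1:
  assumes "h \<in> L1w a" "f \<in> borel_measurable borel"
  shows "(\<integral>x. (x * of_l1 a (to_l1 a h) x) * f x \<partial>lborel) = (\<integral>x. (x * h x) * f x \<partial>lborel)"
proof (rule integral_cong_AE)
  note [measurable] = L1w_measurable[OF assms(1)] assms(2)
  show "(\<lambda>x. x * of_l1 a (to_l1 a h) x * f x) \<in> borel_measurable lborel"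
    "(\<lambda>x. x * h x * f x) \<in> borel_measurable lborel" by measurable
  show "AE x in lborel. x * of_l1 a (to_l1 a h) x * f x = x * h x * f x"
    using of_to_l1[OF assms(1)] by eventually_elim simp
qed

text \<open>If the quotients converge to v, comparing with the weak derivative gives v = - 1 / 4 (x
  h)' - h as distributions; solving for (x h)' yields the witness - 4 v - 4 h.\<close>

lemma dil_op_generator_distr_deriv:
  assumes h: "h \<in> L1w a"
    and lim: "((\<lambda>t. (dil_op a t (to_l1 a h) - to_l1 a h) /\<^sub>R t) \<longlongrightarrow> v) (at_right 0)"
  shows "\<exists>g\<in>L1w a. has_distr_deriv (\<lambda>x. x * h x) g"
proof -
  define u where "u = to_l1 a h"
  define g where "g x = (- 4) * of_l1 a v x + (- 4) * h x" for x
  have g: "g \<in> L1w a" unfolding g_def by (intro L1w_lincomb of_l1_in_L1w h)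
  have to_g: "to_l1 a g = (- 4) *\<^sub>R v + (- 4) *\<^sub>R u"
    unfolding g_def to_l1_lincomb[OF of_l1_in_L1w h] u_def by simp
  have "has_distr_deriv (\<lambda>x. x * h x) g"
    unfolding has_distr_deriv_def
  proof (intro conjI allI impI integrable_locally_integrable)
    show "integrable lborel (\<lambda>x. x * h x)"
      using L1w_pairing(1)[OF h, of "\<lambda>x. x" 1] power_weight[OF a, of 1] by (simp add: mult.commute)
    show "integrable lborel g" by (rule L1w_integrable_1[OF weight_exponent_bounds(1) a(2) g])
    fix \<phi> assume \<phi>: "test_function \<phi>"
    interpret \<phi>: bounded_linear "pairing a \<phi>" by (rule pairing_test_linear(1)[OF \<phi>])
    have "((\<lambda>t. pairing a \<phi> ((dil_op a t u - u) /\<^sub>R t)) \<longlongrightarrow> pairing a \<phi> v) (at_right 0)"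
      unfolding u_def by (rule \<phi>.tendsto[OF lim])
    moreover have "((\<lambda>t. (pairing a \<phi> (dil_op a t u) - pairing a \<phi> (dil_op a 0 u)) / (t - 0)) \<longlongrightarrow>
        (1 / 4) * (\<integral>x. (x * of_l1 a u x) * deriv \<phi> x \<partial>lborel) - pairing a \<phi> u) (at_right 0)"
      using pairing_dil_op_deriv_0[OF \<phi>, of u] unfolding has_field_derivative_iff
      by (rule tendsto_mono[OF at_le, rotated]) simp
    moreover have "(pairing a \<phi> (dil_op a t u) - pairing a \<phi> (dil_op a 0 u)) / (t - 0) = pairing a \<phi> ((dil_op a t u - u) /\<^sub>R t)" for t
      by (simp add: \<phi>.scaleR \<phi>.diff dil_op_zero divide_inverse mult.commute)
    ultimately have "pairing a \<phi> v = (1 / 4) * (\<integral>x. (x * of_l1 a u x) * deriv \<phi> x \<partial>lborel) - pairing a \<phi> u"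
      by (auto intro: tendsto_unique[OF trivial_limit_at_right_real])
    then have "(\<integral>x. (x * h x) * deriv \<phi> x \<partial>lborel) = - pairing a \<phi> (to_l1 a g)"
      unfolding to_g pairing_of_to_l1[OF h test_function_measurable(2)[OF \<phi>], folded u_def, symmetric]
      by (simp add: \<phi>.add \<phi>.diff \<phi>.neg \<phi>.scaleR)
    then show "(\<integral>x. (x * h x) * deriv \<phi> x \<partial>lborel) = - (\<integral>x. g x * \<phi> x \<partial>lborel)"
      by (simp add: pairing_test_linear(2)[OF \<phi> g])
  qed
  with g show ?thesis by blast
qed

lemma perturbed_group_dil_op:
  assumes "bounded_linear K"
  shows "perturbed_group (dil_op a) K 1"
proof (rule perturbed_group.intro)
  show "bounded_linear (dil_op a t)" for t by (rule dil_op_linear[OF weight_exponent_bounds])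
  show "dil_op a 0 u = u" for u by (rule dil_op_zero)
  show "dil_op a (s + t) u = dil_op a s (dil_op a t u)" for s t u by (rule dil_op_add[OF weight_exponent_bounds])
  show "norm (dil_op a t u) \<le> exp (1 * \<bar>t\<bar>) * norm u" for t u
    unfolding mult_1 by (rule dil_op_growth[OF weight_exponent_bounds])
  show "((\<lambda>t. dil_op a t u) \<longlongrightarrow> u) (at 0)" for u by (rule dil_op_tendsto_0[OF weight_exponent_bounds])
  show "bounded_linear K" by (rule assms)
  show "0 \<le> (1 :: real)" by simp
qed

text \<open>The converse: with v the expected derivative, \<open>dil_op a t u - u\<close> is the
  integral of \<open>dil_op a s v\<close>. Against a test function this is the ordinary fundamental
  theorem; dividing by t then gives convergence in norm.\<close>

lemma distr_deriv_dil_op_generator: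
  assumes h: "h \<in> L1w a" and g: "g \<in> L1w a" and d: "has_distr_deriv (\<lambda>x. x * h x) g"
  shows "((\<lambda>t. (dil_op a t (to_l1 a h) - to_l1 a h) /\<^sub>R t) \<longlongrightarrow> - (1 / 4) *\<^sub>R to_l1 a g - to_l1 a h) (at_right 0)"
proof -
  \<comment> \<open>The zero perturbation suffices here: only the continuity of the group is taken
    from the locale.\<close>
  interpret P: perturbed_group "dil_op a" "\<lambda>_. 0" 1
    by (rule perturbed_group_dil_op) (rule bounded_linear_zero)
  define u where "u = to_l1 a h"
  define v where "v = - (1 / 4) *\<^sub>R to_l1 a g - u"
  have cont: "continuous_on S (\<lambda>s. dil_op a s v)" for S
    by (intro P.T_continuous_on continuous_intros)
  have eq: "dil_op a t u - u = integral {0..t} (\<lambda>s. dil_op a s v)" if t: "0 \<le> t" for t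
  proof -
    have "dil_op a t u - u - integral {0..t} (\<lambda>s. dil_op a s v) = 0"
    proof (rule pairing_test_eq_0)
      fix \<phi> assume \<phi>: "test_function \<phi>"
      interpret \<phi>: bounded_linear "pairing a \<phi>" by (rule pairing_test_linear(1)[OF \<phi>])
      have D: "((\<lambda>t. pairing a \<phi> (dil_op a t u)) has_real_derivative pairing a \<phi> (dil_op a s v)) (at s)" for s
      proof -
        \<comment> \<open>The group law moves the derivative at time s to time 0, at the price of a
          rescaled test function.\<close>
        define \<phi>s where "\<phi>s x = \<phi> (exp (s / 4) * x)" for x
        have \<phi>s: "test_function \<phi>s" unfolding \<phi>s_def by (rule test_function_scale[OF \<phi>]) simp
        interpret \<phi>s: bounded_linear "pairing a \<phi>s" by (rule pairing_test_linear(1)[OF \<phi>s])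
        have c: "pairing a \<phi> (dil_op a (s + r) w) = exp (- s) * pairing a \<phi>s (dil_op a r w)" for r w
          unfolding dil_op_add[OF weight_exponent_bounds] \<phi>s_def by (rule pairing_dil_op_test[OF \<phi>])
        have "(\<integral>x. (x * of_l1 a u x) * deriv \<phi>s x \<partial>lborel) = - pairing a \<phi>s (to_l1 a g)"
          using d \<phi>s unfolding u_def pairing_of_to_l1[OF h test_function_measurable(2)[OF \<phi>s]]
            pairing_test_linear(2)[OF \<phi>s g] has_distr_deriv_def by blast
        then have "(1 / 4) * (\<integral>x. (x * of_l1 a u x) * deriv \<phi>s x \<partial>lborel) - pairing a \<phi>s u = pairing a \<phi>s v"
          by (simp add: v_def \<phi>s.diff \<phi>s.scaleR \<phi>s.neg)
        then have "((\<lambda>r. exp (- s) * pairing a \<phi>s (dil_op a r u)) has_real_derivative exp (- s) * pairing a \<phi>s v) (at 0)"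
          using pairing_dil_op_deriv_0[OF \<phi>s, of u] by (intro DERIV_cmult) simp
        then have "((\<lambda>r. pairing a \<phi> (dil_op a (s + r) u)) has_real_derivative pairing a \<phi> (dil_op a s v)) (at 0)"
          using c[of 0 v] by (simp add: c dil_op_zero)
        then show ?thesis
          using DERIV_shift[of "\<lambda>t. pairing a \<phi> (dil_op a t u)" "pairing a \<phi> (dil_op a s v)" 0 s]
          by (simp add: add.commute)
      qed
      have "((\<lambda>s. pairing a \<phi> (dil_op a s v)) has_integral
          pairing a \<phi> (dil_op a t u) - pairing a \<phi> (dil_op a 0 u)) {0..t}"
        using D t by (intro fundamental_theorem_of_calculus)
          (auto simp: has_real_derivative_iff_has_vector_derivative[symmetric] intro: has_field_derivative_at_within)
      then have "integral {0..t} (\<lambda>s. pairing a \<phi> (dil_op a s v)) = pairing a \<phi> (dil_op a t u) - pairing a \<phi> u"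
        by (simp add: integral_unique dil_op_zero)
      moreover have "integral {0..t} (\<lambda>s. pairing a \<phi> (dil_op a s v)) = pairing a \<phi> (integral {0..t} (\<lambda>s. dil_op a s v))"
        using integral_linear[OF integrable_continuous_real[OF cont] pairing_test_linear(1)[OF \<phi>]] by (simp add: o_def)
      ultimately show "pairing a \<phi> (dil_op a t u - u - integral {0..t} (\<lambda>s. dil_op a s v)) = 0"
        by (simp add: \<phi>.diff)
    qed
    then show ?thesis by simp
  qed
  have "((\<lambda>t. integral {0..t} (\<lambda>s. dil_op a s v) /\<^sub>R t) \<longlongrightarrow> dil_op a 0 v) (at_right 0)"
    by (rule integral_average_tendsto[OF cont])
  moreover have "\<forall>\<^sub>F t in at_right 0. integral {0..t} (\<lambda>s. dil_op a s v) /\<^sub>R t = (dil_op a t u - u) /\<^sub>R t"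
    unfolding eventually_at_right_field using eq by (intro exI[of _ 1]) auto
  ultimately show ?thesis
    unfolding u_def[symmetric] v_def[symmetric] by (auto simp: dil_op_zero intro: Lim_transform_eventually)
qed

lemma Y0_iff: "h \<in> L1w a \<Longrightarrow> h \<in> Y0 a \<longleftrightarrow> moments a (to_l1 a h) = 0"
  by (simp add: Y0_def moments_eq_0_iff moment_to_l1[OF a])

lemma of_l1_in_Y0: "of_l1 a u \<in> Y0 a \<longleftrightarrow> moments a u = 0"
  by (simp add: Y0_iff)

end

section \<open>The semigroup\<close>

context
  fixes a :: real
  assumes a: "2 < a" "a < 3"
begin

interpretation P: perturbed_group "dil_op a" "conv_op a" 1
  using a by (intro perturbed_group_dil_op conv_op_linear) auto

text \<open>The semigroup on \<open>l1\<close> carried back to functions; the result is a particular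
  representative, hence the semigroup laws hold almost everywhere.\<close>

definition evolution :: "real \<Rightarrow> (real \<Rightarrow> real) \<Rightarrow> real \<Rightarrow> real" where
  "evolution t h = of_l1 a (P.U t (to_l1 a h))"

lemma Y0_L1w: "h \<in> Y0 a \<Longrightarrow> h \<in> L1w a"
  by (simp add: Y0_def)

lemma moments_U: "moments a u = 0 \<Longrightarrow> 0 \<le> t \<Longrightarrow> moments a (P.U t u) = 0"
  by (rule P.U_in_kernel[OF moments_linear[OF a] moments_dil_op[OF a] moments_conv_op[OF a]])

lemma L1w_norm_diff:
  assumes "h \<in> L1w a" "k \<in> L1w a"
  shows "L1w_norm a (\<lambda>x. h x - k x) = norm (to_l1 a h - to_l1 a k)"
  using norm_to_l1[OF L1w_lincomb[OF assms, of 1 "- 1"]] to_l1_lincomb[OF assms, of 1 "- 1"] by simp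

lemma evolution_strongly_continuous: "strongly_continuous_semigroup (Y0 a) (L1w_norm a) evolution"
  unfolding strongly_continuous_semigroup_def
proof (intro conjI allI impI ballI)
  fix t :: real and h assume "0 \<le> t" "h \<in> Y0 a"
  then show "evolution t h \<in> Y0 a"
    unfolding evolution_def of_l1_in_Y0[OF a] by (intro moments_U) (simp_all add: Y0_iff[OF a] Y0_L1w flip: Y0_iff[OF a Y0_L1w])
next
  fix t c d :: real and h k assume t: "0 \<le> t" and "h \<in> Y0 a" "k \<in> Y0 a"
  then have "P.U t (to_l1 a (\<lambda>y. c * h y + d * k y)) = c *\<^sub>R P.U t (to_l1 a h) + d *\<^sub>R P.U t (to_l1 a k)"
    by (simp add: to_l1_lincomb Y0_L1w P.U_lincomb)
  then show "AE x in lborel. evolution t (\<lambda>y. c * h y + d * k y) x = c * evolution t h x + d * evolution t k x"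
    unfolding evolution_def by (simp only: of_l1_lincomb)
next
  fix t :: real assume t: "0 \<le> t"
  show "\<exists>M. \<forall>h\<in>Y0 a. L1w_norm a (evolution t h) \<le> M * L1w_norm a h"
    using P.U_bound[OF t] by (auto simp: evolution_def norm_of_l1 norm_to_l1[OF Y0_L1w, symmetric])
next
  fix h assume "h \<in> Y0 a"
  then show "AE x in lborel. evolution 0 h x = h x"
    unfolding evolution_def P.U_0 by (intro of_to_l1 Y0_L1w)
next
  fix s t :: real and h assume "0 \<le> s" "0 \<le> t"
  then show "AE x in lborel. evolution (s + t) h x = evolution s (evolution t h) x"
    by (simp add: evolution_def P.U_add)
next
  fix h and t :: real assume t: "0 \<le> t"
  have "((\<lambda>s. P.U s (to_l1 a h) - P.U t (to_l1 a h)) \<longlongrightarrow> 0) (at t within {0..})"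
    using P.U_continuous[of "to_l1 a h"] t by (auto simp: continuous_on_def LIM_zero_iff)
  then show "((\<lambda>s. L1w_norm a (\<lambda>x. evolution s h x - evolution t h x)) \<longlongrightarrow> 0) (at t within {0..})"
    unfolding evolution_def L1w_norm_diff[OF of_l1_in_L1w of_l1_in_L1w] to_of_l1
    by (rule tendsto_norm_zero)
qed

text \<open>Combines the passage to \<open>l1\<close> with \<open>U_generator\<close>: generator
  values of the evolution are those of the dilations, shifted by \<open>K\<close>.\<close>

lemma has_generator_value_iff:
  assumes h: "h \<in> L1w a" and g: "g \<in> L1w a"
  shows "has_generator_value (L1w_norm a) evolution h g \<longleftrightarrow>
    ((\<lambda>t. (dil_op a t (to_l1 a h) - to_l1 a h) /\<^sub>R t) \<longlongrightarrow> to_l1 a g - conv_op a (to_l1 a h)) (at_right 0)"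
proof -
  have "L1w_norm a (\<lambda>x. (evolution t h x - h x) / t - g x)
    = norm ((P.U t (to_l1 a h) - to_l1 a h) /\<^sub>R t - to_l1 a g)" for t
  proof -
    have "(\<lambda>x. (evolution t h x - h x) / t) = (\<lambda>x. inverse t * evolution t h x + (- inverse t) * h x)"
      by (simp add: fun_eq_iff divide_inverse algebra_simps)
    moreover have "evolution t h \<in> L1w a" by (simp add: evolution_def)
    moreover have "to_l1 a (evolution t h) = P.U t (to_l1 a h)" by (simp add: evolution_def)
    ultimately have "(\<lambda>x. (evolution t h x - h x) / t) \<in> L1w a"
      "to_l1 a (\<lambda>x. (evolution t h x - h x) / t) = (P.U t (to_l1 a h) - to_l1 a h) /\<^sub>R t"
      using h by (simp_all only: L1w_lincomb to_l1_lincomb) (simp add: scaleR_diff_right)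
    then show ?thesis using L1w_norm_diff[OF _ g] by simp
  qed
  then show ?thesis
    unfolding has_generator_value_def by (simp add: tendsto_norm_zero_iff LIM_zero_iff P.U_generator)
qed

text \<open>The dilation part of the operator is differentiated in norm by
  \<open>distr_deriv_dil_op_generator\<close>, and \<open>Q0_eq_conv\<close> accounts for the
  rest.\<close>

lemma dom_L_generator:
  assumes "h \<in> dom_L a"
  shows "h \<in> Y0 a" "Lop h \<in> Y0 a" "has_generator_value (L1w_norm a) evolution h (Lop h)"
    and "((\<lambda>t. (P.U t (to_l1 a h) - to_l1 a h) /\<^sub>R t) \<longlongrightarrow> to_l1 a (Lop h)) (at_right 0)"
proof -
  obtain g where h: "h \<in> Y0 a" and g: "g \<in> L1w a" "has_distr_deriv (\<lambda>x. x * h x) g"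
    using assms unfolding dom_L_def by blast
  show "h \<in> Y0 a" by (rule h)
  note hL = Y0_L1w[OF h]
  \<comment> \<open>\<open>Lop\<close> uses the chosen derivative g', whereas membership in the
    domain provides some g; uniqueness transfers weighted integrability to g'.\<close>
  define g' where "g' = distr_deriv (\<lambda>x. x * h x)"
  have g': "has_distr_deriv (\<lambda>x. x * h x) g'"
    unfolding g'_def distr_deriv_def by (rule someI[where P = "has_distr_deriv (\<lambda>x. x * h x)", OF g(2)])
  have ae: "AE x in lborel. g x = g' x" by (rule has_distr_deriv_unique[OF g(2) g'])
  have g'm: "g' \<in> borel_measurable borel"
    using g' locally_integrable_measurable unfolding has_distr_deriv_def by blast
  have g'L: "g' \<in> L1w a"
  proof -
    note [measurable] = g'm L1w_measurable[OF g(1)]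
    have "integrable lborel (\<lambda>x. g' x * weight a x)"
    proof (rule integrable_cong_AE_imp[OF L1w_integrable[OF g(1)]])
      show "AE x in lborel. g x * weight a x = g' x * weight a x"
        using ae by eventually_elim simp
    qed measurable
    with g'm show ?thesis by (simp add: L1w_def)
  qed
  have conv: "conv h \<in> L1w a" using a by (intro conv_bound(1)[OF _ _ hL]) auto
  have "(\<integral>x. h x \<partial>lborel) = 0" using h by (simp add: Y0_def)
  then have Lop: "Lop h = (\<lambda>x. 1 * (- (1 / 4) * g' x + 1 * conv h x) + (- 1) * h x)"
    by (simp add: Lop_def fun_eq_iff Q0_eq_conv g'_def)
  have k: "(\<lambda>x. - (1 / 4) * g' x + 1 * conv h x) \<in> L1w a" by (rule L1w_lincomb[OF g'L conv])
  have L: "Lop h \<in> L1w a" unfolding Lop by (rule L1w_lincomb[OF k hL])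
  have "to_l1 a (Lop h) = (- (1 / 4) *\<^sub>R to_l1 a g' - to_l1 a h) + conv_op a (to_l1 a h)"
    unfolding Lop to_l1_lincomb[OF k hL] to_l1_lincomb[OF g'L conv]
    using a conv_op_to_l1[OF _ _ hL] by simp
  then have lim: "((\<lambda>t. (dil_op a t (to_l1 a h) - to_l1 a h) /\<^sub>R t) \<longlongrightarrow> to_l1 a (Lop h) - conv_op a (to_l1 a h)) (at_right 0)"
    using distr_deriv_dil_op_generator[OF a hL g'L g'] by simp
  then show "has_generator_value (L1w_norm a) evolution h (Lop h)"
    by (simp only: has_generator_value_iff[OF hL L])
  show lim': "((\<lambda>t. (P.U t (to_l1 a h) - to_l1 a h) /\<^sub>R t) \<longlongrightarrow> to_l1 a (Lop h)) (at_right 0)"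
    unfolding P.U_generator by (rule lim)
  \<comment> \<open>The moments of \<open>Lop h\<close> vanish because it is a limit of difference
    quotients whose moments vanish.\<close>
  interpret m: bounded_linear "moments a" by (rule moments_linear[OF a])
  have m0: "moments a (to_l1 a h) = 0" using h by (simp add: Y0_iff[OF a hL])
  have "((\<lambda>t. moments a ((P.U t (to_l1 a h) - to_l1 a h) /\<^sub>R t)) \<longlongrightarrow> moments a (to_l1 a (Lop h))) (at_right 0)"
    by (rule m.tendsto[OF lim'])
  moreover have "\<forall>\<^sub>F t in at_right 0. moments a ((P.U t (to_l1 a h) - to_l1 a h) /\<^sub>R t) = 0"
    unfolding eventually_at_right_field
    using moments_U[OF m0] m0 by (intro exI[of _ 1]) (auto simp: m.scaleR m.diff)
  ultimately have "moments a (to_l1 a (Lop h)) = 0"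
    by (intro tendsto_unique[OF trivial_limit_at_right_real _ tendsto_eventually])
  then show "Lop h \<in> Y0 a" using L by (simp add: Y0_iff[OF a])
qed

lemma evolution_generates: "generates (Y0 a) (L1w_norm a) (dom_L a) Lop evolution"
  unfolding generates_def
proof (intro conjI ballI set_eqI iffI)
  show "strongly_continuous_semigroup (Y0 a) (L1w_norm a) evolution"
    by (rule evolution_strongly_continuous)
  fix h
  show "Lop h \<in> Y0 a" "has_generator_value (L1w_norm a) evolution h (Lop h)" if "h \<in> dom_L a"
    by (rule dom_L_generator[OF that])+
  show "h \<in> {h \<in> Y0 a. \<exists>g\<in>Y0 a. has_generator_value (L1w_norm a) evolution h g}" if "h \<in> dom_L a"
    using dom_L_generator[OF that] by blast
  \<comment> \<open>The remaining inclusion: convergent quotients force a distributional derivative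
    in the weighted space.\<close>
  assume "h \<in> {h \<in> Y0 a. \<exists>g\<in>Y0 a. has_generator_value (L1w_norm a) evolution h g}"
  then obtain g where h: "h \<in> Y0 a" and "g \<in> Y0 a" "has_generator_value (L1w_norm a) evolution h g"
    by blast
  then have "((\<lambda>t. (dil_op a t (to_l1 a h) - to_l1 a h) /\<^sub>R t) \<longlongrightarrow> to_l1 a g - conv_op a (to_l1 a h)) (at_right 0)"
    by (simp add: has_generator_value_iff Y0_L1w)
  from dil_op_generator_distr_deriv[OF a Y0_L1w[OF h] this] h show "h \<in> dom_L a"
    by (simp add: dom_L_def)
qed

text \<open>The slack in the assumption on \<nu> is what the truncation needs: with \<kappa>' = 1 -
  a / 4 - \<nu> there is room for \<kappa> strictly between 2^(1 - a) and \<kappa>', here the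
  midpoint.\<close>

lemma U_exponential_decay:
  assumes \<nu>: "\<nu> < 1 - a / 4 - 2 powr (1 - a)"
  shows "\<exists>C>0. \<forall>u t. 0 \<le> t \<longrightarrow> moments a u = 0 \<longrightarrow> norm (P.U t u) \<le> C * exp (- \<nu> * t) * norm u"
proof -
  define \<gamma> where "\<gamma> = 1 - a / 4"
  define \<beta> where "\<beta> = (2 :: real) powr (1 - a)"
  define \<kappa>' where "\<kappa>' = \<gamma> - \<nu>"
  define \<kappa> where "\<kappa> = (\<beta> + \<kappa>') / 2"
  have \<beta>: "0 < \<beta>" "\<beta> < \<kappa>'" "\<beta> < \<kappa>" "\<kappa> < \<kappa>'"
    using \<nu> by (auto simp: \<beta>_def \<gamma>_def \<kappa>'_def \<kappa>_def)
  obtain R C where R: "0 < R" "0 \<le> C" and RC: "\<And>u. norm (conv_op a u) \<le> \<kappa> * norm u + C * norm (cut a R u)"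
    using conv_op_norm_cut[OF a, of \<kappa>] \<beta>(3) unfolding \<beta>_def by blast
  obtain L where L: "0 \<le> L" and LR: "\<And>t u B. 0 \<le> t \<Longrightarrow> (\<And>\<xi>. norm (fourier a \<xi> u) \<le> B * \<bar>\<xi>\<bar> powr a)
      \<Longrightarrow> norm (cut a R (dil_op a t (conv_op a u))) \<le> L * exp (- \<gamma> * t) * B"
    using cut_dil_conv_bound[OF a R(1)] unfolding \<gamma>_def by blast
  have "\<exists>D>0. \<forall>u t. 0 \<le> t \<longrightarrow> (\<forall>\<xi>. norm (fourier a \<xi> u) \<le> norm u * \<bar>\<xi>\<bar> powr a)
      \<longrightarrow> norm (P.U t u) \<le> D * exp (- (\<gamma> - \<kappa>') * t) * norm u"
  proof (rule P.U_decay[where F = "fourier a" and P = "cut a R" and q = "\<lambda>\<xi>. \<bar>\<xi>\<bar> powr a" and L = L and C = C])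
    show "norm (dil_op a t u) \<le> exp (- \<gamma> * t) * norm u" if "0 \<le> t" for t u
      unfolding \<gamma>_def using a that by (intro dil_op_decay) auto
    show "bounded_linear (fourier a \<xi>)" for \<xi> by (rule fourier_linear[OF a])
    show "bounded_linear (cut a R)" by (rule cut_linear[OF a])
    show "norm (cut a R u) \<le> norm u" for u by (rule cut_le[OF a])
    show "norm (conv_op a u) \<le> \<kappa> * norm u + C * norm (cut a R u)" for u by (rule RC)
    \<comment> \<open>The transform of the dilation is sampled at the frequency \<xi> exp (t / 4),
      which costs exp (a t / 4): the same rate as in the weighted norm.\<close>
    show "norm (fourier a \<xi> (dil_op a t u)) \<le> exp (- \<gamma> * t) * B * \<bar>\<xi>\<bar> powr a"
      if "0 \<le> t" "\<And>\<eta>. norm (fourier a \<eta> u) \<le> B * \<bar>\<eta>\<bar> powr a" for t u B \<xi>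
    proof -
      have "norm (fourier a \<xi> (dil_op a t u)) = exp (- t) * norm (fourier a (\<xi> * exp (t / 4)) u)"
        by (simp add: fourier_dil_op[OF a])
      also have "\<dots> \<le> exp (- t) * (B * \<bar>\<xi> * exp (t / 4)\<bar> powr a)"
        by (intro mult_left_mono that) simp
      also have "\<bar>\<xi> * exp (t / 4)\<bar> powr a = \<bar>\<xi>\<bar> powr a * exp (a * t / 4)"
        by (simp add: abs_mult powr_mult) (simp add: powr_def)
      also have "exp (- t) * (B * (\<bar>\<xi>\<bar> powr a * exp (a * t / 4))) = (exp (- t) * exp (a * t / 4)) * B * \<bar>\<xi>\<bar> powr a"
        by (simp only: ac_simps)
      also have "exp (- t) * exp (a * t / 4) = exp (- \<gamma> * t)"
        by (simp add: \<gamma>_def algebra_simps flip: exp_add)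
      finally show ?thesis .
    qed
    \<comment> \<open>Mass doubles and the frequency is halved, hence 2 * 2^(- a).\<close>
    show "norm (fourier a \<xi> (conv_op a u)) \<le> \<beta> * B * \<bar>\<xi>\<bar> powr a"
      if "\<And>\<eta>. norm (fourier a \<eta> u) \<le> B * \<bar>\<eta>\<bar> powr a" for u B \<xi>
    proof -
      have "norm (fourier a \<xi> (conv_op a u)) \<le> 2 * norm (fourier a (\<xi> / 2) u)"
        by (rule fourier_conv_op[OF a])
      also have "\<dots> \<le> 2 * (B * \<bar>\<xi> / 2\<bar> powr a)" by (intro mult_left_mono that) simp
      also have "\<bar>\<xi> / 2\<bar> powr a = \<bar>\<xi>\<bar> powr a * 2 powr (- a)"
      proof -
        have "\<bar>\<xi> / 2\<bar> = \<bar>\<xi>\<bar> / 2" by simp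
        then show ?thesis by (simp only: powr_divide powr_minus inverse_eq_divide times_divide_eq_right mult_1_right)
      qed
      also have "2 * (B * (\<bar>\<xi>\<bar> powr a * 2 powr (- a))) = (2 * 2 powr (- a)) * B * \<bar>\<xi>\<bar> powr a"
        by (simp only: ac_simps)
      also have "2 * 2 powr (- a) = \<beta>"
        unfolding \<beta>_def using powr_add[of "2::real" 1 "- a"] by simp
      finally show ?thesis .
    qed
  qed (use \<beta> R L LR in auto)
  then obtain D where "0 < D" and D: "\<And>u t. 0 \<le> t \<Longrightarrow> (\<And>\<xi>. norm (fourier a \<xi> u) \<le> norm u * \<bar>\<xi>\<bar> powr a)
      \<Longrightarrow> norm (P.U t u) \<le> D * exp (- (\<gamma> - \<kappa>') * t) * norm u" by blast
  have "\<gamma> - \<kappa>' = \<nu>" by (simp add: \<kappa>'_def)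
  then have "norm (P.U t u) \<le> D * exp (- \<nu> * t) * norm u" if "0 \<le> t" "moments a u = 0" for t u
    using D[OF that(1) fourier_le[OF a that(2)]] by simp
  with \<open>0 < D\<close> show ?thesis by blast
qed

text \<open>A single C serves both conclusions, because the lower bound for the generator is derived
  from the decay estimate with that constant.\<close>

lemma evolution_decay:
  assumes \<nu>: "0 < \<nu>" "\<nu> < 1 - a / 4 - 2 powr (1 - a)"
  shows "\<exists>C>0. (\<forall>h\<in>Y0 a. \<forall>t\<ge>0. L1w_norm a (evolution t h) \<le> C * exp (- \<nu> * t) * L1w_norm a h) \<and>
    (\<forall>h\<in>dom_L a. L1w_norm a (Lop h) \<ge> \<nu> / C * L1w_norm a h)"
proof -
  obtain C where C: "0 < C" and
    decay: "\<And>u t. 0 \<le> t \<Longrightarrow> moments a u = 0 \<Longrightarrow> norm (P.U t u) \<le> C * exp (- \<nu> * t) * norm u"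
    using U_exponential_decay[OF \<nu>(2)] by blast
  interpret m: bounded_linear "moments a" by (rule moments_linear[OF a])
  have "L1w_norm a (evolution t h) \<le> C * exp (- \<nu> * t) * L1w_norm a h" if "h \<in> Y0 a" "0 \<le> t" for h t
    using decay[OF that(2), of "to_l1 a h"] that(1) Y0_L1w[OF that(1)]
    by (simp add: evolution_def norm_of_l1 norm_to_l1 Y0_iff[OF a])
  moreover have "\<nu> / C * L1w_norm a h \<le> L1w_norm a (Lop h)" if "h \<in> dom_L a" for h
  proof -
    note G = dom_L_generator[OF that]
    have "\<nu> / C * norm (to_l1 a h) \<le> norm (to_l1 a (Lop h))"
    proof (rule P.generator_lower_bound[where V = "{u. moments a u = 0}"])
      show "to_l1 a h \<in> {u. moments a u = 0}"
        using G(1) by (simp add: Y0_iff[OF a Y0_L1w[OF G(1)]])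
    qed (use decay moments_U C \<nu> G(4) in \<open>auto simp: m.diff\<close>)
    then show ?thesis by (simp add: norm_to_l1 Y0_L1w G(1,2))
  qed
  ultimately show ?thesis using C by blast
qed

end

theorem theorem1p7:
  fixes a :: real
  assumes "2 < a" and "a < 3"
  shows "\<exists>S. generates (Y0 a) (L1w_norm a) (dom_L a) Lop S \<and>
    (\<forall>\<nu>. 0 < \<nu> \<and> \<nu> < 1 - a / 4 - 2 powr (1 - a) \<longrightarrow>
      (\<exists>C>0. (\<forall>h\<in>Y0 a. \<forall>t\<ge>0. L1w_norm a (S t h) \<le> C * exp (- \<nu> * t) * L1w_norm a h) \<and>
             (\<forall>h\<in>dom_L a. L1w_norm a (Lop h) \<ge> \<nu> / C * L1w_norm a h)))"
  using evolution_generates[OF assms] evolution_decay[OF assms] by blast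

end
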